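(* Let $U\subset D(A^\infty)$ be an open set on which $D_{LA}$ has locally constant dimension $k_D\in\mathbb{N}$, and suppose that the maps $$(\ell,\ell\circ A,\dots,\ell\circ A^r):D(A^\infty)\to B^{r+1}$$ are open for all integers $r\ge0$. Then, locally (i.e. for every $h_0\in U$, on some open neighborhood of $h_0$), there exist $k_D-1$ linearly independent (constant) vectors $\Lambda_1,\dots,\Lambda_{k_D-1}\in D(A^\infty)$ such that $$D_{LA}(h)=\langle\mu(h),\Lambda_1,\dots,\Lambda_{k_D-1}\rangle\quad\text{and}\quad\sigma^j(h)\in\langle\Lambda_1,\dots,\Lambda_{k_D-1}\rangle,\ j=1,\dots,d,$$ for all $h$ in that neighborhood.
   Context: Smoothness: a curve into a Fréchet space is smooth if all derivatives exist as limits of difference quotients; a map between open subsets of Fréchet spaces is smooth if it maps smooth curves to smooth curves. The Lie bracket of vector fields (smooth maps $U\to E$, $U$ open in a Fréchet space $E$) is $[X,Y](x)=DX(x)\cdot Y(x)-DY(x)\cdot X(x)$. $\langle\dots\rangle$ denotes real linear span. Setting: $H$ is a separable Hilbert space of continuous functions $\mathbb{R}_{\ge0}\to\mathbb{R}$ such that: the point evaluations $ev_x:h\mapsto h(x)$ are continuous on $H$; the shifts $S(t)f(x)=f(t+x)$, $t\ge 0$, form a strongly continuous semigroup on $H$, with generator $A$, where $D(A)=\{h\in H\cap C^1(\mathbb{R}_{\ge0};\mathbb{R}) : h'\in H\}$ and $Ah=h'$; there is a closed subspace $H_0\subset H$ such that $\mathcal{S}(f,g)(x):=f(x)\int_0^x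 g(\eta)\,d\eta$ defines a continuous bilinear map $\mathcal{S}:H_0\times H_0\to H$. Write $\mathcal{S}(f)=\mathcal{S}(f,f)$. $D(A^\infty)=\bigcap_n D(A^n)$ is the Fréchet space with seminorms $p_n(h)=\sum_{m=0}^n\|A^mh\|_H$, $n\ge0$. $A_0$ is the restriction of $A$ to $H_0$, $D(A_0)=\{h\in D(A)\cap H_0: Ah\in H_0\}$, and $D(A_0^\infty)=\bigcap_n D(A_0^n)$ is the analogous Fréchet space. Let $d\in\mathbb{N}$, $d\ge1$, $B$ a Banach space, $\ell:H\to B$ continuous linear, $\phi=(\phi^1,\dots,\phi^d):B\to D(A_0^\infty)^d$ smooth, and assume: $(\ell,\ell\circ A):D(A^\infty)\to B\times B$ is an open map; $\phi^1(y),\dots,\phi^d(y)$ are linearly independent for each $y\in B$; $A$ is unbounded, i.e. $D(A)\ne H$. Put $\sigma^j(h)=\phi^j(\ell(h))$ and $$\mu(h)=Ah+\sum_{j=1}^d\mathcal{S}(\sigma^j(h))-\tfrac12\sum_{j=1}^dD\sigma^j(h)\sigma^j(h),\qquad h\in D(A^\infty).$$ These are smooth vector fields on $D(A^\infty)$. $D_{LA}$ is the distribution on $D(A^\infty)$ whose value $D_{LA}(h)$ is the linear span of the values at $h$ of $\mu,\sigma^1,\dots,\sigma^d$ and all their iterated (multiple) Lie brackets. *)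

theory Defs
  imports "HOL-Analysis.Analysis"
begin

section \<open>Calculus in Frechet spaces\<close>

text \<open>A Frechet space is given by a carrier \<open>E\<close> inside a real vector space and a sequence of
  seminorms \<open>p n\<close>; the calculus below refers only to the resulting topology (whose
  \<^const>\<open>topspace\<close> is \<open>E\<close>). A Banach space type enters as \<^const>\<open>euclidean\<close>.\<close>

definition seminorm_topology :: "'a::real_vector set \<Rightarrow> (nat \<Rightarrow> 'a \<Rightarrow> real) \<Rightarrow> 'a topology" where
  "seminorm_topology E p =
     topology_generated_by {{y \<in> E. p n (y - x) < e} | x n e. x \<in> E \<and> 0 < e}"

text \<open>\<open>C n\<close> is the \<open>n\<close>-th derivative of the curve.\<close>

definition smooth_curve :: "'a::real_vector topology \<Rightarrow> (real \<Rightarrow> 'a) \<Rightarrow> bool" where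
  "smooth_curve X c \<longleftrightarrow>
     range c \<subseteq> topspace X \<and>
     (\<exists>C :: nat \<Rightarrow> real \<Rightarrow> 'a. C 0 = c \<and>
        (\<forall>n t. limitin X (\<lambda>s. (C n (t + s) - C n t) /\<^sub>R s) (C (Suc n) t) (at 0)))"

definition smooth_map ::
  "'a::real_vector topology \<Rightarrow> 'b::real_vector topology \<Rightarrow> ('a \<Rightarrow> 'b) \<Rightarrow> bool" where
  "smooth_map X Y f \<longleftrightarrow>
     f ` topspace X \<subseteq> topspace Y \<and>
     (\<forall>c. smooth_curve X c \<longrightarrow> smooth_curve Y (f \<circ> c))"

text \<open>\<open>dir_deriv Y f x v\<close> is \<open>Df(x) v\<close>, the limit being taken in \<open>Y\<close>.\<close>

definition dir_deriv ::
  "'b::real_vector topology \<Rightarrow> ('a::real_vector \<Rightarrow> 'b) \<Rightarrow> 'a \<Rightarrow> 'a \<Rightarrow> 'b" where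
  "dir_deriv Y f x v = (THE w. limitin Y (\<lambda>s::real. (f (x + s *\<^sub>R v) - f x) /\<^sub>R s) w (at 0))"

definition lie_bracket ::
  "'a::real_vector topology \<Rightarrow> ('a \<Rightarrow> 'a) \<Rightarrow> ('a \<Rightarrow> 'a) \<Rightarrow> 'a \<Rightarrow> 'a" where
  "lie_bracket X V W = (\<lambda>x. dir_deriv X V x (W x) - dir_deriv X W x (V x))"

inductive_set iterated_brackets ::
  "'a::real_vector topology \<Rightarrow> ('a \<Rightarrow> 'a) set \<Rightarrow> ('a \<Rightarrow> 'a) set"
  for X :: "'a topology" and G :: "('a \<Rightarrow> 'a) set" where
  generator: "V \<in> G \<Longrightarrow> V \<in> iterated_brackets X G"
| bracket: "V \<in> iterated_brackets X G \<Longrightarrow> W \<in> iterated_brackets X G \<Longrightarrow>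
    lie_bracket X V W \<in> iterated_brackets X G"

definition lin_indep_family :: "nat set \<Rightarrow> (nat \<Rightarrow> 'a::real_vector) \<Rightarrow> bool" where
  "lin_indep_family I v \<longleftrightarrow> inj_on v I \<and> independent (v ` I)"


section \<open>Strongly continuous semigroups and powers of unbounded operators\<close>

definition c0_semigroup :: "(real \<Rightarrow> 'h::real_normed_vector \<Rightarrow> 'h) \<Rightarrow> bool" where
  "c0_semigroup T \<longleftrightarrow>
     (\<forall>t\<ge>0. bounded_linear (T t)) \<and>
     (\<forall>h. T 0 h = h) \<and>
     (\<forall>s\<ge>0. \<forall>t\<ge>0. \<forall>h. T (s + t) h = T s (T t h)) \<and>
     (\<forall>h. ((\<lambda>t. T t h) \<longlongrightarrow> h) (at_right 0))"

definition generator_dom :: "(real \<Rightarrow> 'h::real_normed_vector \<Rightarrow> 'h) \<Rightarrow> 'h set" where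
  "generator_dom T = {h. \<exists>l. ((\<lambda>t. (T t h - h) /\<^sub>R t) \<longlongrightarrow> l) (at_right 0)}"

definition generator :: "(real \<Rightarrow> 'h::real_normed_vector \<Rightarrow> 'h) \<Rightarrow> 'h \<Rightarrow> 'h" where
  "generator T h = Lim (at_right 0) (\<lambda>t. (T t h - h) /\<^sub>R t)"

text \<open>An operator on the space \<open>S\<close> with domain \<open>D\<close> is a function \<open>A\<close> whose values outside \<open>D\<close>
  are irrelevant.\<close>

primrec pow_dom :: "'h set \<Rightarrow> 'h set \<Rightarrow> ('h \<Rightarrow> 'h) \<Rightarrow> nat \<Rightarrow> 'h set" where
  "pow_dom S D A 0 = S"
| "pow_dom S D A (Suc n) = {h \<in> D. A h \<in> pow_dom S D A n}"

definition dom_infty :: "'h set \<Rightarrow> 'h set \<Rightarrow> ('h \<Rightarrow> 'h) \<Rightarrow> 'h set" where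
  "dom_infty S D A = (\<Inter>n. pow_dom S D A n)"

definition graph_seminorm :: "('h \<Rightarrow> 'h::real_normed_vector) \<Rightarrow> nat \<Rightarrow> 'h \<Rightarrow> real" where
  "graph_seminorm A n h = (\<Sum>m=0..n. norm ((A ^^ m) h))"


section \<open>Hilbert spaces of forward curves\<close>

text \<open>The Hilbert space of functions is represented by an abstract Hilbert space type \<open>'h\<close> and
  an evaluation map \<open>ev\<close>, where \<open>ev h x\<close> is \<open>h(x)\<close>. Only arguments \<open>x \<ge> 0\<close> matter.\<close>

definition represents :: "('h \<Rightarrow> real \<Rightarrow> real) \<Rightarrow> 'h \<Rightarrow> (real \<Rightarrow> real) \<Rightarrow> bool" where
  "represents ev h f \<longleftrightarrow> (\<forall>x\<ge>0. ev h x = f x)"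

definition curve_of :: "('h \<Rightarrow> real \<Rightarrow> real) \<Rightarrow> (real \<Rightarrow> real) \<Rightarrow> 'h" where
  "curve_of ev f = (THE h. represents ev h f)"

definition shift :: "('h \<Rightarrow> real \<Rightarrow> real) \<Rightarrow> real \<Rightarrow> 'h \<Rightarrow> 'h" where
  "shift ev t h = curve_of ev (\<lambda>x. ev h (t + x))"

definition hjm_S :: "('h \<Rightarrow> real \<Rightarrow> real) \<Rightarrow> 'h \<Rightarrow> 'h \<Rightarrow> 'h" where
  "hjm_S ev f g = curve_of ev (\<lambda>x. ev f x * integral {0..x} (ev g))"

abbreviation opA :: "('h::real_normed_vector \<Rightarrow> real \<Rightarrow> real) \<Rightarrow> 'h \<Rightarrow> 'h" where
  "opA ev \<equiv> generator (shift ev)"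

abbreviation domA :: "('h::real_normed_vector \<Rightarrow> real \<Rightarrow> real) \<Rightarrow> 'h set" where
  "domA ev \<equiv> generator_dom (shift ev)"

definition domA0 :: "('h::real_normed_vector \<Rightarrow> real \<Rightarrow> real) \<Rightarrow> 'h set \<Rightarrow> 'h set" where
  "domA0 ev H0 = {h \<in> domA ev \<inter> H0. opA ev h \<in> H0}"

definition DAinf :: "('h::real_normed_vector \<Rightarrow> real \<Rightarrow> real) \<Rightarrow> 'h topology" where
  "DAinf ev = seminorm_topology (dom_infty UNIV (domA ev) (opA ev)) (graph_seminorm (opA ev))"

definition DA0inf :: "('h::real_normed_vector \<Rightarrow> real \<Rightarrow> real) \<Rightarrow> 'h set \<Rightarrow> 'h topology" where
  "DA0inf ev H0 =
     seminorm_topology (dom_infty H0 (domA0 ev H0) (opA ev)) (graph_seminorm (opA ev))"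

text \<open>In \<open>generator_C1\<close> the derivative at \<open>0\<close> is one-sided, and continuity of the derivative is
  part of \<open>k\<close> being an element of the space (\<open>ev_continuous\<close>).\<close>

locale forward_curve_space =
  fixes ev :: "'h::{real_inner,complete_space} \<Rightarrow> real \<Rightarrow> real"
    and H0 :: "'h set"
  assumes separable: "\<exists>Q::'h set. countable Q \<and> closure Q = UNIV"
    and ev_inject: "\<And>g h. (\<forall>x\<ge>0. ev g x = ev h x) \<Longrightarrow> g = h"
    and ev_continuous: "\<And>h. continuous_on {0..} (ev h)"
    and ev_bounded_linear: "\<And>x. x \<ge> 0 \<Longrightarrow> bounded_linear (\<lambda>h. ev h x)"
    and shift_closed: "\<And>t h. t \<ge> 0 \<Longrightarrow> \<exists>k. represents ev k (\<lambda>x. ev h (t + x))"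
    and shift_semigroup: "c0_semigroup (shift ev)"
    and generator_C1: "domA ev =
      {h. \<exists>k. \<forall>x\<ge>0. (ev h has_real_derivative ev k x) (at x within {0..})}"
    and generator_deriv: "\<And>h x. h \<in> domA ev \<Longrightarrow> x \<ge> 0 \<Longrightarrow>
      (ev h has_real_derivative ev (opA ev h) x) (at x within {0..})"
    and H0_subspace: "subspace H0"
    and H0_closed: "closed H0"
    and S_closed: "\<And>f g. f \<in> H0 \<Longrightarrow> g \<in> H0 \<Longrightarrow>
      \<exists>k. represents ev k (\<lambda>x. ev f x * integral {0..x} (ev g))"
    and S_continuous: "continuous_on (H0 \<times> H0) (\<lambda>(f, g). hjm_S ev f g)"


section \<open>The drift and the distribution\<close>

definition vol :: "('h \<Rightarrow> 'b) \<Rightarrow> (nat \<Rightarrow> 'b \<Rightarrow> 'h) \<Rightarrow> nat \<Rightarrow> 'h \<Rightarrow> 'h" where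
  "vol l \<phi> j h = \<phi> j (l h)"

definition drift :: "('h::real_normed_vector \<Rightarrow> real \<Rightarrow> real) \<Rightarrow> nat \<Rightarrow> ('h \<Rightarrow> 'b) \<Rightarrow>
    (nat \<Rightarrow> 'b \<Rightarrow> 'h) \<Rightarrow> 'h \<Rightarrow> 'h" where
  "drift ev d l \<phi> h =
     opA ev h + (\<Sum>j=1..d. hjm_S ev (vol l \<phi> j h) (vol l \<phi> j h))
       - (1/2) *\<^sub>R (\<Sum>j=1..d. dir_deriv (DAinf ev) (vol l \<phi> j) h (vol l \<phi> j h))"

definition D_LA :: "('h::real_normed_vector \<Rightarrow> real \<Rightarrow> real) \<Rightarrow> nat \<Rightarrow> ('h \<Rightarrow> 'b) \<Rightarrow>
    (nat \<Rightarrow> 'b \<Rightarrow> 'h) \<Rightarrow> 'h \<Rightarrow> 'h set" where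
  "D_LA ev d l \<phi> h =
     span ((\<lambda>V. V h) `
       iterated_brackets (DAinf ev) (insert (drift ev d l \<phi>) (vol l \<phi> ` {1..d})))"

end

theory Submission
  imports Defs
begin

text \<open>Every iterated bracket other than \<open>\<mu>\<close> depends on \<open>h\<close> only through finitely many of the jets
  \<open>\<ell>(h), \<ell>(A h), \<ell>(A\<^sup>2 h), \<dots>\<close>, whereas \<open>\<mu>(h + u) = \<mu>(h) + A u\<close> if \<open>\<ell>(u) = 0\<close>. Let \<open>W(h)\<close> be the span of the
  values of these brackets and \<open>K\<^sub>n\<close> the set of vectors whose first \<open>n\<close> jets vanish. If \<open>\<mu>(h)\<close> were in
  \<open>W(h)\<close>, then translating \<open>h\<close> by \<open>u \<in> K\<^sub>n\<close> would show \<open>A u \<in> W(h)\<close>, so that \<open>A(K\<^sub>n)\<close> would be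
  finite-dimensional, which contradicts the openness of the jet maps and the unboundedness of \<open>A\<close>. Hence
  \<open>W\<close> has constant dimension \<open>k\<^sub>D - 1\<close>, and \<open>[\<mu>, V] \<in> W\<close> forces \<open>W\<close> to be invariant under
  translations by \<open>K\<^sub>n\<close> for smaller and smaller \<open>n\<close>, so that it is locally constant.

  All this rests on the fact that directional derivatives of maps which are smooth along smooth
  curves exist, are additive in the direction and are again smooth along smooth curves; it reduces to
  Boman's theorem for two real variables.\<close>

section \<open>Smooth curves in normed spaces\<close>

text \<open>Vector fields on a Frechet space need not have flows, so the usual proof of Frobenius'
  theorem is not at hand. Invariance of \<open>W\<close> is instead integrated along straight
  segments in a convex neighbourhood: a frame whose derivatives along the segment lie in its own
  span keeps that span, by a Gronwall estimate in the ambient Hilbert space. Straight segments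
  suffice because the relevant directions form the linear spaces \<open>K n\<close>. The descent has
  a starting point because a basis of \<open>W\<close> at one point involves finitely many brackets,
  hence finitely many jets, and stays a basis nearby. It proceeds because finite jets can be
  prescribed at will, so that every element of \<open>K n\<close> has the form
  \<open>A u + u'\<close> with \<open>u\<close> and \<open>u'\<close> in \<open>K (n + 1)\<close>.
  Two real variables are enough for the calculus: the derivative of \<open>f\<close> at
  \<open>c t\<close> in the direction \<open>w t\<close> is the derivative in \<open>s\<close> at
  \<open>s = 0\<close> of \<open>f (c t + s w t)\<close>, a function of \<open>t\<close> and
  \<open>s\<close> that is smooth along every smooth plane curve. Smoothness of this derivative in
  \<open>t\<close> is exactly what allows brackets to be iterated.\<close>

primrec times_diff :: "nat \<Rightarrow> (real \<Rightarrow> 'v::real_normed_vector) \<Rightarrow> bool" where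
  "times_diff 0 f \<longleftrightarrow> True"
| "times_diff (Suc n) f \<longleftrightarrow>
     (\<exists>f'. (\<forall>t. (f has_vector_derivative f' t) (at t)) \<and> times_diff n f')"

definition smth :: "(real \<Rightarrow> 'v::real_normed_vector) \<Rightarrow> bool" where
  "smth f \<longleftrightarrow> (\<forall>n. times_diff n f)"

text \<open>\<open>times_diff\<close> quantifies over the derivative, which makes closure rules
  plain inductions; \<open>hderiv\<close> names the derivatives for estimates.\<close>

primrec hderiv :: "nat \<Rightarrow> (real \<Rightarrow> 'v::real_normed_vector) \<Rightarrow> real \<Rightarrow> 'v" where
  "hderiv 0 f = f"
| "hderiv (Suc n) f = (\<lambda>t. vector_derivative (hderiv n f) (at t))"

lemma times_diff_SucD: "times_diff (Suc n) f \<Longrightarrow> times_diff n f"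
proof (induction n arbitrary: f)
  case (Suc n)
  then obtain f' where "\<And>t. (f has_vector_derivative f' t) (at t)" "times_diff (Suc n) f'"
    by (subst (asm) times_diff.simps(2)) blast
  with Suc.IH show ?case by auto
qed simp

text \<open>The derivative chosen in \<open>times_diff\<close> might depend on the order; uniqueness
  of derivatives makes it the same for all orders.\<close>

lemma smth_hderiv1:
  assumes "smth f"
  shows "(f has_vector_derivative hderiv 1 f t) (at t)" "smth (hderiv 1 f)"
proof -
  have ex: "\<exists>f'. (\<forall>t. (f has_vector_derivative f' t) (at t)) \<and> times_diff n f'" for n
    using assms unfolding smth_def by (metis times_diff.simps(2))
  have eq: "f' = hderiv 1 f" if "\<forall>t. (f has_vector_derivative f' t) (at t)" for f'
    using that by (auto simp: fun_eq_iff vector_derivative_at[symmetric])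
  show "(f has_vector_derivative hderiv 1 f t) (at t)" using ex[of 0] eq by blast
  show "smth (hderiv 1 f)" unfolding smth_def using ex eq by blast
qed

lemma smth_hderiv: "smth f \<Longrightarrow> smth (hderiv n f)"
proof (induction n)
  case (Suc n)
  then show ?case using smth_hderiv1(2)[of "hderiv n f"] by simp
qed simp

lemma has_hderiv: "smth f \<Longrightarrow> (hderiv n f has_vector_derivative hderiv (Suc n) f t) (at t)"
  using smth_hderiv1(1)[OF smth_hderiv, of f n t] by simp

lemma smthI_deriv:
  assumes "\<And>t. (f has_vector_derivative f' t) (at t)" "smth f'"
  shows "smth f"
  unfolding smth_def
proof
  fix n show "times_diff n f"
    using assms by (cases n) (auto simp: smth_def)
qed

text \<open>Exhibiting the whole sequence of candidate derivatives proves smoothness and computes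
  every \<open>hderiv\<close> at the same time.\<close>

lemma smthI_seq:
  assumes "\<And>n t. (C n has_vector_derivative C (Suc n) t) (at t)"
  shows "smth (C 0)" "hderiv n (C 0) = C n"
proof -
  have "times_diff k (C n)" for k n
    by (induction k arbitrary: n) (use assms in auto)
  then show "smth (C 0)" by (simp add: smth_def)
  show "hderiv n (C 0) = C n"
    by (induction n) (auto simp: assms vector_derivative_at)
qed

lemma smth_continuous: "smth f \<Longrightarrow> continuous_on S (hderiv n f)"
  by (meson continuous_at_imp_continuous_on has_hderiv has_vector_derivative_continuous)

lemma smth_const [simp]: "smth (\<lambda>t. c)"
  using smthI_seq(1)[of "\<lambda>n t. if n = 0 then c else 0"] by (force intro: derivative_eq_intros)

lemma smth_ident [simp]: "smth (\<lambda>t. t)"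
  by (rule smthI_deriv[where f' = "\<lambda>t. 1"]) (auto intro!: derivative_eq_intros)

lemma times_diff_add:
  "times_diff n f \<Longrightarrow> times_diff n g \<Longrightarrow> times_diff n (\<lambda>t. f t + g t)"
proof (induction n arbitrary: f g)
  case (Suc n)
  then obtain f' g' where d: "\<And>t. (f has_vector_derivative f' t) (at t)" "times_diff n f'"
      "\<And>t. (g has_vector_derivative g' t) (at t)" "times_diff n g'"
    by auto
  have "\<forall>t. ((\<lambda>t. f t + g t) has_vector_derivative f' t + g' t) (at t)"
    using d by (auto intro!: has_vector_derivative_add)
  moreover have "times_diff n (\<lambda>t. f' t + g' t)" using Suc.IH d by blast
  ultimately show ?case by auto
qed simp

lemma smth_add: "smth f \<Longrightarrow> smth g \<Longrightarrow> smth (\<lambda>t. f t + g t)"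
  by (simp add: smth_def times_diff_add)

lemma times_diff_bounded_linear:
  assumes "bounded_linear L"
  shows "times_diff n f \<Longrightarrow> times_diff n (\<lambda>t. L (f t))"
proof (induction n arbitrary: f)
  case (Suc n)
  then obtain f' where d: "\<And>t. (f has_vector_derivative f' t) (at t)" "times_diff n f'" by auto
  have "\<forall>t. ((\<lambda>t. L (f t)) has_vector_derivative L (f' t)) (at t)"
    using d bounded_linear.has_vector_derivative[OF assms] by blast
  with Suc.IH[OF d(2)] show ?case by auto
qed simp

lemma smth_bounded_linear: "bounded_linear L \<Longrightarrow> smth f \<Longrightarrow> smth (\<lambda>t. L (f t))"
  by (simp add: smth_def times_diff_bounded_linear)

lemma smth_scale: "smth f \<Longrightarrow> smth (\<lambda>t. a *\<^sub>R f t)"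
  by (rule smth_bounded_linear[OF bounded_linear_scaleR_right])

lemma smth_uminus: "smth f \<Longrightarrow> smth (\<lambda>t. - f t)"
  using smth_scale[of f "-1"] by simp

lemma smth_diff: "smth f \<Longrightarrow> smth g \<Longrightarrow> smth (\<lambda>t. f t - g t)"
  using smth_add[OF _ smth_uminus] by fastforce

text \<open>Links derivatives in the norm with the difference quotients that define
  \<open>smooth_curve\<close> and \<open>dir_deriv\<close>.\<close>

lemma has_vector_derivative_iff_quotient:
  "(f has_vector_derivative f') (at t) \<longleftrightarrow> ((\<lambda>s. (f (t + s) - f t) /\<^sub>R s) \<longlongrightarrow> f') (at 0)"
proof -
  have "(f has_vector_derivative f') (at t) \<longleftrightarrow>
      ((\<lambda>s. norm (f (t + s) - f t - s *\<^sub>R f') / norm s) \<longlongrightarrow> 0) (at 0)"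
    unfolding has_vector_derivative_def has_derivative_at
    by (simp add: bounded_linear_scaleR_left)
  also have "\<dots> \<longleftrightarrow> ((\<lambda>s. norm ((f (t + s) - f t) /\<^sub>R s - f')) \<longlongrightarrow> 0) (at 0)"
  proof (rule tendsto_cong)
    have "norm (f (t + s) - f t - s *\<^sub>R f') / norm s = norm ((f (t + s) - f t) /\<^sub>R s - f')"
      if "s \<noteq> 0" for s
    proof -
      have "(f (t + s) - f t) /\<^sub>R s - f' = (f (t + s) - f t - s *\<^sub>R f') /\<^sub>R s"
        using that by (simp add: algebra_simps)
      then show ?thesis by (simp add: divide_inverse mult.commute)
    qed
    then show "\<forall>\<^sub>F s in at 0. norm (f (t + s) - f t - s *\<^sub>R f') / norm s =
        norm ((f (t + s) - f t) /\<^sub>R s - f')"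
      by (simp add: eventually_at_filter)
  qed
  also have "\<dots> \<longleftrightarrow> ((\<lambda>s. (f (t + s) - f t) /\<^sub>R s) \<longlongrightarrow> f') (at 0)"
    by (simp add: tendsto_norm_zero_iff Lim_null[symmetric])
  finally show ?thesis .
qed

text \<open>Keeps the product rule inside the subspaces on which a bilinear map is
  controlled.\<close>

lemma has_vector_derivative_in_closed_subspace:
  assumes "(f has_vector_derivative f') (at t)" "\<And>t. f t \<in> Z" "subspace Z" "closed Z"
  shows "f' \<in> Z"
proof -
  have "((\<lambda>s. (f (t + s) - f t) /\<^sub>R s) \<longlongrightarrow> f') (at 0)"
    using assms(1) has_vector_derivative_iff_quotient by blast
  then show ?thesis
    by (rule Lim_in_closed_set[OF \<open>closed Z\<close>, rotated 2])
      (use assms in \<open>auto intro!: always_eventually subspace_scale subspace_diff\<close>)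
qed

text \<open>The subspaces accommodate \<open>hjm_S\<close>, which is bilinear on \<open>H0\<close> only.\<close>

locale bounded_bilinear_on =
  fixes b :: "'a::real_normed_vector \<Rightarrow> 'b::real_normed_vector \<Rightarrow> 'c::real_normed_vector"
    and Y Z and K :: real
  assumes Y: "subspace Y" "closed Y" and Z: "subspace Z" "closed Z"
    and add_left: "\<And>x x' z. x \<in> Y \<Longrightarrow> x' \<in> Y \<Longrightarrow> z \<in> Z \<Longrightarrow> b (x + x') z = b x z + b x' z"
    and add_right: "\<And>x z z'. x \<in> Y \<Longrightarrow> z \<in> Z \<Longrightarrow> z' \<in> Z \<Longrightarrow> b x (z + z') = b x z + b x z'"
    and scale_left: "\<And>x z r. x \<in> Y \<Longrightarrow> z \<in> Z \<Longrightarrow> b (r *\<^sub>R x) z = r *\<^sub>R b x z"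
    and scale_right: "\<And>x z r. x \<in> Y \<Longrightarrow> z \<in> Z \<Longrightarrow> b x (r *\<^sub>R z) = r *\<^sub>R b x z"
    and bounded: "\<And>x z. x \<in> Y \<Longrightarrow> z \<in> Z \<Longrightarrow> norm (b x z) \<le> K * norm x * norm z"
begin

lemma diff_left: "x \<in> Y \<Longrightarrow> x' \<in> Y \<Longrightarrow> z \<in> Z \<Longrightarrow> b (x - x') z = b x z - b x' z"
  using add_left[of x "- 1 *\<^sub>R x'" z] scale_left[of x' z "-1"] Y by (simp add: subspace_neg)

lemma diff_right: "x \<in> Y \<Longrightarrow> z \<in> Z \<Longrightarrow> z' \<in> Z \<Longrightarrow> b x (z - z') = b x z - b x z'"
  using add_right[of x z "- 1 *\<^sub>R z'"] scale_right[of x z' "-1"] Z by (simp add: subspace_neg)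

lemma tendsto:
  assumes "(f \<longlongrightarrow> x) F" "(g \<longlongrightarrow> z) F" "\<And>t. f t \<in> Y" "\<And>t. g t \<in> Z" "x \<in> Y" "z \<in> Z"
  shows "((\<lambda>t. b (f t) (g t)) \<longlongrightarrow> b x z) F"
proof -
  have "((\<lambda>t. b (f t) (g t) - b x z) \<longlongrightarrow> 0) F"
  proof (rule Lim_null_comparison)
    have "norm (b (f t) (g t) - b x z) \<le> K * norm (f t - x) * norm (g t) + K * norm x * norm (g t - z)" for t
    proof -
      have "b (f t) (g t) - b x z = b (f t - x) (g t) + b x (g t - z)"
        using assms by (simp add: diff_left diff_right)
      also have "norm \<dots> \<le> norm (b (f t - x) (g t)) + norm (b x (g t - z))"
        by (rule norm_triangle_ineq)
      also have "\<dots> \<le> K * norm (f t - x) * norm (g t) + K * norm x * norm (g t - z)"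
        using assms Y Z by (intro add_mono bounded) (auto intro: subspace_diff)
      finally show ?thesis .
    qed
    then show "\<forall>\<^sub>F t in F. norm (b (f t) (g t) - b x z)
        \<le> K * norm (f t - x) * norm (g t) + K * norm x * norm (g t - z)" by simp
    have "((\<lambda>t. K * norm (f t - x) * norm (g t) + K * norm x * norm (g t - z)) \<longlongrightarrow>
        K * norm (x - x) * norm z + K * norm x * norm (z - z)) F"
      using assms by (intro tendsto_intros)
    then show "((\<lambda>t. K * norm (f t - x) * norm (g t) + K * norm x * norm (g t - z)) \<longlongrightarrow> 0) F"
      by simp
  qed
  then show ?thesis using Lim_null by blast
qed

lemma has_vector_derivative:
  assumes f: "(f has_vector_derivative f') (at t)" and g: "(g has_vector_derivative g') (at t)"
    and "\<And>t. f t \<in> Y" "\<And>t. g t \<in> Z"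
  shows "((\<lambda>t. b (f t) (g t)) has_vector_derivative b (f t) g' + b f' (g t)) (at t)"
proof -
  have in': "f' \<in> Y" "g' \<in> Z"
    using assms Y Z has_vector_derivative_in_closed_subspace by blast+
  have cont: "((\<lambda>s. g (t + s)) \<longlongrightarrow> g t) (at 0)"
    using has_vector_derivative_continuous[OF g] by (simp add: isCont_iff)
  have "((\<lambda>s. b (f t) ((g (t + s) - g t) /\<^sub>R s) + b ((f (t + s) - f t) /\<^sub>R s) (g (t + s)))
      \<longlongrightarrow> b (f t) g' + b f' (g t)) (at 0)"
    using assms Y Z in' cont unfolding has_vector_derivative_iff_quotient
    by (intro tendsto_add tendsto tendsto_const) (auto intro!: subspace_scale subspace_diff)
  moreover have "b (f t) ((g (t + s) - g t) /\<^sub>R s) + b ((f (t + s) - f t) /\<^sub>R s) (g (t + s))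
      = (b (f (t + s)) (g (t + s)) - b (f t) (g t)) /\<^sub>R s" for s
  proof -
    have "b (f t) ((g (t + s) - g t) /\<^sub>R s) = (b (f t) (g (t + s)) - b (f t) (g t)) /\<^sub>R s"
      using assms Y Z by (simp only: scale_right diff_right subspace_diff)
    moreover have "b ((f (t + s) - f t) /\<^sub>R s) (g (t + s)) =
        (b (f (t + s)) (g (t + s)) - b (f t) (g (t + s))) /\<^sub>R s"
      using assms Y Z by (simp only: scale_left diff_left subspace_diff)
    ultimately show ?thesis by (simp add: scaleR_diff_right)
  qed
  ultimately show ?thesis unfolding has_vector_derivative_iff_quotient by simp
qed

lemma times_diff:
  assumes "times_diff n f" "times_diff n g" "\<And>t. f t \<in> Y" "\<And>t. g t \<in> Z"
  shows "times_diff n (\<lambda>t. b (f t) (g t))"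
  using assms
proof (induction n arbitrary: f g)
  case (Suc n)
  then obtain f' g' where d: "\<And>t. (f has_vector_derivative f' t) (at t)" "times_diff n f'"
      "\<And>t. (g has_vector_derivative g' t) (at t)" "times_diff n g'"
    by auto
  have in': "f' t \<in> Y" "g' t \<in> Z" for t
    using d Suc.prems Y Z has_vector_derivative_in_closed_subspace by blast+
  have "\<forall>t. ((\<lambda>t. b (f t) (g t)) has_vector_derivative b (f t) (g' t) + b (f' t) (g t)) (at t)"
    using d Suc.prems has_vector_derivative by blast
  moreover have "times_diff n (\<lambda>t. b (f t) (g' t) + b (f' t) (g t))"
    using Suc d in' by (intro times_diff_add Suc.IH) (auto simp del: times_diff.simps intro: times_diff_SucD)
  ultimately show ?case by auto
qed simp

lemma smth: "smth f \<Longrightarrow> smth g \<Longrightarrow> (\<And>t. f t \<in> Y) \<Longrightarrow> (\<And>t. g t \<in> Z) \<Longrightarrow> smth (\<lambda>t. b (f t) (g t))"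
  by (simp add: smth_def times_diff)

end

lemma smth_scaleR:
  fixes f :: "real \<Rightarrow> real" and g :: "real \<Rightarrow> 'v::real_normed_vector"
  shows "smth f \<Longrightarrow> smth g \<Longrightarrow> smth (\<lambda>t. f t *\<^sub>R g t)"
proof -
  interpret bounded_bilinear_on "\<lambda>(r::real) (x::'v). r *\<^sub>R x" UNIV UNIV 1
    by unfold_locales (auto simp: algebra_simps)
  show "smth f \<Longrightarrow> smth g \<Longrightarrow> smth (\<lambda>t. f t *\<^sub>R g t)" by (rule smth) auto
qed

lemma smth_compose:
  fixes f :: "real \<Rightarrow> 'v::real_normed_vector" and g :: "real \<Rightarrow> real"
  assumes "smth f" "smth g"
  shows "smth (\<lambda>t. f (g t))"
proof -
  have "times_diff n (\<lambda>t. f (g t))" if "smth f" for n and f :: "real \<Rightarrow> 'v"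
    using that
  proof (induction n arbitrary: f)
    case (Suc n)
    have "((\<lambda>t. f (g t)) has_vector_derivative hderiv 1 g t *\<^sub>R hderiv 1 f (g t)) (at t)" for t
      using vector_diff_chain_at[OF smth_hderiv1(1)[OF \<open>smth g\<close>] smth_hderiv1(1)[OF Suc.prems]]
      by (simp add: o_def)
    moreover have "times_diff n (\<lambda>t. hderiv 1 g t *\<^sub>R hderiv 1 f (g t))"
    proof -
      interpret bounded_bilinear_on "\<lambda>(r::real) (x::'v). r *\<^sub>R x" UNIV UNIV 1
        by unfold_locales (auto simp: algebra_simps)
      have "times_diff n (hderiv 1 g)" "times_diff n (\<lambda>t. hderiv 1 f (g t))"
        using smth_hderiv1(2)[OF assms(2)] Suc.IH[OF smth_hderiv1(2)[OF Suc.prems]]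
        unfolding smth_def by blast+
      from times_diff[OF this] show ?thesis by simp
    qed
    ultimately show ?case unfolding times_diff.simps by (intro exI conjI allI)
  qed simp
  with assms show ?thesis by (simp add: smth_def)
qed

lemma smth_affine: "smth (\<lambda>t. a * t + c :: real)"
  using smth_add[OF smth_scale[OF smth_ident, of a] smth_const[of c]] by simp

lemma hderiv_affine:
  assumes "smth f"
  shows "hderiv n (\<lambda>t. f (a * t + c)) t = a ^ n *\<^sub>R hderiv n f (a * t + c)"
proof -
  define C where "C = (\<lambda>n t. a ^ n *\<^sub>R hderiv n f (a * t + c))"
  have "(C n has_vector_derivative C (Suc n) t) (at t)" for n t
  proof -
    have "((\<lambda>t. a * t + c) has_vector_derivative a) (at t)"
      by (auto intro!: derivative_eq_intros)
    from vector_diff_chain_at[OF this has_hderiv[OF assms, of n]]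
    have "((\<lambda>t. hderiv n f (a * t + c)) has_vector_derivative a *\<^sub>R hderiv (Suc n) f (a * t + c)) (at t)"
      by (simp add: o_def)
    from bounded_linear.has_vector_derivative[OF bounded_linear_scaleR_right this, of "a ^ n"]
    show ?thesis by (simp add: C_def mult.commute)
  qed
  from smthI_seq(2)[of C, OF this, of n] show ?thesis by (simp add: C_def fun_eq_iff)
qed

lemma hderiv_bounded_linear:
  assumes "bounded_linear L" "smth f"
  shows "hderiv n (\<lambda>t. L (f t)) = (\<lambda>t. L (hderiv n f t))"
  using smthI_seq(2)[of "\<lambda>n t. L (hderiv n f t)" n]
  by (simp add: bounded_linear.has_vector_derivative[OF assms(1)] has_hderiv[OF assms(2)] del: hderiv.simps(2))

lemma hderiv_add:
  assumes "smth f" "smth g"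
  shows "hderiv n (\<lambda>t. f t + g t) = (\<lambda>t. hderiv n f t + hderiv n g t)"
  using smthI_seq(2)[of "\<lambda>n t. hderiv n f t + hderiv n g t" n]
  by (simp add: has_vector_derivative_add has_hderiv assms del: hderiv.simps(2))

lemma hderiv_scale:
  assumes "smth f"
  shows "hderiv n (\<lambda>t. a *\<^sub>R f t) = (\<lambda>t. a *\<^sub>R hderiv n f t)"
  by (rule hderiv_bounded_linear[OF bounded_linear_scaleR_right assms])

lemma hderiv_diff:
  assumes "smth f" "smth g"
  shows "hderiv n (\<lambda>t. f t - g t) = (\<lambda>t. hderiv n f t - hderiv n g t)"
  using smthI_seq(2)[of "\<lambda>n t. hderiv n f t - hderiv n g t" n]
  by (simp add: has_vector_derivative_diff has_hderiv assms del: hderiv.simps(2))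

lemma hderiv_cong_local:
  assumes "open S" "\<And>t. t \<in> S \<Longrightarrow> f t = g t" "t \<in> S"
  shows "hderiv n f t = hderiv n g t"
  using assms(3)
proof (induction n arbitrary: t)
  case (Suc n)
  have ev: "\<forall>\<^sub>F x in nhds t. x \<in> UNIV \<longrightarrow> hderiv n f x = hderiv n g x"
    using Suc by (auto intro: eventually_mono[OF eventually_nhds_in_open[OF assms(1)]])
  show ?case
    using vector_derivative_cong_eq[OF ev refl refl] Suc by simp
qed (use assms in auto)

text \<open>The form with \<open>min\<close> and \<open>max\<close> admits the endpoints in either
  order.\<close>

lemma norm_increment_bound:
  fixes f :: "real \<Rightarrow> 'v::real_normed_vector"
  assumes "\<And>x. x \<in> {min a b..max a b} \<Longrightarrow> (f has_vector_derivative f' x) (at x)"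
    and "\<And>x. x \<in> {min a b..max a b} \<Longrightarrow> norm (f' x) \<le> B"
  shows "norm (f b - f a) \<le> B * \<bar>b - a\<bar>"
proof -
  have "norm (f b - f a) \<le> B * norm (b - a)"
  proof (rule differentiable_bound[of "{min a b..max a b}" f "\<lambda>x h. h *\<^sub>R f' x"])
    show "(f has_derivative (\<lambda>h. h *\<^sub>R f' x)) (at x within {min a b..max a b})"
      if "x \<in> {min a b..max a b}" for x
      using assms(1)[OF that] has_vector_derivative_def has_derivative_at_withinI by blast
    show "onorm (\<lambda>h. h *\<^sub>R f' x) \<le> B" if "x \<in> {min a b..max a b}" for x
      using assms(2)[OF that] by (intro onorm_le) (auto simp: mult.commute[of B] intro!: mult_left_mono)
  qed auto
  then show ?thesis by simp
qed

declare hderiv.simps(2) [simp del]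

section \<open>Bump functions and special curves\<close>

text \<open>The functions \<open>p(1/x) exp(-1/x)\<close>, extended by zero, form a family closed
  under differentiation: the polynomial \<open>p\<close> in \<open>y = 1/x\<close> is replaced by
  \<open>y^2 (p - p')\<close>. Hence all of them are smooth at once.\<close>

definition exp_recip :: "real poly \<Rightarrow> real \<Rightarrow> real" where
  "exp_recip p x = (if x > 0 then poly p (1 / x) * exp (- (1 / x)) else 0)"

lemma poly_div_exp_tendsto_0: "((\<lambda>x::real. poly p x / exp x) \<longlongrightarrow> 0) at_top"
proof -
  have "((\<lambda>x. \<Sum>i\<le>degree p. coeff p i * (x ^ i / exp x)) \<longlongrightarrow> (\<Sum>i\<le>degree p. coeff p i * 0)) at_top"
    by (intro tendsto_intros tendsto_power_div_exp_0)
  then show ?thesis by (simp add: poly_altdef sum_divide_distrib)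
qed

lemma exp_recip_has_derivative:
  "(exp_recip p has_vector_derivative exp_recip ([:0, 0, 1:] * (p - pderiv p)) x) (at x)"
proof (cases x "0::real" rule: linorder_cases)
  case less
  have "(exp_recip p has_vector_derivative 0) (at x)"
    by (rule has_vector_derivative_transform_within_open[of "\<lambda>_. 0" _ _ "{..<0}"])
      (use less in \<open>auto simp: exp_recip_def\<close>)
  then show ?thesis using less by (simp add: exp_recip_def)
next
  case greater
  have "((\<lambda>x. poly p (1 / x) * exp (- (1 / x))) has_real_derivative
      exp_recip ([:0, 0, 1:] * (p - pderiv p)) x) (at x)"
    using greater
    by (auto intro!: derivative_eq_intros poly_DERIV[THEN DERIV_chain2]
        simp: exp_recip_def field_simps power2_eq_square)
  then have "((\<lambda>x. poly p (1 / x) * exp (- (1 / x))) has_vector_derivative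
      exp_recip ([:0, 0, 1:] * (p - pderiv p)) x) (at x)"
    by (simp add: has_real_derivative_iff_has_vector_derivative)
  then show ?thesis
    by (rule has_vector_derivative_transform_within_open[of _ _ _ "{0<..}"])
      (use greater in \<open>auto simp: exp_recip_def\<close>)
next
  case equal
  have "((\<lambda>s. (exp_recip p (0 + s) - exp_recip p 0) /\<^sub>R s) \<longlongrightarrow> 0) (at 0)"
  proof (rule filterlim_split_at)
    show "((\<lambda>s. (exp_recip p (0 + s) - exp_recip p 0) /\<^sub>R s) \<longlongrightarrow> 0) (at_left 0)"
      by (rule tendsto_eventually)
        (auto simp: eventually_at_filter exp_recip_def)
    \<comment> \<open>Dividing by \<open>s\<close> multiplies the polynomial by its variable, so the
      quotient is again a polynomial in \<open>1/s\<close> divided by an exponential.\<close>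
    have "((\<lambda>s. poly ([:0, 1:] * p) (inverse s) / exp (inverse s)) \<longlongrightarrow> 0) (at_right 0)"
      by (rule filterlim_compose[OF poly_div_exp_tendsto_0 filterlim_inverse_at_top_right])
    then show "((\<lambda>s. (exp_recip p (0 + s) - exp_recip p 0) /\<^sub>R s) \<longlongrightarrow> 0) (at_right 0)"
      by (rule Lim_transform_eventually)
        (auto simp: eventually_at_filter exp_recip_def exp_minus divide_inverse)
  qed
  then show ?thesis
    using equal by (simp add: has_vector_derivative_iff_quotient exp_recip_def)
qed

lemma smth_exp_recip: "smth (exp_recip p)"
proof -
  define P where "P = rec_nat p (\<lambda>_ q. [:0, 0, 1:] * (q - pderiv q))"
  have "(exp_recip (P n) has_vector_derivative exp_recip (P (Suc n)) t) (at t)" for n t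
    using exp_recip_has_derivative[of "P n" t] by (simp add: P_def)
  from smthI_seq(1)[of "\<lambda>n. exp_recip (P n)", OF this] show ?thesis by (simp add: P_def)
qed

lemma smooth_mollifier_exists:
  "\<exists>\<rho>::real \<Rightarrow> real. smth \<rho> \<and> (\<forall>x. 0 \<le> \<rho> x) \<and> (\<forall>x. \<rho> x > 0 \<longleftrightarrow> 0 < x \<and> x < 1)"
proof (intro exI conjI allI)
  let ?\<rho> = "\<lambda>x. exp_recip 1 x * exp_recip 1 ((-1) * x + 1)"
  show "smth ?\<rho>"
    using smth_scaleR[OF smth_exp_recip[of 1] smth_compose[OF smth_exp_recip[of 1] smth_affine[of "-1" 1]]]
    by simp
qed (auto simp: exp_recip_def)

lemma smooth_step_exists:
  "\<exists>(\<Phi>::real \<Rightarrow> real). smth \<Phi> \<and> (\<forall>x\<le>0. \<Phi> x = 0) \<and> (\<forall>x\<ge>1. \<Phi> x = 1)"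
proof -
  obtain \<rho> :: "real \<Rightarrow> real" where \<rho>: "smth \<rho>" "\<And>x. 0 \<le> \<rho> x" "\<And>x. \<rho> x > 0 \<longleftrightarrow> 0 < x \<and> x < 1"
    using smooth_mollifier_exists by blast
  have \<rho>0: "\<rho> x = 0" if "x \<le> 0 \<or> x \<ge> 1" for x
    using \<rho>(2)[of x] \<rho>(3)[of x] that by linarith
  have cont: "continuous_on S \<rho>" for S using smth_continuous[OF \<rho>(1), of S 0] by simp
  \<comment> \<open>Starting at \<open>-1\<close> makes the points near \<open>0\<close> interior,
    so the two-sided derivative at \<open>0\<close> needs no separate case.\<close>
  define I where "I = (\<lambda>x. integral {-1..x} \<rho>)"
  have I0: "I x = 0" if "x \<le> 0" for x
  proof -
    have "I x = integral {-1..x} (\<lambda>_. 0)"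
      unfolding I_def using that by (intro integral_cong) (auto intro: \<rho>0)
    then show ?thesis by simp
  qed
  have dI: "(I has_vector_derivative \<rho> x) (at x)" for x
  proof (cases "x > - 1")
    case True
    have "(I has_vector_derivative \<rho> x) (at x within {-1..x+1})"
      unfolding I_def using True by (intro integral_has_vector_derivative cont) auto
    moreover have "x \<in> interior {-1..x+1}" using True by simp
    ultimately show ?thesis using at_within_interior by metis
  next
    case False
    have "(I has_vector_derivative 0) (at x)"
      by (rule has_vector_derivative_transform_within_open[of "\<lambda>_. 0" _ _ "{..<0}"])
        (use False I0 in auto)
    then show ?thesis using False \<rho>0[of x] by simp
  qed
  have I1: "I x = I 1" if "x \<ge> 1" for x
  proof -
    have "norm (I x - I 1) \<le> 0 * \<bar>x - 1\<bar>"
    proof (rule norm_increment_bound[OF dI])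
      show "norm (\<rho> y) \<le> 0" if "y \<in> {min 1 x..max 1 x}" for y
        using that \<open>x \<ge> 1\<close> \<rho>0[of y] by simp
    qed
    then show ?thesis by simp
  qed
  have "(I has_real_derivative \<rho> x) (at x)" for x
    using dI[of x] by (simp add: has_real_derivative_iff_has_vector_derivative)
  from MVT2[of 0 1 I \<rho>, OF zero_less_one this]
  obtain z where z: "0 < z" "z < 1" "I 1 - I 0 = (1 - 0) * \<rho> z" by blast
  moreover have "\<rho> z > 0" using z(1,2) \<rho>(3) by blast
  ultimately have "I 1 > 0" using I0[of 0] by simp
  have "smth I" by (rule smthI_deriv[OF dI \<rho>(1)])
  then have "smth (\<lambda>x. (1 / I 1) *\<^sub>R I x)" by (rule smth_scale)
  moreover have "(1 / I 1) *\<^sub>R I x = 0" if "x \<le> 0" for x using I0[OF that] by simp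
  moreover have "(1 / I 1) *\<^sub>R I x = 1" if "x \<ge> 1" for x
    using \<open>I 1 > 0\<close> unfolding I1[OF that] by simp
  ultimately show ?thesis by blast
qed

lemma smooth_bump_exists:
  "\<exists>\<beta>::real \<Rightarrow> real. smth \<beta> \<and> (\<forall>x. \<bar>x\<bar> \<ge> 1 \<longrightarrow> \<beta> x = 0) \<and> (\<forall>x. \<bar>x\<bar> \<le> 1/2 \<longrightarrow> \<beta> x = 1)"
proof -
  obtain \<Phi> :: "real \<Rightarrow> real" where \<Phi>: "smth \<Phi>" "\<forall>x\<le>0. \<Phi> x = 0" "\<forall>x\<ge>1. \<Phi> x = 1"
    using smooth_step_exists by blast
  let ?\<beta> = "\<lambda>x. \<Phi> (2 * x + 2) *\<^sub>R \<Phi> ((-2) * x + 2)"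
  have "smth ?\<beta>" by (intro smth_scaleR smth_compose[OF \<Phi>(1)] smth_affine)
  moreover have "?\<beta> x = 0" if "\<bar>x\<bar> \<ge> 1" for x
    using that \<Phi>(2) by (cases "x \<ge> 0") auto
  moreover have "?\<beta> x = 1" if "\<bar>x\<bar> \<le> 1/2" for x
    using that \<Phi>(3) by (auto simp: abs_le_iff)
  ultimately show ?thesis by (intro exI[of _ ?\<beta>]) blast
qed

lemma hderiv_compact_support:
  fixes \<beta> :: "real \<Rightarrow> real"
  assumes "smth \<beta>" "\<And>x. \<bar>x\<bar> \<ge> 1 \<Longrightarrow> \<beta> x = 0"
  shows "\<bar>x\<bar> \<ge> 1 \<Longrightarrow> hderiv k \<beta> x = 0" "\<exists>M. \<forall>x. \<bar>hderiv k \<beta> x\<bar> \<le> M"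
proof -
  have out: "hderiv k \<beta> x = 0" if "\<bar>x\<bar> > 1" for x
  proof -
    have "hderiv k \<beta> x = hderiv k (\<lambda>_. 0) x"
      by (rule hderiv_cong_local[of "- {-1..1}"]) (use assms that in auto)
    also have "hderiv k (\<lambda>_. 0::real) = (\<lambda>_. 0)" by (induction k) (auto simp: hderiv.simps(2))
    finally show ?thesis .
  qed
  have cont: "continuous_on S (hderiv k \<beta>)" for S by (rule smth_continuous[OF assms(1)])
  \<comment> \<open>The points \<open>1\<close> and \<open>-1\<close> are not covered by
    \<open>out\<close>; they lie in the closure of the exterior.\<close>
  have "closed {x. hderiv k \<beta> x = 0}"
    using continuous_closed_preimage_constant[OF cont[of UNIV]] by (simp add: closed_UNIV)
  moreover have "{x. \<bar>x\<bar> > 1} \<subseteq> {x. hderiv k \<beta> x = 0}" using out by blast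
  ultimately have cl: "closure {x::real. \<bar>x\<bar> > 1} \<subseteq> {x. hderiv k \<beta> x = 0}"
    by (rule closure_minimal[rotated])
  have "{x::real. \<bar>x\<bar> \<ge> 1} \<subseteq> closure {x. \<bar>x\<bar> > 1}"
  proof
    fix x :: real assume "x \<in> {x. \<bar>x\<bar> \<ge> 1}"
    then consider "x \<ge> 1" | "x \<le> -1" by fastforce
    then show "x \<in> closure {x. \<bar>x\<bar> > 1}"
    proof cases
      case 1
      then have "x \<in> closure {1<..}" by simp
      also have "\<dots> \<subseteq> closure {x. \<bar>x\<bar> > 1}" by (rule closure_mono) auto
      finally show ?thesis .
    next
      case 2
      then have "x \<in> closure {..<-1}" by simp
      also have "\<dots> \<subseteq> closure {x. \<bar>x\<bar> > 1}" by (rule closure_mono) auto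
      finally show ?thesis .
    qed
  qed
  with cl have z: "hderiv k \<beta> x = 0" if "\<bar>x\<bar> \<ge> 1" for x using that by blast
  then show "\<bar>x\<bar> \<ge> 1 \<Longrightarrow> hderiv k \<beta> x = 0" .
  have "compact (hderiv k \<beta> ` {-1..1})" by (intro compact_continuous_image cont compact_Icc)
  then obtain M where "\<forall>y \<in> hderiv k \<beta> ` {-1..1}. norm y \<le> M" "M > 0"
    using compact_imp_bounded bounded_pos by metis
  then have "\<bar>hderiv k \<beta> x\<bar> \<le> M" for x
    by (cases "\<bar>x\<bar> \<le> 1") (auto simp: z abs_le_iff)
  then show "\<exists>M. \<forall>x. \<bar>hderiv k \<beta> x\<bar> \<le> M" by blast
qed

text \<open>Kriegl and Michor's special curve: it runs through prescribed points near the parameters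
  \<open>2^(-n)\<close>, and it is smooth at \<open>0\<close> because these points converge faster than any power.
  Near every positive parameter the sum is a fixed finite one.\<close>

definition special_curve :: "(real \<Rightarrow> real) \<Rightarrow> (nat \<Rightarrow> 'v::real_normed_vector) \<Rightarrow> real \<Rightarrow> 'v" where
  "special_curve \<beta> z t =
     (if t \<le> 0 then 0 else \<Sum>n | 2 ^ n * t < 2. \<beta> (2 ^ (n + 2) * t - 4) *\<^sub>R z n)"

lemma finite_dyadic: "t > 0 \<Longrightarrow> finite {n::nat. 2 ^ n * t < (c::real)}"
proof -
  assume "t > 0"
  have "{n::nat. 2 ^ n * t < c} \<subseteq> {n. n \<le> nat \<lceil>c / t\<rceil>}"
  proof
    fix n assume "n \<in> {n. 2 ^ n * t < c}"
    then have "2 ^ n < c / t" using \<open>t > 0\<close> by (simp add: pos_less_divide_eq)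
    moreover have "real n < 2 ^ n" by (rule of_nat_less_two_power)
    ultimately have "real n \<le> c / t" by linarith
    then have "real n \<le> real (nat \<lceil>c / t\<rceil>)" using real_nat_ceiling_ge[of "c / t"] by linarith
    then show "n \<in> {n. n \<le> nat \<lceil>c / t\<rceil>}" by simp
  qed
  then show ?thesis by (rule finite_subset) simp
qed

text \<open>The bump with index \<open>n\<close> is active only where \<open>2^n t\<close> lies
  between \<open>3/4\<close> and \<open>5/4\<close>. Doubling or halving leaves this interval, so at
  most one summand is nonzero.\<close>

lemma special_curve_eq:
  assumes "\<And>x. \<bar>x\<bar> \<ge> 1 \<Longrightarrow> \<beta> x = 0" "\<bar>2 ^ (n + 2) * t - 4\<bar> \<le> 1"
  shows "special_curve \<beta> z t = \<beta> (2 ^ (n + 2) * t - 4) *\<^sub>R z n"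
proof -
  have e: "2 ^ (m + 2) * t = 4 * (2 ^ m * t)" for m by (simp add: power_add)
  have r: "3/4 \<le> 2 ^ n * t" "2 ^ n * t \<le> 5/4"
    using assms(2) unfolding e by linarith+
  have t: "t > 0"
  proof (rule ccontr)
    assume "\<not> t > 0"
    then have "2 ^ n * t \<le> 0" by (intro mult_nonneg_nonpos) auto
    with r show False by linarith
  qed
  have "\<beta> (2 ^ (m + 2) * t - 4) = 0" if "m \<noteq> n" for m
  proof (cases "m < n")
    case True
    then have "2 * 2 ^ m \<le> (2::real) ^ n" using power_increasing[of "Suc m" n "2::real"] by simp
    from mult_right_mono[OF this, of t] have "2 * (2 ^ m * t) \<le> 2 ^ n * t" using t by (simp only: mult.assoc)
    then have "1 \<le> \<bar>2 ^ (m + 2) * t - 4\<bar>" unfolding e using r by linarith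
    then show ?thesis by (rule assms(1))
  next
    case False
    then have "2 * 2 ^ n \<le> (2::real) ^ m"
      using that power_increasing[of "Suc n" m "2::real"] by simp
    from mult_right_mono[OF this, of t] have "2 * (2 ^ n * t) \<le> 2 ^ m * t" using t by (simp only: mult.assoc)
    then have "1 \<le> \<bar>2 ^ (m + 2) * t - 4\<bar>" unfolding e using r by linarith
    then show ?thesis by (rule assms(1))
  qed
  then have "(\<Sum>m | 2 ^ m * t < 2. \<beta> (2 ^ (m + 2) * t - 4) *\<^sub>R z m)
      = (\<Sum>m\<in>{n}. \<beta> (2 ^ (m + 2) * t - 4) *\<^sub>R z m)"
    using r finite_dyadic[OF t] by (intro sum.mono_neutral_right) auto
  then show ?thesis using t by (simp add: special_curve_def)
qed

text \<open>The index set on the right does not depend on \<open>t'\<close>, so the curve can be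
  differentiated term by term near \<open>t\<close>.\<close>

lemma special_curve_finite_sum:
  assumes "\<And>x. \<bar>x\<bar> \<ge> 1 \<Longrightarrow> \<beta> x = 0" "0 < t" "t / 2 < t'"
  shows "special_curve \<beta> z t' = (\<Sum>n | 2 ^ n * t < 4. \<beta> (2 ^ (n + 2) * t' - 4) *\<^sub>R z n)"
proof -
  have "(\<Sum>n | 2 ^ n * t' < 2. \<beta> (2 ^ (n + 2) * t' - 4) *\<^sub>R z n)
      = (\<Sum>n | 2 ^ n * t < 4. \<beta> (2 ^ (n + 2) * t' - 4) *\<^sub>R z n)"
  proof (rule sum.mono_neutral_left)
    show "finite {n. 2 ^ n * t < 4}" by (rule finite_dyadic[OF \<open>0 < t\<close>])
    show "{n. 2 ^ n * t' < 2} \<subseteq> {n. 2 ^ n * t < 4}"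
    proof
      fix n :: nat assume "n \<in> {n. 2 ^ n * t' < 2}"
      moreover have "2 ^ n * (t / 2) < 2 ^ n * t'" using assms(3) by (intro mult_strict_left_mono) auto
      ultimately have "2 * (2 ^ n * (t / 2)) < 4" unfolding mem_Collect_eq by linarith
      then show "n \<in> {n. 2 ^ n * t < 4}" by simp
    qed
    show "\<forall>n\<in>{n. 2 ^ n * t < 4} - {n. 2 ^ n * t' < 2}. \<beta> (2 ^ (n + 2) * t' - 4) *\<^sub>R z n = 0"
      by (auto intro!: assms(1))
  qed
  then show ?thesis using assms by (simp add: special_curve_def)
qed

text \<open>Where bump \<open>n\<close> is active, \<open>2^n t\<close> is at least
  \<open>3/4\<close>, hence \<open>2 t^2 2^(2n)\<close> is at least \<open>1\<close>, and the decay
  of \<open>z\<close> turns into a factor \<open>t^2\<close>. A quadratic bound gives derivative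
  zero at the origin.\<close>

lemma special_curve_bound:
  assumes "\<And>x. \<bar>x\<bar> \<ge> 1 \<Longrightarrow> \<beta> x = 0" "\<And>x. \<bar>\<beta> x\<bar> \<le> M" "\<And>n. 2 ^ (n * 2) * norm (z n) \<le> B"
  shows "norm (special_curve \<beta> z t) \<le> 2 * M * B * t\<^sup>2"
proof -
  have M: "0 \<le> M" using assms(2)[of 0] by linarith
  have B: "0 \<le> B" using assms(3)[of 0] by (simp add: order.trans[OF norm_ge_zero])
  show ?thesis
  proof (cases "t > 0 \<and> (\<exists>n. \<bar>2 ^ (n + 2) * t - 4\<bar> \<le> 1)")
    case True
    then obtain n where n: "\<bar>2 ^ (n + 2) * t - 4\<bar> \<le> 1" and t: "t > 0" by blast
    then have r: "3/4 \<le> 2 ^ n * t" by (simp add: power_add abs_le_iff)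
    have "(3/4)\<^sup>2 \<le> (2 ^ n * t)\<^sup>2" by (rule power_mono[OF r]) simp
    moreover have "(2 ^ n * t)\<^sup>2 = t\<^sup>2 * 2 ^ (n * 2)"
      by (simp only: mult_2_right power_add power2_eq_square mult_ac)
    ultimately have "9/16 \<le> t\<^sup>2 * 2 ^ (n * 2)" by (simp add: power_divide)
    then have r2: "1 \<le> 2 * t\<^sup>2 * 2 ^ (n * 2)" by linarith
    have "norm (special_curve \<beta> z t) \<le> M * norm (z n)"
    proof -
      have "special_curve \<beta> z t = \<beta> (2 ^ (n + 2) * t - 4) *\<^sub>R z n"
        by (rule special_curve_eq[OF assms(1) n])
      then show ?thesis using assms(2) by (auto intro!: mult_right_mono)
    qed
    also have "\<dots> \<le> M * ((2 * t\<^sup>2 * 2 ^ (n * 2)) * norm (z n))"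
      using M r2 mult_right_mono[OF r2, of "norm (z n)"] by (intro mult_left_mono) auto
    also have "\<dots> = 2 * M * t\<^sup>2 * (2 ^ (n * 2) * norm (z n))" by simp
    also have "\<dots> \<le> 2 * M * t\<^sup>2 * B" using M by (intro mult_left_mono assms(3)) auto
    finally show ?thesis by (simp add: mult_ac)
  next
    case False
    then have "1 \<le> \<bar>2 ^ (n + 2) * t - 4\<bar>" if "t > 0" for n
      using that by (meson linear)
    then have "special_curve \<beta> z t = 0"
      using assms(1) by (auto simp: special_curve_def intro!: sum.neutral simp del: power_add_numeral2)
    then show ?thesis using M B by simp
  qed
qed

lemma smth_special_curve:
  fixes z :: "nat \<Rightarrow> 'v::real_normed_vector"
  assumes \<beta>: "smth \<beta>" "\<And>x. \<bar>x\<bar> \<ge> 1 \<Longrightarrow> \<beta> x = 0"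
    and z: "\<And>k. \<exists>B. \<forall>n. 2 ^ (n * k) * norm (z n) \<le> B"
  shows "smth (special_curve \<beta> z)"
proof -
  \<comment> \<open>Each derivative is again a special curve: the chain rule factor
    \<open>2^(n+2)\<close> is moved into the points, which still decay faster than any
    power.\<close>
  define w where "w = (\<lambda>k n. (2 ^ (n + 2)) ^ k *\<^sub>R z n)"
  define C where "C = (\<lambda>k. special_curve (hderiv k \<beta>) (w k))"
  have supp: "hderiv k \<beta> x = 0" if "\<bar>x\<bar> \<ge> 1" for k x
    using hderiv_compact_support(1)[OF \<beta>] that by blast
  have "(C k has_vector_derivative C (Suc k) t) (at t)" for k t
  proof (cases t "0::real" rule: linorder_cases)
    case less
    have "(C k has_vector_derivative 0) (at t)"
      by (rule has_vector_derivative_transform_within_open[of "\<lambda>_. 0" _ _ "{..<0}"])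
        (use less in \<open>auto simp: C_def special_curve_def\<close>)
    then show ?thesis using less by (simp add: C_def special_curve_def)
  next
    case equal
    obtain M where M: "\<And>x. \<bar>hderiv k \<beta> x\<bar> \<le> M" using hderiv_compact_support(2)[OF \<beta>] by blast
    \<comment> \<open>Of the exponent \<open>k + 2\<close>, the \<open>k\<close> pays for the
      scaling in \<open>w k\<close> and the \<open>2\<close> for the quadratic bound.\<close>
    obtain B where B: "\<And>n. 2 ^ (n * (k + 2)) * norm (z n) \<le> B" using z by blast
    have "2 ^ (n * 2) * norm (w k n) \<le> 4 ^ k * B" for n
    proof -
      have "2 ^ (n * 2) * norm (w k n) = 4 ^ k * (2 ^ (n * (k + 2)) * norm (z n))"
      proof -
        have "((2::real) ^ (n + 2)) ^ k = 2 ^ (n * k) * 4 ^ k"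
          by (simp add: power_add power_mult_distrib flip: power_mult)
        moreover have "(2::real) ^ (n * (k + 2)) = 2 ^ (n * k) * 2 ^ (n * 2)"
          by (simp only: distrib_left power_add)
        ultimately show ?thesis unfolding w_def norm_scaleR by simp
      qed
      then show ?thesis using B by simp
    qed
    note bd = special_curve_bound[OF supp M this]
    define D where "D = \<bar>2 * M * (4 ^ k * B)\<bar>"
    have "((\<lambda>s. C k s /\<^sub>R s) \<longlongrightarrow> 0) (at 0)"
    proof (rule Lim_null_comparison)
      have "norm (C k s /\<^sub>R s) \<le> D * \<bar>s\<bar>" for s
      proof (cases "s = 0")
        case False
        have "norm (C k s) \<le> D * (\<bar>s\<bar> * \<bar>s\<bar>)"
        proof -
          have "norm (C k s) \<le> 2 * M * (4 ^ k * B) * s\<^sup>2" unfolding C_def by (rule bd)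
          also have "\<dots> \<le> D * s\<^sup>2" unfolding D_def by (intro mult_right_mono abs_ge_self zero_le_power2)
          finally show ?thesis by (simp only: abs_mult_self_eq power2_eq_square)
        qed
        then have "norm (C k s) / \<bar>s\<bar> \<le> D * \<bar>s\<bar>"
          using False by (simp add: pos_divide_le_eq mult.assoc)
        then show ?thesis by (simp add: divide_inverse mult.commute)
      qed simp
      then show "\<forall>\<^sub>F s in at 0. norm (C k s /\<^sub>R s) \<le> D * \<bar>s\<bar>" by simp
      have "((\<lambda>s::real. D * \<bar>s\<bar>) \<longlongrightarrow> D * \<bar>0\<bar>) (at 0)" by (intro tendsto_intros)
      then show "((\<lambda>s. D * \<bar>s\<bar>) \<longlongrightarrow> 0) (at 0)" by simp
    qed
    then show ?thesis
      using equal by (simp add: has_vector_derivative_iff_quotient C_def special_curve_def)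
  next
    case greater
    let ?S = "\<lambda>k t'. \<Sum>n | 2 ^ n * t < 4. hderiv k \<beta> (2 ^ (n + 2) * t' - 4) *\<^sub>R w k n"
    have eq: "C k t' = ?S k t'" if "t / 2 < t'" for k t'
      unfolding C_def by (rule special_curve_finite_sum[OF supp greater that])
    have "((\<lambda>t'. hderiv k \<beta> (2 ^ (n + 2) * t' - 4) *\<^sub>R w k n) has_vector_derivative
        hderiv (Suc k) \<beta> (2 ^ (n + 2) * t - 4) *\<^sub>R w (Suc k) n) (at t)" for n
    proof -
      have "((\<lambda>t. 2 ^ (n + 2) * t - 4) has_vector_derivative 2 ^ (n + 2)) (at t)"
        by (auto intro!: derivative_eq_intros)
      from vector_diff_chain_at[OF this has_hderiv[OF \<beta>(1), of k]]
      have "((\<lambda>t. hderiv k \<beta> (2 ^ (n + 2) * t - 4)) has_vector_derivative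
          2 ^ (n + 2) * hderiv (Suc k) \<beta> (2 ^ (n + 2) * t - 4)) (at t)"
        unfolding o_def real_scaleR_def .
      from bounded_linear.has_vector_derivative[OF bounded_linear_scaleR_left this, of "w k n"]
      show ?thesis unfolding w_def scaleR_scaleR power_Suc by (simp only: mult_ac)
    qed
    then have "(?S k has_vector_derivative ?S (Suc k) t) (at t)"
      by (intro has_vector_derivative_sum)
    then have "(C k has_vector_derivative ?S (Suc k) t) (at t)"
      by (rule has_vector_derivative_transform_within_open[of _ _ _ "{t/2<..}"])
        (use eq greater in auto)
    moreover have "C (Suc k) t = ?S (Suc k) t" using eq[of t "Suc k"] greater by linarith
    ultimately show ?thesis by (simp only:)
  qed
  from smthI_seq(1)[of C, OF this] show ?thesis by (simp add: C_def w_def)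
qed

text \<open>The rate \<open>(1/2)^(n*n)\<close> beats every \<open>2^(n*k)\<close>. The threshold
  \<open>n0\<close> serves sequences that are controlled in the \<open>n\<close>-th seminorm at
  stage \<open>n\<close>, so that the \<open>m\<close>-th seminorm is controlled only from
  \<open>m\<close> on.\<close>

lemma rapid_decay:
  fixes z :: "nat \<Rightarrow> 'v::real_normed_vector"
  assumes "\<And>n. n \<ge> n0 \<Longrightarrow> norm (z n) \<le> (1/2) ^ (n * n)"
  shows "\<exists>B. \<forall>n. 2 ^ (n * k) * norm (z n) \<le> B"
proof -
  define N where "N = max n0 k"
  define B where "B = 1 + (\<Sum>n<N. 2 ^ (n * k) * norm (z n))"
  have S: "0 \<le> (\<Sum>n<N. 2 ^ (n * k) * norm (z n))" by (intro sum_nonneg) auto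
  have "2 ^ (n * k) * norm (z n) \<le> B" for n
  proof (cases "n < N")
    case True
    then have "2 ^ (n * k) * norm (z n) \<le> (\<Sum>n<N. 2 ^ (n * k) * norm (z n))"
      by (intro member_le_sum) auto
    then show ?thesis by (simp add: B_def)
  next
    case False
    then have "2 ^ (n * k) * norm (z n) \<le> 2 ^ (n * n) * (1/2) ^ (n * n)"
      using assms by (intro mult_mono power_increasing) (auto simp: N_def)
    also have "\<dots> = 1" by (simp flip: power_mult_distrib)
    finally show ?thesis using S by (simp add: B_def)
  qed
  then show ?thesis by blast
qed

section \<open>Boman's theorem in two variables\<close>

definition curvewise_smooth :: "(real \<Rightarrow> real \<Rightarrow> 'v::real_normed_vector) \<Rightarrow> bool" where
  "curvewise_smooth G \<longleftrightarrow> (\<forall>g1 g2. smth g1 \<longrightarrow> smth g2 \<longrightarrow> smth (\<lambda>t. G (g1 t) (g2 t)))"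

lemma curvewise_smoothD: "curvewise_smooth G \<Longrightarrow> smth g1 \<Longrightarrow> smth g2 \<Longrightarrow> smth (\<lambda>t. G (g1 t) (g2 t))"
  by (simp add: curvewise_smooth_def)

lemma curvewise_smooth_sections:
  assumes "curvewise_smooth G"
  shows "smth (\<lambda>t. G t s)" "smth (\<lambda>s. G t s)"
  using curvewise_smoothD[OF assms smth_ident smth_const] curvewise_smoothD[OF assms smth_const smth_ident]
  by simp_all

lemma curvewise_smooth_swap: "curvewise_smooth G \<Longrightarrow> curvewise_smooth (\<lambda>s t. G t s)"
  by (simp add: curvewise_smooth_def)

text \<open>If a derivative were unbounded along some sequence, a special curve that runs through (a fast
  subsequence of) it horizontally would have an unbounded derivative.\<close>

lemma curvewise_smooth_locally_bounded:
  fixes G :: "real \<Rightarrow> real \<Rightarrow> 'v::real_normed_vector"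
  assumes G: "curvewise_smooth G"
  shows "\<exists>e>0. \<exists>M. \<forall>t s. \<bar>t - t0\<bar> \<le> e \<longrightarrow> \<bar>s - s0\<bar> \<le> e \<longrightarrow> norm (hderiv p (\<lambda>t. G t s) t) \<le> M"
proof (rule ccontr)
  assume "\<not> ?thesis"
  then have *: "\<exists>t s. \<bar>t - t0\<bar> \<le> e \<and> \<bar>s - s0\<bar> \<le> e \<and> norm (hderiv p (\<lambda>t. G t s) t) > M"
    if "e > 0" for e M
    using that by (meson not_le)
  define e :: "nat \<Rightarrow> real" where "e = (\<lambda>n. (1/2) ^ (n * n))"
  have e: "e n > 0" for n by (simp add: e_def)
  \<comment> \<open>The \<open>p\<close>-th derivative along the curve below picks up a factor
    \<open>a ^ p\<close> with \<open>a\<close> at least \<open>e n\<close>; dividing by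
    \<open>e n ^ p\<close> here makes the product exceed \<open>n\<close>.\<close>
  have "\<forall>n. \<exists>t s. \<bar>t - t0\<bar> \<le> e n \<and> \<bar>s - s0\<bar> \<le> e n \<and>
      norm (hderiv p (\<lambda>t. G t s) t) > n / e n ^ p"
    using *[OF e] by blast
  then obtain T S where TS: "\<And>n. \<bar>T n - t0\<bar> \<le> e n" "\<And>n. \<bar>S n - s0\<bar> \<le> e n"
      "\<And>n. norm (hderiv p (\<lambda>t. G t (S n)) (T n)) > n / e n ^ p"
    by metis
  obtain \<beta> :: "real \<Rightarrow> real" where \<beta>: "smth \<beta>" "\<And>x. \<bar>x\<bar> \<ge> 1 \<Longrightarrow> \<beta> x = 0"
      "\<And>x. \<bar>x\<bar> \<le> 1/2 \<Longrightarrow> \<beta> x = 1"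
    using smooth_bump_exists by blast
  \<comment> \<open>On the plateau of \<open>\<beta>\<close> this is the identity, so
    \<open>special_curve \<beta>' e\<close> moves horizontally with constant speed
    \<open>e n * 2 ^ (n + 2)\<close>.\<close>
  define \<beta>' where "\<beta>' = (\<lambda>x. x *\<^sub>R \<beta> x)"
  have \<beta>': "smth \<beta>'" "\<And>x. \<bar>x\<bar> \<ge> 1 \<Longrightarrow> \<beta>' x = 0"
    unfolding \<beta>'_def using \<beta> smth_scaleR[OF smth_ident \<beta>(1)] by auto
  define \<gamma>1 where "\<gamma>1 = (\<lambda>\<tau>. t0 + special_curve \<beta> (\<lambda>n. T n - t0) \<tau> + special_curve \<beta>' e \<tau>)"
  define \<gamma>2 where "\<gamma>2 = (\<lambda>\<tau>. s0 + special_curve \<beta> (\<lambda>n. S n - s0) \<tau>)"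
  have "smth (special_curve \<beta> (\<lambda>n. T n - t0))" "smth (special_curve \<beta>' e)"
      "smth (special_curve \<beta> (\<lambda>n. S n - s0))"
    using TS e by (auto intro!: smth_special_curve \<beta> \<beta>' rapid_decay[of 0] simp: e_def)
  then have "smth \<gamma>1" "smth \<gamma>2"
    unfolding \<gamma>1_def \<gamma>2_def by (auto intro!: smth_add)
  define F where "F = (\<lambda>\<tau>. G (\<gamma>1 \<tau>) (\<gamma>2 \<tau>))"
  have "smth F" unfolding F_def using curvewise_smoothD[OF G] \<open>smth \<gamma>1\<close> \<open>smth \<gamma>2\<close> .
  have "compact (hderiv p F ` {0..1})"
    by (intro compact_continuous_image smth_continuous \<open>smth F\<close> compact_Icc)
  then obtain M where M: "\<And>\<tau>. \<tau> \<in> {0..1} \<Longrightarrow> norm (hderiv p F \<tau>) \<le> M"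
    using compact_imp_bounded bounded_iff by (metis imageI)
  have "real n \<le> M" for n :: nat
  proof -
    define a where "a = e n * 2 ^ (n + 2)"
    define c where "c = T n - 4 * e n"
    define \<tau> where "\<tau> = (1/2::real) ^ n"
    have a\<tau>: "2 ^ (n + 2) * \<tau> = 4" unfolding \<tau>_def by (simp add: power_add flip: power_mult_distrib)
    let ?O = "{x::real. \<bar>2 ^ (n + 2) * x - 4\<bar> < 1/2}"
    have "open ?O" by (intro open_Collect_less continuous_intros)
    have "F x = G (a * x + c) (S n)" if "x \<in> ?O" for x
    proof -
      have x: "\<bar>2 ^ (n + 2) * x - 4\<bar> \<le> 1" "\<bar>2 ^ (n + 2) * x - 4\<bar> \<le> 1/2" using that by auto
      have "special_curve \<beta> z x = z n" for z :: "nat \<Rightarrow> real"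
        using special_curve_eq[of \<beta> n x z] \<beta>(2) x(1) \<beta>(3)[OF x(2)] by simp
      moreover have "special_curve \<beta>' e x = (2 ^ (n + 2) * x - 4) * e n"
        using special_curve_eq[of \<beta>' n x e] \<beta>'(2) x(1) \<beta>(3)[OF x(2)] by (simp add: \<beta>'_def)
      ultimately have "\<gamma>1 x = a * x + c" "\<gamma>2 x = S n"
        by (simp_all add: \<gamma>1_def \<gamma>2_def a_def c_def algebra_simps)
      then show ?thesis by (simp add: F_def)
    qed
    then have "hderiv p F \<tau> = hderiv p (\<lambda>x. G (a * x + c) (S n)) \<tau>"
      using a\<tau> by (intro hderiv_cong_local[OF \<open>open ?O\<close>]) auto
    also have "\<dots> = a ^ p *\<^sub>R hderiv p (\<lambda>t. G t (S n)) (a * \<tau> + c)"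
      by (rule hderiv_affine[OF curvewise_smooth_sections(1)[OF G]])
    also have "a * \<tau> + c = T n"
      using a\<tau> by (simp add: a_def c_def mult.assoc)
    finally have "norm (hderiv p F \<tau>) = a ^ p * norm (hderiv p (\<lambda>t. G t (S n)) (T n))"
      using e[of n] by (simp add: a_def)
    moreover have "real n \<le> a ^ p * norm (hderiv p (\<lambda>t. G t (S n)) (T n))"
    proof -
      have "e n * 1 \<le> e n * 2 ^ (n + 2)" using e[of n] by (intro mult_left_mono one_le_power) auto
      then have "e n ^ p \<le> a ^ p" unfolding a_def using e[of n] by (intro power_mono) auto
      moreover have "real n = e n ^ p * (n / e n ^ p)" using e[of n] by simp
      moreover have "\<dots> \<le> a ^ p * norm (hderiv p (\<lambda>t. G t (S n)) (T n))"
        using e[of n] less_imp_le[OF TS(3)[of n]] calculation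
        by (intro mult_mono) (auto simp: a_def)
      ultimately show ?thesis by linarith
    qed
    moreover have "\<tau> \<in> {0..1}" unfolding \<tau>_def by (simp add: power_le_one)
    ultimately show ?thesis using M[of \<tau>] by linarith
  qed
  then show False using reals_Archimedean2[of M] by (meson not_le)
qed

lemma curvewise_smooth_bounded:
  fixes G :: "real \<Rightarrow> real \<Rightarrow> 'v::real_normed_vector"
  assumes G: "curvewise_smooth G"
  shows "\<exists>M. \<forall>t s. \<bar>t\<bar> \<le> T \<longrightarrow> \<bar>s\<bar> \<le> T \<longrightarrow> norm (hderiv p (\<lambda>t. G t s) t) \<le> M"
proof (rule ccontr)
  let ?g = "\<lambda>z. norm (hderiv p (\<lambda>t. G t (snd z)) (fst z))"
  let ?K = "{-T..T} \<times> {-T..T}"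
  assume "\<not> ?thesis"
  then have *: "\<forall>M. \<exists>t s. \<bar>t\<bar> \<le> T \<and> \<bar>s\<bar> \<le> T \<and> norm (hderiv p (\<lambda>t. G t s) t) > M"
    by (meson not_le)
  have "\<exists>z. z \<in> ?K \<and> ?g z > n" for n :: nat
  proof -
    obtain t s where "\<bar>t\<bar> \<le> T" "\<bar>s\<bar> \<le> T" "norm (hderiv p (\<lambda>t. G t s) t) > n"
      using * by blast
    then show ?thesis by (intro exI[of _ "(t, s)"]) (auto simp: abs_le_iff)
  qed
  then obtain z where z: "\<And>n::nat. z n \<in> ?K" "\<And>n. ?g (z n) > n" by metis
  have "compact ?K" by (intro compact_Times compact_Icc)
  then obtain l r where l: "strict_mono (r :: nat \<Rightarrow> nat)" "(z \<circ> r) \<longlonglongrightarrow> l"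
    using z(1) unfolding compact_def by blast
  obtain e M where e: "e > 0" "\<And>t s. \<bar>t - fst l\<bar> \<le> e \<Longrightarrow> \<bar>s - snd l\<bar> \<le> e \<Longrightarrow>
      norm (hderiv p (\<lambda>t. G t s) t) \<le> M"
    using curvewise_smooth_locally_bounded[OF G, of "fst l" "snd l" p] by blast
  obtain n0 where n0: "\<And>n. n \<ge> n0 \<Longrightarrow> dist (z (r n)) l < e"
    using l(2) e(1) unfolding lim_sequentially by auto
  obtain n1 :: nat where "M < n1" using reals_Archimedean2 by blast
  define n where "n = max n0 n1"
  have "dist (z (r n)) l < e" using n0 by (simp add: n_def)
  then have "\<bar>fst (z (r n)) - fst l\<bar> \<le> e" "\<bar>snd (z (r n)) - snd l\<bar> \<le> e"
    using dist_fst_le[of "z (r n)" l] dist_snd_le[of "z (r n)" l] by (auto simp: dist_real_def)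
  then have "?g (z (r n)) \<le> M" by (rule e(2))
  moreover have "?g (z (r n)) > r n" by (rule z(2))
  moreover have "r n \<ge> n1" using seq_suble[OF l(1), of n] by (simp add: n_def)
  ultimately show False using \<open>M < n1\<close> by linarith
qed

section \<open>Interpolation inequalities between derivatives\<close>

definition sup_norm_on :: "real \<Rightarrow> (real \<Rightarrow> 'v::real_normed_vector) \<Rightarrow> real" where
  "sup_norm_on T f = (SUP t\<in>{-T..T}. norm (f t))"

lemma sup_norm_on_upper:
  assumes "smth f" "\<bar>t\<bar> \<le> T"
  shows "norm (hderiv k f t) \<le> sup_norm_on T (hderiv k f)"
proof -
  have "compact ((\<lambda>t. norm (hderiv k f t)) ` {-T..T})"
    by (intro compact_continuous_image continuous_on_norm smth_continuous assms compact_Icc)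
  then have "bdd_above ((\<lambda>t. norm (hderiv k f t)) ` {-T..T})"
    by (intro bounded_imp_bdd_above compact_imp_bounded)
  then show ?thesis unfolding sup_norm_on_def
    using assms(2) by (intro cSUP_upper) (auto simp: abs_le_iff)
qed

lemma sup_norm_on_least:
  "0 \<le> T \<Longrightarrow> (\<And>t. \<bar>t\<bar> \<le> T \<Longrightarrow> norm (f t) \<le> B) \<Longrightarrow> sup_norm_on T f \<le> B"
  unfolding sup_norm_on_def by (rule cSUP_least) (auto simp: abs_le_iff)

lemma sup_norm_on_nonneg: "smth f \<Longrightarrow> 0 \<le> T \<Longrightarrow> 0 \<le> sup_norm_on T (hderiv k f)"
  using sup_norm_on_upper[of f 0 T k] by (simp add: order.trans[OF norm_ge_zero])

text \<open>A difference quotient of step \<open>h\<close> approximates the next derivative, with an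
  error governed by the one after it.\<close>

lemma landau_inequality:
  assumes f: "smth f" and "1 \<le> T" "0 < h" "h \<le> 1"
  shows "sup_norm_on T (hderiv (Suc k) f) \<le>
    2 * sup_norm_on T (hderiv k f) / h + h * sup_norm_on T (hderiv (Suc (Suc k)) f)"
proof (rule sup_norm_on_least)
  fix t assume t: "\<bar>t\<bar> \<le> T"
  let ?N = "\<lambda>k. sup_norm_on T (hderiv k f)"
  \<comment> \<open>The step goes towards the origin and is at most \<open>1\<close>, so it does not
    leave the interval of radius \<open>T\<close>.\<close>
  define u where "u = (if t \<le> 0 then t + h else t - h)"
  have u: "\<bar>u\<bar> \<le> T" "\<bar>u - t\<bar> = h" using t assms by (auto simp: u_def)
  have seg: "\<bar>x\<bar> \<le> T" "\<bar>x - t\<bar> \<le> h" if "x \<in> {min t u..max t u}" for x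
    using that t u by (auto simp: min_def max_def split: if_splits)
  define g where "g = (\<lambda>x. hderiv k f x - x *\<^sub>R hderiv (Suc k) f t)"
  have "norm (g u - g t) \<le> (h * ?N (Suc (Suc k))) * \<bar>u - t\<bar>"
  proof (rule norm_increment_bound)
    fix x assume x: "x \<in> {min t u..max t u}"
    show "(g has_vector_derivative hderiv (Suc k) f x - hderiv (Suc k) f t) (at x)"
      unfolding g_def
      by (intro has_vector_derivative_diff has_hderiv f)
         (use has_vector_derivative_scaleR[of "\<lambda>x. x" 1 x UNIV "\<lambda>_. hderiv (Suc k) f t" 0] in
           \<open>auto intro!: derivative_eq_intros\<close>)
    have "norm (hderiv (Suc k) f x - hderiv (Suc k) f t) \<le> ?N (Suc (Suc k)) * \<bar>x - t\<bar>"
    proof (rule norm_increment_bound[OF has_hderiv[OF f]])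
      fix y assume "y \<in> {min t x..max t x}"
      then have "\<bar>y\<bar> \<le> T" using t seg(1)[OF x] by (auto simp: min_def max_def split: if_splits)
      then show "norm (hderiv (Suc (Suc k)) f y) \<le> ?N (Suc (Suc k))" by (rule sup_norm_on_upper[OF f])
    qed
    also have "\<dots> \<le> ?N (Suc (Suc k)) * h"
      using seg(2)[OF x] assms sup_norm_on_nonneg[OF f, of T "Suc (Suc k)"] by (intro mult_left_mono) auto
    finally show "norm (hderiv (Suc k) f x - hderiv (Suc k) f t) \<le> h * ?N (Suc (Suc k))"
      by (simp only: mult.commute)
  qed
  moreover have "(u - t) *\<^sub>R hderiv (Suc k) f t = hderiv k f u - hderiv k f t - (g u - g t)"
    unfolding g_def scaleR_diff_left by simp
  then have "h * norm (hderiv (Suc k) f t) = norm (hderiv k f u - hderiv k f t - (g u - g t))"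
    using u(2) by (metis norm_scaleR)
  moreover have "\<dots> \<le> norm (hderiv k f u) + norm (hderiv k f t) + norm (g u - g t)"
    by (meson add_right_mono norm_triangle_ineq4 order_trans)
  moreover have "norm (hderiv k f u) \<le> ?N k" "norm (hderiv k f t) \<le> ?N k"
    using sup_norm_on_upper[OF f] t u by blast+
  ultimately have "h * norm (hderiv (Suc k) f t) \<le> 2 * ?N k + h * ?N (Suc (Suc k)) * h"
    unfolding u(2) by linarith
  then have "norm (hderiv (Suc k) f t) \<le> (2 * ?N k + h * ?N (Suc (Suc k)) * h) / h"
    using \<open>0 < h\<close> by (simp add: pos_le_divide_eq mult.commute)
  also have "\<dots> = 2 * ?N k / h + h * ?N (Suc (Suc k))"
    using \<open>0 < h\<close> by (simp add: add_divide_distrib)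
  finally show "norm (hderiv (Suc k) f t) \<le> 2 * ?N k / h + h * ?N (Suc (Suc k))" .
qed (use assms in auto)

text \<open>Landau's inequality with step \<open>h / (4c)\<close> lets the first derivative on the right be absorbed.\<close>

lemma landau_inequality_high_order:
  assumes T: "1 \<le> T"
  shows "\<exists>c\<ge>1. \<forall>(f :: real \<Rightarrow> 'v::real_normed_vector) k h. smth f \<longrightarrow> 0 < h \<longrightarrow> h \<le> 1 \<longrightarrow>
    sup_norm_on T (hderiv (Suc k) f) \<le>
      c * (sup_norm_on T (hderiv k f) / h + h ^ Suc m * sup_norm_on T (hderiv (Suc (Suc (k + m))) f))"
proof (induction m)
  case 0
  show ?case
  proof (intro exI[of _ 2] conjI allI impI)
    fix f :: "real \<Rightarrow> 'v" and k and h :: real assume f: "smth f" and h: "0 < h" "h \<le> 1"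
    have "0 \<le> h * sup_norm_on T (hderiv (Suc (Suc k)) f)"
      using sup_norm_on_nonneg[OF f] h T by (intro mult_nonneg_nonneg) auto
    with landau_inequality[OF f T h, of k]
    show "sup_norm_on T (hderiv (Suc k) f) \<le> 2 * (sup_norm_on T (hderiv k f) / h
        + h ^ Suc 0 * sup_norm_on T (hderiv (Suc (Suc (k + 0))) f))"
      by simp
  qed simp
next
  case (Suc m)
  then obtain c where c: "c \<ge> 1" and IH: "\<And>(f :: real \<Rightarrow> 'v) k h. smth f \<Longrightarrow> 0 < h \<Longrightarrow> h \<le> 1 \<Longrightarrow>
    sup_norm_on T (hderiv (Suc k) f) \<le>
      c * (sup_norm_on T (hderiv k f) / h + h ^ Suc m * sup_norm_on T (hderiv (Suc (Suc (k + m))) f))"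
    by metis
  show ?case
  proof (intro exI[of _ "8 * c"] conjI allI impI)
    fix f :: "real \<Rightarrow> 'v" and k and h :: real assume f: "smth f" and h: "0 < h" "h \<le> 1"
    let ?N = "\<lambda>k. sup_norm_on T (hderiv k f)"
    have N: "0 \<le> ?N j" for j using sup_norm_on_nonneg[OF f] T by auto
    \<comment> \<open>With this step the factor \<open>c\<close> of the induction hypothesis leaves
      exactly half of \<open>?N (Suc k)\<close> on the right; absorbing it doubles
      \<open>4 * c\<close> to \<open>8 * c\<close>.\<close>
    have "h / (2 * c) \<le> h" using h c by (simp add: field_simps)
    then have h': "0 < h / (2 * c)" "h / (2 * c) \<le> 1" using h c by auto
    have "?N (Suc k) \<le> 2 * ?N k / (h / (2 * c)) + h / (2 * c) * ?N (Suc (Suc k))"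
      by (rule landau_inequality[OF f T h'])
    also have "2 * ?N k / (h / (2 * c)) = 4 * c * (?N k / h)" by simp
    also have "h / (2 * c) * ?N (Suc (Suc k)) \<le> h / (2 * c) *
        (c * (?N (Suc k) / h + h ^ Suc m * ?N (Suc (Suc (Suc k + m)))))"
      using h' by (intro mult_left_mono IH f h) auto
    also have "\<dots> = ?N (Suc k) / 2 + (h * h ^ Suc m) * ?N (Suc (Suc (Suc k + m))) / 2"
      using h c by (simp add: field_simps del: power_Suc)
    finally have "?N (Suc k) \<le> 8 * c * (?N k / h) + h ^ Suc (Suc m) * ?N (Suc (Suc (k + Suc m)))"
      by simp
    also have "h ^ Suc (Suc m) * ?N (Suc (Suc (k + Suc m))) \<le>
        8 * c * (h ^ Suc (Suc m) * ?N (Suc (Suc (k + Suc m))))"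
      using mult_right_mono[of 1 "8 * c" "h ^ Suc (Suc m) * ?N (Suc (Suc (k + Suc m)))"] c h N
      by simp
    finally show "?N (Suc k) \<le> 8 * c * (?N k / h + h ^ Suc (Suc m) * ?N (Suc (Suc (k + Suc m))))"
      by (simp add: distrib_left)
  qed (use c in simp)
qed

text \<open>A function that is small in the supremum norm and has bounded derivatives has small
  derivatives. As \<open>q\<close> is free, the power of smallness that is lost can be made as small
  as desired by the choice of \<open>h\<close>.\<close>

lemma derivative_interpolation:
  assumes T: "1 \<le> T"
  shows "\<exists>C K. 0 \<le> C \<and> (\<forall>(f :: real \<Rightarrow> 'v::real_normed_vector) M h. smth f \<longrightarrow> 0 < h \<longrightarrow> h \<le> 1 \<longrightarrow>
    (\<forall>k\<le>K. sup_norm_on T (hderiv k f) \<le> M) \<longrightarrow>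
    sup_norm_on T (hderiv p f) \<le> C * (sup_norm_on T f / h ^ p + h ^ q * M))"
proof (induction p arbitrary: q)
  case 0
  show ?case
  proof (intro exI[of _ "1::real"] exI[of _ "0::nat"] conjI allI impI)
    fix f :: "real \<Rightarrow> 'v" and M h :: real
    assume f: "smth f" "0 < h" "h \<le> 1" and M: "\<forall>k\<le>0. sup_norm_on T (hderiv k f) \<le> M"
    have "0 \<le> h ^ q * M"
      using M sup_norm_on_nonneg[OF f(1), of T 0] T f by (intro mult_nonneg_nonneg) auto
    then show "sup_norm_on T (hderiv 0 f) \<le> 1 * (sup_norm_on T f / h ^ 0 + h ^ q * M)" by simp
  qed auto
next
  case (Suc p)
  obtain c where c: "c \<ge> 1" "\<And>(f :: real \<Rightarrow> 'v) k h. smth f \<Longrightarrow> 0 < h \<Longrightarrow> h \<le> 1 \<Longrightarrow>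
    sup_norm_on T (hderiv (Suc k) f) \<le>
      c * (sup_norm_on T (hderiv k f) / h + h ^ Suc q * sup_norm_on T (hderiv (Suc (Suc (k + q))) f))"
    using landau_inequality_high_order[OF T] by metis
  \<comment> \<open>\<open>Suc q\<close>, because the division by \<open>h\<close> below costs one
    power.\<close>
  obtain C K where C: "0 \<le> C" "\<And>(f :: real \<Rightarrow> 'v) M h. smth f \<Longrightarrow> 0 < h \<Longrightarrow> h \<le> 1 \<Longrightarrow>
    (\<forall>k\<le>K. sup_norm_on T (hderiv k f) \<le> M) \<Longrightarrow>
    sup_norm_on T (hderiv p f) \<le> C * (sup_norm_on T f / h ^ p + h ^ Suc q * M)"
    using Suc[of "Suc q"] by metis
  show ?case
  proof (intro exI[of _ "c * (C + 1)"] exI[of _ "max K (Suc (Suc (p + q)))"] conjI allI impI)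
    fix f :: "real \<Rightarrow> 'v" and M h :: real
    assume f: "smth f" and h: "0 < h" "h \<le> 1"
      and M: "\<forall>k\<le>max K (Suc (Suc (p + q))). sup_norm_on T (hderiv k f) \<le> M"
    define a where "a = sup_norm_on T f"
    have a: "0 \<le> a" using sup_norm_on_nonneg[OF f, of T 0] T by (simp add: a_def)
    have "0 \<le> M" using sup_norm_on_nonneg[OF f, of T 0] T M by (meson order_trans zero_le zero_le_one)
    have 1: "sup_norm_on T (hderiv p f) / h \<le> C * (a / h ^ p + h ^ Suc q * M) / h"
      unfolding a_def using M h by (intro divide_right_mono C f) auto
    have 2: "\<dots> = C * (a / h ^ Suc p + h ^ q * M)"
      using h by (simp add: field_simps)
    have 3: "h ^ Suc q * sup_norm_on T (hderiv (Suc (Suc (p + q))) f) \<le> h ^ q * M"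
      using M h sup_norm_on_nonneg[OF f] T
      by (intro mult_mono) (auto simp: mult_left_le_one_le)
    have "sup_norm_on T (hderiv (Suc p) f) \<le> c * (sup_norm_on T (hderiv p f) / h
        + h ^ Suc q * sup_norm_on T (hderiv (Suc (Suc (p + q))) f))"
      by (rule c(2)[OF f h])
    also have "\<dots> \<le> c * (C * (a / h ^ Suc p + h ^ q * M) + h ^ q * M)"
      using 1 2 3 c(1) by (intro mult_left_mono add_mono) auto
    also have "\<dots> \<le> c * (C * (a / h ^ Suc p + h ^ q * M) + (a / h ^ Suc p + h ^ q * M))"
      using c(1) a h by (intro mult_left_mono add_left_mono) auto
    finally show "sup_norm_on T (hderiv (Suc p) f) \<le> c * (C + 1) * (sup_norm_on T f / h ^ Suc p + h ^ q * M)"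
      unfolding a_def by (simp only: distrib_left distrib_right mult.assoc mult_1_left mult_1_right)
  qed (use c C in auto)
qed

section \<open>Uniform limits and their derivatives\<close>

lemma geometric_uniform_limit:
  fixes u :: "nat \<Rightarrow> real \<Rightarrow> 'v::{real_normed_vector, complete_space}"
  assumes \<rho>: "0 \<le> \<rho>" "\<rho> < 1"
    and u: "\<And>T. \<exists>C. \<forall>j t. \<bar>t\<bar> \<le> T \<longrightarrow> norm (u j t - u (Suc j) t) \<le> C * \<rho> ^ j"
  shows "\<exists>U. \<forall>T. \<exists>C. \<forall>j t. \<bar>t\<bar> \<le> T \<longrightarrow> norm (u j t - U t) \<le> C * \<rho> ^ j"
proof -
  have tail: "\<exists>C. \<forall>j n t. \<bar>t\<bar> \<le> T \<longrightarrow> norm (u j t - u (j + n) t) \<le> C * \<rho> ^ j" for T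
  proof -
    obtain C where C: "\<And>j t. \<bar>t\<bar> \<le> T \<Longrightarrow> norm (u j t - u (Suc j) t) \<le> C * \<rho> ^ j" using u by blast
    \<comment> \<open>The factor in the sum of the geometric series; it solves
      \<open>\<bar>C\<bar> + \<rho> * C' = C'\<close>, which closes the induction.\<close>
    define C' where "C' = \<bar>C\<bar> / (1 - \<rho>)"
    have C': "0 \<le> C'" "\<bar>C\<bar> + \<rho> * C' = C'" using \<rho> by (auto simp: C'_def field_simps)
    have "norm (u j t - u (j + n) t) \<le> C' * \<rho> ^ j" if t: "\<bar>t\<bar> \<le> T" for j n t
    proof (induction n arbitrary: j)
      case 0 show ?case using C' \<rho> by simp
    next
      case (Suc n)
      have "u j t - u (j + Suc n) t = (u j t - u (Suc j) t) + (u (Suc j) t - u (Suc j + n) t)" by simp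
      also have "norm \<dots> \<le> norm (u j t - u (Suc j) t) + norm (u (Suc j) t - u (Suc j + n) t)"
        by (rule norm_triangle_ineq)
      also have "\<dots> \<le> C * \<rho> ^ j + C' * \<rho> ^ Suc j" by (intro add_mono C t Suc)
      also have "\<dots> \<le> \<bar>C\<bar> * \<rho> ^ j + C' * \<rho> ^ Suc j"
        using \<rho> by (intro add_right_mono mult_right_mono) auto
      also have "\<dots> = (\<bar>C\<bar> + \<rho> * C') * \<rho> ^ j" by (simp add: algebra_simps)
      finally show ?case unfolding C' .
    qed
    then show ?thesis by blast
  qed
  have "Cauchy (\<lambda>j. u j t)" for t
  proof (rule metric_CauchyI)
    fix e :: real assume "e > 0"
    obtain C where C: "\<And>j n. norm (u j t - u (j + n) t) \<le> C * \<rho> ^ j" using tail[of "\<bar>t\<bar>"] by blast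
    have "(\<lambda>j. C * \<rho> ^ j) \<longlonglongrightarrow> C * 0" using \<rho> by (intro tendsto_mult tendsto_const LIMSEQ_power_zero) auto
    then obtain N where N: "\<And>j. j \<ge> N \<Longrightarrow> C * \<rho> ^ j < e / 2"
      using order_tendstoD(2)[of _ "C * 0" sequentially "e / 2"] \<open>e > 0\<close>
      unfolding eventually_sequentially by auto
    have "dist (u N t) (u m t) < e / 2" if "m \<ge> N" for m
      using C[of N "m - N"] N[of N] that by (simp add: dist_norm)
    then show "\<exists>M. \<forall>m\<ge>M. \<forall>n\<ge>M. dist (u m t) (u n t) < e"
      by (metis dist_triangle_half_r)
  qed
  then have lim: "(\<lambda>j. u j t) \<longlonglongrightarrow> lim (\<lambda>j. u j t)" for t
    using Cauchy_convergent_iff convergent_LIMSEQ_iff by blast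
  show ?thesis
  proof (intro exI[of _ "\<lambda>t. lim (\<lambda>j. u j t)"] allI)
    fix T
    obtain C where C: "\<And>j n t. \<bar>t\<bar> \<le> T \<Longrightarrow> norm (u j t - u (j + n) t) \<le> C * \<rho> ^ j" using tail by blast
    have "norm (u j t - lim (\<lambda>j. u j t)) \<le> C * \<rho> ^ j" if "\<bar>t\<bar> \<le> T" for j t
    proof (rule tendsto_upperbound)
      show "(\<lambda>n. norm (u j t - u (j + n) t)) \<longlonglongrightarrow> norm (u j t - lim (\<lambda>j. u j t))"
        using LIMSEQ_ignore_initial_segment[OF lim[of t], of j]
        by (intro tendsto_norm tendsto_diff tendsto_const) (simp add: add.commute)
    qed (use C that in auto)
    then show "\<exists>C. \<forall>j t. \<bar>t\<bar> \<le> T \<longrightarrow> norm (u j t - lim (\<lambda>j. u j t)) \<le> C * \<rho> ^ j" by blast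
  qed
qed

text \<open>The mean value inequality controls the increments of \<open>u i - u J\<close> uniformly
  in \<open>i\<close>; letting \<open>i\<close> tend to infinity controls those of
  \<open>U - u J\<close>, and \<open>u J\<close> is differentiable.\<close>

lemma has_vector_derivative_uniform_limit:
  fixes u :: "nat \<Rightarrow> real \<Rightarrow> 'v::real_normed_vector"
  assumes du: "\<And>j t. (u j has_vector_derivative u' j t) (at t)"
    and lim: "\<And>t. (\<lambda>j. u j t) \<longlonglongrightarrow> U t"
    and unif: "\<And>T e. 0 < e \<Longrightarrow> \<exists>J. \<forall>j\<ge>J. \<forall>t. \<bar>t\<bar> \<le> T \<longrightarrow> norm (u' j t - U' t) \<le> e"
  shows "(U has_vector_derivative U' t) (at t)"
  unfolding has_vector_derivative_iff_quotient
proof (rule tendstoI)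
  fix e :: real assume "e > 0"
  then obtain J where J: "\<And>j x. j \<ge> J \<Longrightarrow> \<bar>x\<bar> \<le> \<bar>t\<bar> + 1 \<Longrightarrow> norm (u' j x - U' x) \<le> e / 8"
    using unif[of "e / 8"] by fastforce
  have "((\<lambda>s. (u J (t + s) - u J t) /\<^sub>R s) \<longlongrightarrow> u' J t) (at 0)"
    using du has_vector_derivative_iff_quotient by blast
  then have "\<forall>\<^sub>F s in at 0. dist ((u J (t + s) - u J t) /\<^sub>R s) (u' J t) < e / 2"
    using \<open>e > 0\<close> by (intro tendstoD) auto
  moreover have "\<forall>\<^sub>F s in at (0::real). dist s 0 < 1 \<and> s \<noteq> 0"
    unfolding eventually_at by (rule exI[of _ 1]) auto
  ultimately show "\<forall>\<^sub>F s in at 0. dist ((U (t + s) - U t) /\<^sub>R s) (U' t) < e"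
  proof eventually_elim
    case (elim s)
    then have s: "\<bar>s\<bar> < 1" "s \<noteq> 0" by auto
    have "norm ((u i (t + s) - u J (t + s)) - (u i t - u J t)) \<le> (e / 4) * \<bar>(t + s) - t\<bar>" if "i \<ge> J" for i
    proof (rule norm_increment_bound[of _ _ "\<lambda>x. u i x - u J x" "\<lambda>x. u' i x - u' J x"])
      fix x assume "x \<in> {min t (t + s)..max t (t + s)}"
      then have x: "\<bar>x\<bar> \<le> \<bar>t\<bar> + 1" using s by (auto simp: min_def max_def split: if_splits)
      show "((\<lambda>x. u i x - u J x) has_vector_derivative u' i x - u' J x) (at x)"
        by (intro has_vector_derivative_diff du)
      have "norm (u' i x - u' J x) \<le> norm (u' i x - U' x) + norm (u' J x - U' x)"
        by (metis norm_triangle_ineq4 diff_diff_eq2 diff_add_cancel)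
      then show "norm (u' i x - u' J x) \<le> e / 4" using J[OF that x] J[OF order_refl x] by linarith
    qed
    then have "norm ((U (t + s) - u J (t + s)) - (U t - u J t)) \<le> (e / 4) * \<bar>s\<bar>"
      by (intro tendsto_upperbound[where f = "\<lambda>i. norm ((u i (t + s) - u J (t + s)) - (u i t - u J t))"
            and F = sequentially])
        (auto intro!: tendsto_intros lim eventually_sequentiallyI[of J])
    then have "norm ((U (t + s) - u J (t + s)) - (U t - u J t)) / \<bar>s\<bar> \<le> e / 4"
      using s by (simp add: pos_divide_le_eq)
    then have 1: "norm (((U (t + s) - u J (t + s)) - (U t - u J t)) /\<^sub>R s) \<le> e / 4"
      unfolding norm_scaleR abs_inverse by (simp only: divide_inverse mult.commute)
    have eq: "(U (t + s) - U t) /\<^sub>R s - U' t = ((U (t + s) - u J (t + s)) - (U t - u J t)) /\<^sub>R s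
        + ((u J (t + s) - u J t) /\<^sub>R s - u' J t) + (u' J t - U' t)"
      by (simp add: algebra_simps)
    have "norm ((U (t + s) - U t) /\<^sub>R s - U' t) \<le> e / 4 + norm ((u J (t + s) - u J t) /\<^sub>R s - u' J t) + e / 8"
      unfolding eq using 1 J[of J t] by (intro norm_triangle_le add_mono) auto
    then show ?case using elim \<open>e > 0\<close> by (simp add: dist_norm)
  qed
qed


text \<open>The dyadic difference quotients in \<open>s\<close> converge together with all \<open>t\<close>-derivatives:
  consecutive ones differ by \<open>R / (2s)\<close>, where the second difference \<open>R\<close> is \<open>O(s^2)\<close> and has
  bounded \<open>t\<close>-derivatives, so that by interpolation all these derivatives are \<open>O(s^(3/2))\<close>.\<close>

theorem curvewise_smooth_partial_derivative:
  fixes G :: "real \<Rightarrow> real \<Rightarrow> 'v::{real_normed_vector, complete_space}"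
  assumes G: "curvewise_smooth G"
  shows "smth (\<lambda>t. hderiv 1 (\<lambda>s. G t s) 0)"
proof -
  define s :: "nat \<Rightarrow> real" where "s = (\<lambda>j. (1/2) ^ j)"
  have s: "0 < s j" "s j \<le> 1" "s j = 2 * s (Suc j)" for j
    by (auto simp: s_def power_le_one)
  define D where "D = (\<lambda>j t. (1 / s j) *\<^sub>R (G t (s j) - G t 0))"
  define R where "R = (\<lambda>j t. G t (s j) - 2 *\<^sub>R G t (s (Suc j)) + G t 0)"
  note sec = curvewise_smooth_sections[OF G]
  have smD: "smth (D j)" and smR: "smth (R j)" for j
    unfolding D_def R_def by (intro smth_scale smth_diff smth_add sec)+
  have DR: "D j t - D (Suc j) t = (1 / (2 * s (Suc j))) *\<^sub>R R j t" for j t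
    using s(1)[of "Suc j"]
    by (simp add: D_def R_def s(3)[of j] algebra_simps) (simp flip: scaleR_add_left)
  have Rbound: "\<exists>C. \<forall>j. sup_norm_on T (hderiv p (R j)) \<le> C * s (Suc j) * sqrt (s (Suc j))"
    if T: "1 \<le> T" for T p
  proof -
    \<comment> \<open>For \<open>h\<close> the root of order \<open>2 * Suc p\<close> of the step
      \<open>s\<close>, \<open>h ^ q\<close> is \<open>s * sqrt s\<close>, while dividing the bound
      \<open>s^2\<close> by \<open>h ^ p\<close> costs at most \<open>sqrt s\<close>. Both
      interpolation terms are then of order \<open>s^(3/2)\<close>.\<close>
    define q where "q = 3 * Suc p"
    obtain C K where C: "0 \<le> C" "\<And>(f :: real \<Rightarrow> 'v) M h. smth f \<Longrightarrow> 0 < h \<Longrightarrow> h \<le> 1 \<Longrightarrow>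
        (\<forall>k\<le>K. sup_norm_on T (hderiv k f) \<le> M) \<Longrightarrow>
        sup_norm_on T (hderiv p f) \<le> C * (sup_norm_on T f / h ^ p + h ^ q * M)"
      using derivative_interpolation[OF T, of p q] by metis
    have "\<forall>k. \<exists>M. \<forall>t s. \<bar>t\<bar> \<le> T \<longrightarrow> \<bar>s\<bar> \<le> T \<longrightarrow> norm (hderiv k (\<lambda>t. G t s) t) \<le> M"
      using curvewise_smooth_bounded[OF G] by blast
    then obtain M where M: "\<And>k t s. \<bar>t\<bar> \<le> T \<Longrightarrow> \<bar>s\<bar> \<le> T \<Longrightarrow> norm (hderiv k (\<lambda>t. G t s) t) \<le> M k"
      by metis
    define B where "B = (\<Sum>k\<le>K. 4 * M k)"
    have M0: "0 \<le> M k" for k using M[of 0 0 k] T by (simp add: order.trans[OF norm_ge_zero])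
    then have B0: "0 \<le> B" unfolding B_def by (intro sum_nonneg) auto
    have RB: "sup_norm_on T (hderiv k (R j)) \<le> B" if "k \<le> K" for k j
    proof -
      have "sup_norm_on T (hderiv k (R j)) \<le> 4 * M k"
      proof (rule sup_norm_on_least)
        fix t assume t: "\<bar>t\<bar> \<le> T"
        have "hderiv k (R j) t = hderiv k (\<lambda>t. G t (s j)) t - 2 *\<^sub>R hderiv k (\<lambda>t. G t (s (Suc j))) t
            + hderiv k (\<lambda>t. G t 0) t"
          unfolding R_def by (simp add: hderiv_add hderiv_diff hderiv_scale smth_diff smth_scale sec)
        also have "norm \<dots> \<le> norm (hderiv k (\<lambda>t. G t (s j)) t) + 2 * norm (hderiv k (\<lambda>t. G t (s (Suc j))) t)
            + norm (hderiv k (\<lambda>t. G t 0) t)"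
          by (intro norm_triangle_le add_mono order.trans[OF norm_triangle_ineq4]) auto
        also have "\<dots> \<le> M k + 2 * M k + M k"
          using s[of j] s[of "Suc j"] T t by (intro add_mono mult_left_mono M) auto
        finally show "norm (hderiv k (R j) t) \<le> 4 * M k" by simp
      qed (use T in simp)
      also have "\<dots> \<le> B" unfolding B_def
        using that M0 by (intro member_le_sum) auto
      finally show ?thesis .
    qed
    obtain M2 where M2: "\<And>t s. \<bar>t\<bar> \<le> T \<Longrightarrow> \<bar>s\<bar> \<le> T \<Longrightarrow> norm (hderiv 2 (\<lambda>s. G t s) s) \<le> M2"
      using curvewise_smooth_bounded[OF curvewise_smooth_swap[OF G], of T 2] by blast
    have M20: "0 \<le> M2" using M2[of 0 0] T by (simp add: order.trans[OF norm_ge_zero])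
    have R0: "sup_norm_on T (R j) \<le> M2 * (s (Suc j))\<^sup>2" for j
    proof (rule sup_norm_on_least)
      fix t assume t: "\<bar>t\<bar> \<le> T"
      let ?g = "\<lambda>s. G t s" and ?s = "s (Suc j)"
      have s1: "0 < ?s" "2 * ?s \<le> 1" using s[of j] s[of "Suc j"] by auto
      have "norm ((?g (?s + ?s) - ?g ?s) - (?g (0 + ?s) - ?g 0)) \<le> (M2 * ?s) * \<bar>?s - 0\<bar>"
      proof (rule norm_increment_bound[where f = "\<lambda>x. ?g (x + ?s) - ?g x"
            and f' = "\<lambda>x. hderiv 1 ?g (x + ?s) - hderiv 1 ?g x"])
        fix x assume "x \<in> {min 0 ?s..max 0 ?s}"
        then have x: "0 \<le> x" "x \<le> ?s" using s1 by auto
        have "((\<lambda>x. x + ?s) has_vector_derivative 1) (at x)" by (auto intro!: derivative_eq_intros)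
        from vector_diff_chain_at[OF this smth_hderiv1(1)[OF sec(2)]]
        have "((\<lambda>x. ?g (x + ?s)) has_vector_derivative hderiv 1 ?g (x + ?s)) (at x)"
          by (simp add: o_def)
        then show "((\<lambda>x. ?g (x + ?s) - ?g x) has_vector_derivative hderiv 1 ?g (x + ?s) - hderiv 1 ?g x) (at x)"
          by (intro has_vector_derivative_diff smth_hderiv1(1) sec)
        have "norm (hderiv 1 ?g (x + ?s) - hderiv 1 ?g x) \<le> M2 * \<bar>x + ?s - x\<bar>"
        proof (rule norm_increment_bound)
          fix y assume "y \<in> {min x (x + ?s)..max x (x + ?s)}"
          then have "\<bar>y\<bar> \<le> T" using x s1 T by auto
          then show "norm (hderiv 2 ?g y) \<le> M2" by (rule M2[OF t])
          show "(hderiv 1 ?g has_vector_derivative hderiv 2 ?g y) (at y)"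
            using has_hderiv[OF sec(2), of 1 t y] by (simp add: numeral_2_eq_2)
        qed
        then show "norm (hderiv 1 ?g (x + ?s) - hderiv 1 ?g x) \<le> M2 * ?s" using s1 by simp
      qed
      moreover have "R j t = (?g (?s + ?s) - ?g ?s) - (?g (0 + ?s) - ?g 0)"
        by (simp add: R_def s(3)[of j] scaleR_2)
      ultimately show "norm (R j t) \<le> M2 * ?s\<^sup>2" using s1 by (simp only: power2_eq_square mult.assoc diff_0_right abs_of_pos)
    qed (use T in simp)
    have "sup_norm_on T (hderiv p (R j)) \<le> C * (M2 + B) * s (Suc j) * sqrt (s (Suc j))" for j
    proof -
      let ?s = "s (Suc j)"
      have s1: "0 < ?s" "?s \<le> 1" using s(1,2) by auto
      define h where "h = root (2 * Suc p) ?s"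
      have h: "0 < h" "h \<le> 1" using s1 by (auto simp: h_def)
      have h2: "h ^ Suc p = sqrt ?s"
      proof -
        have "h ^ (2 * Suc p) = ?s" unfolding h_def using s1 by (intro real_root_pow_pos2) auto
        then have "(h ^ Suc p)\<^sup>2 = ?s" by (metis power_mult mult.commute)
        then show ?thesis using h by (metis real_sqrt_unique zero_le_power less_imp_le)
      qed
      have hp: "sqrt ?s \<le> h ^ p" unfolding h2[symmetric] using h by (intro power_decreasing) auto
      have hq: "h ^ q = ?s * sqrt ?s"
        unfolding q_def power_mult mult.commute[of 3] h2
        using s1 by (simp add: power3_eq_cube)
      have "sup_norm_on T (R j) / h ^ p \<le> M2 * ?s\<^sup>2 / sqrt ?s"
        using R0[of j] hp s1 M20 h sup_norm_on_nonneg[OF smR, of T 0 j] T by (intro frac_le) auto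
      also have "\<dots> = M2 * (?s * sqrt ?s)"
        using s1 by (simp add: field_simps power2_eq_square)
      finally have "sup_norm_on T (hderiv p (R j)) \<le> C * (M2 * (?s * sqrt ?s) + (?s * sqrt ?s) * B)"
        using C(2)[OF smR h, of j B] RB C(1) unfolding hq
        by (intro order.trans[OF C(2)[OF smR h, of j B]] mult_left_mono add_mono) (auto simp: hq)
      then show ?thesis by (simp add: algebra_simps)
    qed
    then show ?thesis by blast
  qed
  \<comment> \<open>Dividing \<open>s^(3/2)\<close> by \<open>2 s\<close> leaves
    \<open>sqrt s\<close>, which decays geometrically with this ratio along dyadic steps.\<close>
  define \<rho> where "\<rho> = sqrt (1/2)"
  have \<rho>: "0 \<le> \<rho>" "\<rho> < 1" by (simp_all add: \<rho>_def)
  have s\<rho>: "sqrt (s (Suc j)) \<le> \<rho> ^ j" for j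
  proof -
    have "sqrt (s (Suc j)) = \<rho> ^ Suc j" unfolding s_def \<rho>_def by (rule real_sqrt_power)
    also have "\<dots> \<le> \<rho> ^ j" using \<rho> by (intro power_decreasing) auto
    finally show ?thesis .
  qed
  have step: "\<exists>C. \<forall>j t. \<bar>t\<bar> \<le> T \<longrightarrow> norm (hderiv p (D j) t - hderiv p (D (Suc j)) t) \<le> C * \<rho> ^ j" for T p
  proof -
    obtain C where C: "\<And>j. sup_norm_on (max 1 T) (hderiv p (R j)) \<le> C * s (Suc j) * sqrt (s (Suc j))"
      using Rbound[of "max 1 T" p] by auto
    have "norm (hderiv p (D j) t - hderiv p (D (Suc j)) t) \<le> \<bar>C\<bar> * \<rho> ^ j" if "\<bar>t\<bar> \<le> T" for j t
    proof -
      have "hderiv p (D j) t - hderiv p (D (Suc j)) t = hderiv p (\<lambda>t. D j t - D (Suc j) t) t"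
        by (simp add: hderiv_diff smD)
      also have "\<dots> = (1 / (2 * s (Suc j))) *\<^sub>R hderiv p (R j) t"
        unfolding DR by (simp add: hderiv_scale smR)
      also have "norm \<dots> = norm (hderiv p (R j) t) / (2 * s (Suc j))" using s(1)[of "Suc j"] by simp
      also have "\<dots> \<le> (C * s (Suc j) * sqrt (s (Suc j))) / (2 * s (Suc j))"
        using s(1)[of "Suc j"] that
        by (intro divide_right_mono order.trans[OF sup_norm_on_upper[OF smR, of t "max 1 T"] C]) auto
      also have "\<dots> = C / 2 * sqrt (s (Suc j))" using s(1)[of "Suc j"] by simp
      also have "\<dots> \<le> \<bar>C\<bar> * \<rho> ^ j" using s\<rho>[of j] s(1)[of "Suc j"] by (intro mult_mono) auto
      finally show ?thesis .
    qed
    then show ?thesis by blast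
  qed
  have "\<forall>p. \<exists>U. \<forall>T. \<exists>C. \<forall>j t. \<bar>t\<bar> \<le> T \<longrightarrow> norm (hderiv p (D j) t - U t) \<le> C * \<rho> ^ j"
    using geometric_uniform_limit[OF \<rho> step] by blast
  then obtain U where U: "\<And>p T. \<exists>C. \<forall>j t. \<bar>t\<bar> \<le> T \<longrightarrow> norm (hderiv p (D j) t - U p t) \<le> C * \<rho> ^ j"
    by metis
  have \<rho>lim: "(\<lambda>j. C * \<rho> ^ j) \<longlonglongrightarrow> 0" for C
    using tendsto_mult[OF tendsto_const[of C] LIMSEQ_power_zero[of \<rho>]] \<rho> by simp
  have lim: "(\<lambda>j. hderiv p (D j) t) \<longlonglongrightarrow> U p t" for p t
  proof -
    obtain C where "\<And>j. norm (hderiv p (D j) t - U p t) \<le> C * \<rho> ^ j" using U[of "\<bar>t\<bar>" p] by blast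
    then have "(\<lambda>j. hderiv p (D j) t - U p t) \<longlonglongrightarrow> 0"
      by (intro Lim_null_comparison[OF _ \<rho>lim[of C]]) auto
    then show ?thesis using Lim_null by blast
  qed
  have "(U p has_vector_derivative U (Suc p) t) (at t)" for p t
  proof (rule has_vector_derivative_uniform_limit[OF has_hderiv[OF smD] lim])
    fix T e :: real assume "0 < e"
    obtain C where C: "\<And>j t. \<bar>t\<bar> \<le> T \<Longrightarrow> norm (hderiv (Suc p) (D j) t - U (Suc p) t) \<le> C * \<rho> ^ j"
      using U[of T "Suc p"] by blast
    obtain J where "\<And>j. j \<ge> J \<Longrightarrow> C * \<rho> ^ j < e"
      using order_tendstoD(2)[OF \<rho>lim \<open>0 < e\<close>] unfolding eventually_sequentially by blast
    with C show "\<exists>J. \<forall>j\<ge>J. \<forall>t. \<bar>t\<bar> \<le> T \<longrightarrow> norm (hderiv (Suc p) (D j) t - U (Suc p) t) \<le> e"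
      by (meson less_imp_le order_trans)
  qed
  then have "smth (U 0)" by (rule smthI_seq(1))
  \<comment> \<open>The derivative in \<open>s\<close> is already known to exist, so its value can
    be read off along the dyadic steps.\<close>
  moreover have "U 0 = (\<lambda>t. hderiv 1 (\<lambda>s. G t s) 0)"
  proof
    fix t
    have "((\<lambda>x. (G t (0 + x) - G t 0) /\<^sub>R x) \<longlongrightarrow> hderiv 1 (\<lambda>s. G t s) 0) (at 0)"
      using smth_hderiv1(1)[OF sec(2)] has_vector_derivative_iff_quotient by blast
    moreover have "filterlim s (at 0) sequentially"
      unfolding filterlim_at s_def by (auto intro!: LIMSEQ_power_zero)
    ultimately have "(\<lambda>j. (G t (0 + s j) - G t 0) /\<^sub>R s j) \<longlonglongrightarrow> hderiv 1 (\<lambda>s. G t s) 0"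
      by (rule filterlim_compose)
    moreover have "(\<lambda>j. (G t (0 + s j) - G t 0) /\<^sub>R s j) = (\<lambda>j. hderiv 0 (D j) t)"
      by (simp add: D_def divide_inverse)
    ultimately show "U 0 t = hderiv 1 (\<lambda>s. G t s) 0" using lim[of 0 t] LIMSEQ_unique by fastforce
  qed
  ultimately show ?thesis by simp
qed

section \<open>Smooth maps on Frechet spaces with graph seminorms\<close>

text \<open>Covers both \<open>D(A^inf)\<close> and \<open>D(A0^inf)\<close>.
  \<open>graph_closed\<close> is completeness in the form in which a closed operator supplies it:
  limits of all coordinates \<open>A^m x\<close> are the coordinates of one element.\<close>

locale graph_frechet_space =
  fixes E :: "'h::{real_normed_vector, complete_space} set" and A :: "'h \<Rightarrow> 'h"
  assumes subspace_E: "subspace E"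
    and A_mem: "h \<in> E \<Longrightarrow> A h \<in> E"
    and A_add: "g \<in> E \<Longrightarrow> h \<in> E \<Longrightarrow> A (g + h) = A g + A h"
    and A_scale: "h \<in> E \<Longrightarrow> A (r *\<^sub>R h) = r *\<^sub>R A h"
    and graph_closed: "(\<And>n::nat. x n \<in> E) \<Longrightarrow> (\<And>m. (\<lambda>n. (A ^^ m) (x n)) \<longlonglongrightarrow> l m) \<Longrightarrow>
      l 0 \<in> E \<and> (\<forall>m. (A ^^ m) (l 0) = l m)"
begin

abbreviation "X \<equiv> seminorm_topology E (graph_seminorm A)"
abbreviation "p \<equiv> graph_seminorm A"

lemma pow_mem: "h \<in> E \<Longrightarrow> (A ^^ m) h \<in> E"
  by (induction m) (auto intro: A_mem)

lemma pow_add: "g \<in> E \<Longrightarrow> h \<in> E \<Longrightarrow> (A ^^ m) (g + h) = (A ^^ m) g + (A ^^ m) h"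
  by (induction m) (auto simp: A_add pow_mem)

lemma pow_scale: "h \<in> E \<Longrightarrow> (A ^^ m) (r *\<^sub>R h) = r *\<^sub>R (A ^^ m) h"
  by (induction m) (auto simp: A_scale pow_mem)

lemma pow_diff: "g \<in> E \<Longrightarrow> h \<in> E \<Longrightarrow> (A ^^ m) (g - h) = (A ^^ m) g - (A ^^ m) h"
  using pow_add[of g "(-1) *\<^sub>R h"] pow_scale[of h m "-1"] subspace_scale[OF subspace_E, of h "-1"] by simp

lemma zero_mem: "0 \<in> E" using subspace_E by (rule subspace_0)

lemma pow_zero: "(A ^^ m) 0 = 0"
  using pow_scale[OF zero_mem, of m 0] by simp

lemma add_mem: "g \<in> E \<Longrightarrow> h \<in> E \<Longrightarrow> g + h \<in> E"
  and diff_mem: "g \<in> E \<Longrightarrow> h \<in> E \<Longrightarrow> g - h \<in> E"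
  and scale_mem: "h \<in> E \<Longrightarrow> r *\<^sub>R h \<in> E"
  using subspace_E by (auto intro: subspace_add subspace_diff subspace_scale)

lemma sum_mem: "(\<And>i. i \<in> I \<Longrightarrow> f i \<in> E) \<Longrightarrow> (\<Sum>i\<in>I. f i) \<in> E"
  using subspace_E by (rule subspace_sum)

lemma pow_sum: "(\<And>i. i \<in> I \<Longrightarrow> f i \<in> E) \<Longrightarrow> (A ^^ m) (\<Sum>i\<in>I. f i) = (\<Sum>i\<in>I. (A ^^ m) (f i))"
  by (induction I rule: infinite_finite_induct) (auto simp: pow_zero pow_add sum_mem)

lemmas mem_intros = add_mem diff_mem scale_mem sum_mem A_mem pow_mem zero_mem

lemma norm_pow_le: "m \<le> n \<Longrightarrow> norm ((A ^^ m) h) \<le> p n h"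
  unfolding graph_seminorm_def by (rule member_le_sum) auto

lemma p_mono: "m \<le> n \<Longrightarrow> p m h \<le> p n h"
  unfolding graph_seminorm_def by (rule sum_mono2) auto

lemma p_triangle: "g \<in> E \<Longrightarrow> h \<in> E \<Longrightarrow> p n (g + h) \<le> p n g + p n h"
  unfolding graph_seminorm_def sum.distrib[symmetric]
  by (intro sum_mono) (auto simp: pow_add norm_triangle_ineq)

lemma p_scale: "h \<in> E \<Longrightarrow> p n (r *\<^sub>R h) = \<bar>r\<bar> * p n h"
  unfolding graph_seminorm_def by (simp add: pow_scale sum_distrib_left)

lemma p_zero: "p n 0 = 0"
  unfolding graph_seminorm_def by (simp add: pow_zero)

lemma p_nonneg: "0 \<le> p n h"
  unfolding graph_seminorm_def by (rule sum_nonneg) auto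

lemma openin_ball:
  assumes "x \<in> E" "0 < e"
  shows "openin X {y \<in> E. p n (y - x) < e}"
  unfolding seminorm_topology_def
  by (rule topology_generated_by_Basis) (use assms in auto)

lemma topspace_X: "topspace X = E"
proof -
  have "x \<in> \<Union> {{y \<in> E. p n (y - x) < e} |x n e. x \<in> E \<and> 0 < e}" if "x \<in> E" for x
  proof (rule UnionI)
    show "{y \<in> E. p 0 (y - x) < 1} \<in> {{y \<in> E. p n (y - x) < e} |x n e. x \<in> E \<and> 0 < e}"
      using that zero_less_one by blast
    show "x \<in> {y \<in> E. p 0 (y - x) < 1}" using that by (simp add: p_zero)
  qed
  then show ?thesis
    unfolding seminorm_topology_def topology_generated_by_topspace by auto
qed

text \<open>The balls are only a subbasis by definition; as the graph seminorms increase with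
  \<open>n\<close>, the intersection of two balls around a point contains a third.\<close>

lemma openin_X_contains_ball:
  assumes "openin X U" "x \<in> U"
  shows "\<exists>n e. 0 < e \<and> {y \<in> E. p n (y - x) < e} \<subseteq> U"
proof -
  let ?S = "{{y \<in> E. p n (y - x) < e} |x n e. x \<in> E \<and> 0 < e}"
  have "U \<subseteq> E" using openin_subset[OF assms(1)] topspace_X by simp
  have "generate_topology_on ?S U"
    using assms(1) unfolding seminorm_topology_def openin_topology_generated_by_iff .
  then show ?thesis using assms(2)
  proof (induction arbitrary: x)
    case (Int a b)
    have "x \<in> a" "x \<in> b" using Int.prems by auto
    from Int.IH(1)[OF this(1)] Int.IH(2)[OF this(2)]
    obtain n e n' e' where *: "0 < e" "{y \<in> E. p n (y - x) < e} \<subseteq> a"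
        "0 < e'" "{y \<in> E. p n' (y - x) < e'} \<subseteq> b"
      by blast
    have "{y \<in> E. p (max n n') (y - x) < min e e'} \<subseteq> a \<inter> b"
    proof
      fix y assume y: "y \<in> {y \<in> E. p (max n n') (y - x) < min e e'}"
      have "p n (y - x) \<le> p (max n n') (y - x)" "p n' (y - x) \<le> p (max n n') (y - x)"
        by (auto intro: p_mono)
      with y * show "y \<in> a \<inter> b" by auto
    qed
    then show ?case using * by (intro exI[of _ "max n n'"] exI[of _ "min e e'"]) auto
  next
    case (UN K)
    then obtain k where k: "k \<in> K" "x \<in> k" by blast
    from UN.IH[OF this] obtain n e where "0 < e" "{y \<in> E. p n (y - x) < e} \<subseteq> k" by blast
    with k show ?case by blast
  next
    case (Basis s)
    then obtain z n e where s: "s = {y \<in> E. p n (y - z) < e}" "z \<in> E" "0 < e" by blast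
    have "{y \<in> E. p n (y - x) < e - p n (x - z)} \<subseteq> s"
    proof
      fix y assume y: "y \<in> {y \<in> E. p n (y - x) < e - p n (x - z)}"
      have "x \<in> E" using Basis s by auto
      then have "p n ((y - x) + (x - z)) \<le> p n (y - x) + p n (x - z)"
        using y s by (intro p_triangle mem_intros) auto
      then show "y \<in> s" using y s by auto
    qed
    then show ?case using Basis s
      by (intro exI[of _ n] exI[of _ "e - p n (x - z)"]) auto
  qed auto
qed

text \<open>With the converse \<open>limitin_X_I\<close>, limits in \<open>X\<close> can be computed
  in the ambient norm, one power of \<open>A\<close> at a time.\<close>

lemma limitin_X_D:
  assumes "limitin X f l F"
  shows "l \<in> E" "((\<lambda>x. (A ^^ m) (f x)) \<longlongrightarrow> (A ^^ m) l) F"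
proof -
  show l: "l \<in> E" using limitin_topspace[OF assms] topspace_X by simp
  show "((\<lambda>x. (A ^^ m) (f x)) \<longlongrightarrow> (A ^^ m) l) F"
  proof (rule tendstoI)
    fix e :: real assume "0 < e"
    have "\<forall>\<^sub>F x in F. f x \<in> {y \<in> E. p m (y - l) < e}"
      by (rule limitinD[OF assms openin_ball[OF l \<open>0 < e\<close>]]) (use l \<open>0 < e\<close> p_zero in auto)
    then show "\<forall>\<^sub>F x in F. dist ((A ^^ m) (f x)) ((A ^^ m) l) < e"
    proof eventually_elim
      case (elim x)
      then show ?case using norm_pow_le[of m m "f x - l"] l by (simp add: dist_norm pow_diff)
    qed
  qed
qed

lemma limitin_X_I:
  assumes "l \<in> E" "\<forall>\<^sub>F x in F. f x \<in> E" "\<And>m. ((\<lambda>x. (A ^^ m) (f x)) \<longlongrightarrow> (A ^^ m) l) F"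
  shows "limitin X f l F"
  unfolding limitin_def
proof (intro conjI allI impI)
  show "l \<in> topspace X" using assms(1) topspace_X by simp
  fix U assume U: "openin X U \<and> l \<in> U"
  then obtain n e where e: "0 < e" "{y \<in> E. p n (y - l) < e} \<subseteq> U"
    using openin_X_contains_ball[of U l] by blast
  have "((\<lambda>x. \<Sum>m=0..n. norm ((A ^^ m) (f x) - (A ^^ m) l)) \<longlongrightarrow>
      (\<Sum>m=0..n. norm ((A ^^ m) l - (A ^^ m) l))) F"
    by (intro tendsto_intros assms)
  then have "\<forall>\<^sub>F x in F. (\<Sum>m=0..n. norm ((A ^^ m) (f x) - (A ^^ m) l)) < e"
    using e(1) by (intro order_tendstoD(2)) auto
  with assms(2) show "\<forall>\<^sub>F x in F. f x \<in> U"
  proof eventually_elim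
    case (elim x)
    then have "p n (f x - l) < e"
      using assms(1) by (simp add: graph_seminorm_def pow_diff)
    then show ?case using e(2) elim(1) by blast
  qed
qed

text \<open>The derivatives of the coordinates are limits along a sequence of quotients in
  \<open>E\<close>, and \<open>graph_closed\<close> recognises them as the coordinates of a single
  vector.\<close>

lemma curve_derivative:
  assumes c: "\<And>t. c t \<in> E" "\<And>m. smth (\<lambda>t. (A ^^ m) (c t))"
  shows "hderiv 1 c t \<in> E" "(A ^^ m) (hderiv 1 c t) = hderiv 1 (\<lambda>t. (A ^^ m) (c t)) t"
    "limitin X (\<lambda>s. (c (t + s) - c t) /\<^sub>R s) (hderiv 1 c t) (at 0)"
proof -
  have q: "(A ^^ m) ((c (t + s) - c t) /\<^sub>R s) = ((A ^^ m) (c (t + s)) - (A ^^ m) (c t)) /\<^sub>R s" for m s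
    using c(1) by (simp add: pow_scale pow_diff mem_intros)
  have lim: "((\<lambda>s. (A ^^ m) ((c (t + s) - c t) /\<^sub>R s)) \<longlongrightarrow> hderiv 1 (\<lambda>t. (A ^^ m) (c t)) t) (at 0)" for m
    unfolding q by (rule has_vector_derivative_iff_quotient[THEN iffD1, OF smth_hderiv1(1)[OF c(2)]])
  have seq: "filterlim (\<lambda>n. 1 / real (Suc n)) (at 0) sequentially"
    unfolding filterlim_at using LIMSEQ_inverse_real_of_nat by (auto simp: divide_inverse)
  have *: "(\<lambda>n. (A ^^ m) ((c (t + 1 / real (Suc n)) - c t) /\<^sub>R (1 / real (Suc n))))
      \<longlonglongrightarrow> hderiv 1 (\<lambda>t. (A ^^ m) (c t)) t" for m
    by (rule filterlim_compose[OF lim seq])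
  have "hderiv 1 (\<lambda>t. (A ^^ 0) (c t)) t \<in> E \<and>
      (\<forall>m. (A ^^ m) (hderiv 1 (\<lambda>t. (A ^^ 0) (c t)) t) = hderiv 1 (\<lambda>t. (A ^^ m) (c t)) t)"
    by (rule graph_closed[OF _ *]) (intro mem_intros c)
  then show mem: "hderiv 1 c t \<in> E"
    and pow: "(A ^^ m) (hderiv 1 c t) = hderiv 1 (\<lambda>t. (A ^^ m) (c t)) t" for m by auto
  show "limitin X (\<lambda>s. (c (t + s) - c t) /\<^sub>R s) (hderiv 1 c t) (at 0)"
    by (rule limitin_X_I[OF mem]) (use lim pow c in \<open>auto intro!: mem_intros always_eventually\<close>)
qed

text \<open>Turns calculus in the Frechet space into calculus of \<open>smth\<close> curves in a
  normed space.\<close>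

lemma smooth_curve_X_iff:
  "smooth_curve X c \<longleftrightarrow> (\<forall>t. c t \<in> E) \<and> (\<forall>m. smth (\<lambda>t. (A ^^ m) (c t)))"
proof (intro iffI conjI allI)
  assume sc: "smooth_curve X c"
  then obtain C where C: "C 0 = c"
      "\<And>n t. limitin X (\<lambda>s. (C n (t + s) - C n t) /\<^sub>R s) (C (Suc n) t) (at 0)"
    unfolding smooth_curve_def by blast
  show c: "c t \<in> E" for t using sc unfolding smooth_curve_def topspace_X by blast
  have mem: "C n t \<in> E" for n t
    using C c limitin_X_D(1) by (cases n) blast+
  fix m
  have "((\<lambda>t. (A ^^ m) (C n t)) has_vector_derivative (A ^^ m) (C (Suc n) t)) (at t)" for n t
    using limitin_X_D(2)[OF C(2), of m n t] mem
    unfolding has_vector_derivative_iff_quotient by (simp add: pow_scale pow_diff mem_intros)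
  from smthI_seq(1)[of "\<lambda>n t. (A ^^ m) (C n t)", OF this]
  show "smth (\<lambda>t. (A ^^ m) (c t))" by (simp add: C)
next
  assume "(\<forall>t. c t \<in> E) \<and> (\<forall>m. smth (\<lambda>t. (A ^^ m) (c t)))"
  then have c: "\<And>t. c t \<in> E" "\<And>m. smth (\<lambda>t. (A ^^ m) (c t))" by auto
  have ind: "(\<forall>t. hderiv n c t \<in> E) \<and> (\<forall>m. smth (\<lambda>t. (A ^^ m) (hderiv n c t)))" for n
  proof (induction n)
    case (Suc n)
    have "hderiv (Suc n) c = hderiv 1 (hderiv n c)" by (simp add: hderiv.simps(2))
    moreover have n: "\<And>t. hderiv n c t \<in> E" "\<And>m. smth (\<lambda>t. (A ^^ m) (hderiv n c t))"
      using Suc by auto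
    moreover have "smth (\<lambda>t. (A ^^ m) (hderiv 1 (hderiv n c) t))" for m
      unfolding curve_derivative(2)[OF n] by (rule smth_hderiv1(2)[OF n(2)])
    ultimately show ?case using curve_derivative(1)[OF n] by simp
  qed (use c in auto)
  show "smooth_curve X c"
    unfolding smooth_curve_def
  proof (intro conjI exI[of _ "\<lambda>n. hderiv n c"] allI)
    show "range c \<subseteq> topspace X" using c topspace_X by auto
    fix n t
    have "hderiv (Suc n) c = hderiv 1 (hderiv n c)" by (simp add: hderiv.simps(2))
    then show "limitin X (\<lambda>s. (hderiv n c (t + s) - hderiv n c t) /\<^sub>R s) (hderiv (Suc n) c t) (at 0)"
      using curve_derivative(3)[of "hderiv n c"] ind[of n] by simp
  qed simp
qed

lemma smooth_map_X_I:
  assumes "\<And>h. h \<in> E \<Longrightarrow> f h \<in> E"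
    and "\<And>c m. (\<And>t. c t \<in> E) \<Longrightarrow> (\<And>m. smth (\<lambda>t. (A ^^ m) (c t))) \<Longrightarrow> smth (\<lambda>t. (A ^^ m) (f (c t)))"
  shows "smooth_map X X f"
  unfolding smooth_map_def smooth_curve_X_iff topspace_X using assms by (auto simp: o_def)

lemma smooth_map_X_D:
  assumes "smooth_map X X f"
  shows "h \<in> E \<Longrightarrow> f h \<in> E"
    and "(\<And>t. c t \<in> E) \<Longrightarrow> (\<And>m. smth (\<lambda>t. (A ^^ m) (c t))) \<Longrightarrow> smth (\<lambda>t. (A ^^ m) (f (c t)))"
  using assms unfolding smooth_map_def smooth_curve_X_iff topspace_X by (auto simp: o_def)

lemma smooth_map_add: "smooth_map X X f \<Longrightarrow> smooth_map X X g \<Longrightarrow> smooth_map X X (\<lambda>h. f h + g h)"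
  by (rule smooth_map_X_I) (auto simp: pow_add smooth_map_X_D intro!: mem_intros smth_add)

lemma smooth_map_scale: "smooth_map X X f \<Longrightarrow> smooth_map X X (\<lambda>h. r *\<^sub>R f h)"
  by (rule smooth_map_X_I) (auto simp: pow_scale smooth_map_X_D intro!: mem_intros smth_scale)

lemma smooth_map_diff: "smooth_map X X f \<Longrightarrow> smooth_map X X g \<Longrightarrow> smooth_map X X (\<lambda>h. f h - g h)"
  using smooth_map_add[OF _ smooth_map_scale[of g "-1"]] by fastforce

lemma smooth_map_sum:
  "(\<And>i. i \<in> I \<Longrightarrow> smooth_map X X (f i)) \<Longrightarrow> smooth_map X X (\<lambda>h. \<Sum>i\<in>I. f i h)"
proof (induction I rule: infinite_finite_induct)
  case empty
  show ?case by (rule smooth_map_X_I) (auto simp: pow_zero zero_mem)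
next
  case (infinite I)
  then show ?case by (simp, intro smooth_map_X_I) (auto simp: pow_zero zero_mem)
qed (auto intro: smooth_map_add)

lemma smooth_map_A: "smooth_map X X A"
proof (rule smooth_map_X_I)
  show "smth (\<lambda>t. (A ^^ m) (A (c t)))" if "\<And>t. c t \<in> E" "\<And>m. smth (\<lambda>t. (A ^^ m) (c t))" for c m
    using that(2)[of "Suc m"] by (simp only: funpow_Suc_right o_def)
qed (rule A_mem)

lemma line_smooth:
  assumes "x \<in> E" "v \<in> E"
  shows "x + s *\<^sub>R v \<in> E" "smth (\<lambda>s. (A ^^ m) (x + s *\<^sub>R v))"
proof -
  show "x + s *\<^sub>R v \<in> E" using assms by (intro mem_intros)
  have "(\<lambda>s. (A ^^ m) (x + s *\<^sub>R v)) = (\<lambda>s. (A ^^ m) x + s *\<^sub>R (A ^^ m) v)"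
    using assms by (simp add: pow_add pow_scale mem_intros)
  then show "smth (\<lambda>s. (A ^^ m) (x + s *\<^sub>R v))"
    using smth_scaleR[OF smth_ident smth_const[of "(A ^^ m) v"]] by (simp add: smth_add)
qed

lemma smth_along_line:
  assumes "smooth_map X X f" "x \<in> E" "v \<in> E"
  shows "smth (\<lambda>s. (A ^^ m) (f (x + s *\<^sub>R v)))"
  using smooth_map_X_D(2)[OF assms(1), of "\<lambda>s. x + s *\<^sub>R v" m] line_smooth[OF assms(2,3)] by simp

text \<open>Gives meaning to the definite description: the limit exists since \<open>f\<close> maps
  the line to a smooth curve, and it is unique since convergence in \<open>X\<close> implies
  convergence in norm.\<close>

lemma dir_deriv_eq:
  assumes f: "smooth_map X X f" and x: "x \<in> E" and v: "v \<in> E"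
  shows "dir_deriv X f x v = hderiv 1 (\<lambda>s. f (x + s *\<^sub>R v)) 0"
    "dir_deriv X f x v \<in> E"
    "(A ^^ m) (dir_deriv X f x v) = hderiv 1 (\<lambda>s. (A ^^ m) (f (x + s *\<^sub>R v))) 0"
proof -
  let ?c = "\<lambda>s. f (x + s *\<^sub>R v)"
  have c: "\<And>s. ?c s \<in> E" "\<And>m. smth (\<lambda>s. (A ^^ m) (?c s))"
    using smooth_map_X_D(1)[OF f] line_smooth(1)[OF x v] smth_along_line[OF f x v] by auto
  have "limitin X (\<lambda>s. (?c (0 + s) - ?c 0) /\<^sub>R s) (hderiv 1 ?c 0) (at 0)"
    by (rule curve_derivative(3)[OF c])
  then have lim: "limitin X (\<lambda>s. (f (x + s *\<^sub>R v) - f x) /\<^sub>R s) (hderiv 1 ?c 0) (at 0)" by simp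
  have "w = hderiv 1 ?c 0" if "limitin X (\<lambda>s. (f (x + s *\<^sub>R v) - f x) /\<^sub>R s) w (at 0)" for w
    using limitin_X_D(2)[OF that, of 0] limitin_X_D(2)[OF lim, of 0] tendsto_unique[of "at (0::real)"] by auto
  then show eq: "dir_deriv X f x v = hderiv 1 ?c 0"
    unfolding dir_deriv_def using lim by (intro the_equality)
  show "dir_deriv X f x v \<in> E" "(A ^^ m) (dir_deriv X f x v) = hderiv 1 (\<lambda>s. (A ^^ m) (f (x + s *\<^sub>R v))) 0"
    unfolding eq using curve_derivative(1,2)[OF c] by auto
qed

lemma has_vector_derivative_along_line:
  assumes f: "smooth_map X X f" and x: "x \<in> E" and v: "v \<in> E"
  shows "((\<lambda>s. f (x + s *\<^sub>R v)) has_vector_derivative dir_deriv X f (x + t *\<^sub>R v) v) (at t)"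
proof -
  have "smth (\<lambda>s. f ((x + t *\<^sub>R v) + s *\<^sub>R v))"
    using smth_along_line[OF f line_smooth(1)[OF x v] v, of 0] by simp
  then have "((\<lambda>s. f ((x + t *\<^sub>R v) + s *\<^sub>R v)) has_vector_derivative dir_deriv X f (x + t *\<^sub>R v) v) (at 0)"
    unfolding dir_deriv_eq(1)[OF f line_smooth(1)[OF x v] v] by (rule smth_hderiv1(1))
  then show ?thesis
    unfolding has_vector_derivative_iff_quotient by (simp add: scaleR_add_left add.assoc)
qed

text \<open>Substituting smooth functions for \<open>t\<close> and \<open>s\<close> yields another
  smooth curve in \<open>E\<close>. This brings maps between infinite-dimensional spaces within
  reach of the two-variable theorem.\<close>

lemma curvewise_smooth_perturbation:
  assumes f: "smooth_map X X f" and c: "\<And>t. c t \<in> E" "\<And>m. smth (\<lambda>t. (A ^^ m) (c t))"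
    and w: "\<And>t. w t \<in> E" "\<And>m. smth (\<lambda>t. (A ^^ m) (w t))"
  shows "curvewise_smooth (\<lambda>t s. (A ^^ m) (f (c t + s *\<^sub>R w t)))"
  unfolding curvewise_smooth_def
proof (intro allI impI)
  fix g1 g2 :: "real \<Rightarrow> real" assume g: "smth g1" "smth g2"
  show "smth (\<lambda>t. (A ^^ m) (f (c (g1 t) + g2 t *\<^sub>R w (g1 t))))"
  proof (rule smooth_map_X_D(2)[OF f])
    fix t show "c (g1 t) + g2 t *\<^sub>R w (g1 t) \<in> E" by (intro mem_intros c w)
  next
    fix m
    have "smth (\<lambda>t. (A ^^ m) (c (g1 t)) + g2 t *\<^sub>R (A ^^ m) (w (g1 t)))"
      by (intro smth_add smth_scaleR g smth_compose[OF c(2) g(1)] smth_compose[OF w(2) g(1)])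
    then show "smth (\<lambda>t. (A ^^ m) (c (g1 t) + g2 t *\<^sub>R w (g1 t)))"
      using c(1) w(1) by (simp add: pow_add pow_scale mem_intros)
  qed
qed

lemma smth_dir_deriv:
  assumes f: "smooth_map X X f" and c: "\<And>t. c t \<in> E" "\<And>m. smth (\<lambda>t. (A ^^ m) (c t))"
    and w: "\<And>t. w t \<in> E" "\<And>m. smth (\<lambda>t. (A ^^ m) (w t))"
  shows "smth (\<lambda>t. (A ^^ m) (dir_deriv X f (c t) (w t)))"
  using curvewise_smooth_partial_derivative[OF curvewise_smooth_perturbation[OF f c w]]
  by (simp add: dir_deriv_eq(3)[OF f c(1) w(1)])

lemma smooth_map_dir_deriv:
  assumes f: "smooth_map X X f" and w: "smooth_map X X w"
  shows "smooth_map X X (\<lambda>h. dir_deriv X f h (w h))"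
proof (rule smooth_map_X_I)
  show "dir_deriv X f h (w h) \<in> E" if "h \<in> E" for h
    using dir_deriv_eq(2)[OF f that] smooth_map_X_D(1)[OF w that] by blast
  show "smth (\<lambda>t. (A ^^ m) (dir_deriv X f (c t) (w (c t))))"
    if c: "\<And>t. c t \<in> E" "\<And>m. smth (\<lambda>t. (A ^^ m) (c t))" for c m
    by (rule smth_dir_deriv[OF f c smooth_map_X_D(1)[OF w c(1)] smooth_map_X_D(2)[OF w c]])
qed

lemma smooth_map_lie_bracket:
  "smooth_map X X V \<Longrightarrow> smooth_map X X W \<Longrightarrow> smooth_map X X (lie_bracket X V W)"
  unfolding lie_bracket_def by (intro smooth_map_diff smooth_map_dir_deriv)

lemma dir_deriv_scale:
  assumes f: "smooth_map X X f" and x: "x \<in> E" and v: "v \<in> E"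
  shows "dir_deriv X f x (r *\<^sub>R v) = r *\<^sub>R dir_deriv X f x v"
proof -
  have "smth (\<lambda>s. f (x + s *\<^sub>R v))" using smth_along_line[OF f x v, of 0] by simp
  from hderiv_affine[OF this, of 1 r 0 0] show ?thesis
    using dir_deriv_eq(1)[OF f x] v by (simp add: mem_intros mult.commute)
qed

text \<open>Continuity of \<open>t \<mapsto> Df(x + tv) w\<close> suffices for additivity.\<close>

lemma dir_deriv_add:
  assumes f: "smooth_map X X f" and x: "x \<in> E" and v: "v \<in> E" and w: "w \<in> E"
  shows "dir_deriv X f x (v + w) = dir_deriv X f x v + dir_deriv X f x w"
proof -
  define G where "G = (\<lambda>t s. f ((x + t *\<^sub>R v) + s *\<^sub>R w))"
  define D where "D = (\<lambda>t. dir_deriv X f (x + t *\<^sub>R v) w)"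
  have cw: "curvewise_smooth G"
    using curvewise_smooth_perturbation[OF f line_smooth[OF x v], of "\<lambda>_. w" 0] w by (simp add: G_def)
  note sec = curvewise_smooth_sections[OF cw]
  have D: "D t = hderiv 1 (G t) 0" for t
    unfolding D_def G_def by (rule dir_deriv_eq(1)[OF f line_smooth(1)[OF x v] w])
  have "smth D"
    unfolding D by (rule curvewise_smooth_partial_derivative[OF cw])
  then have "(D \<longlongrightarrow> D 0) (at 0)"
    using has_hderiv[of D 0 0] by (simp add: continuous_within[symmetric] has_vector_derivative_continuous)
  \<comment> \<open>The displacement along \<open>v + w\<close> is made first along
    \<open>v\<close>, then along \<open>w\<close>. The second leg differs from
    \<open>t *\<^sub>R D t\<close> by a term of order \<open>t^2\<close>, because the second
    derivatives in \<open>s\<close> are bounded.\<close>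
  moreover have "((\<lambda>t. (G t t - G t 0) /\<^sub>R t - D t) \<longlongrightarrow> 0) (at 0)"
  proof -
    obtain M where M: "\<And>t s. \<bar>t\<bar> \<le> 1 \<Longrightarrow> \<bar>s\<bar> \<le> 1 \<Longrightarrow> norm (hderiv 2 (\<lambda>s. G t s) s) \<le> M"
      using curvewise_smooth_bounded[OF curvewise_smooth_swap[OF cw], of 1 2] by blast
    have M0: "0 \<le> M" using M[of 0 0] by (simp add: order.trans[OF norm_ge_zero])
    have bd: "norm ((G t t - G t 0) /\<^sub>R t - D t) \<le> M * \<bar>t\<bar>" if t: "\<bar>t\<bar> < 1" "t \<noteq> 0" for t
    proof -
      have "norm ((G t t - t *\<^sub>R D t) - (G t 0 - 0 *\<^sub>R D t)) \<le> (M * \<bar>t\<bar>) * \<bar>t - 0\<bar>"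
      proof (rule norm_increment_bound[where f = "\<lambda>s. G t s - s *\<^sub>R D t" and f' = "\<lambda>s. hderiv 1 (G t) s - D t"])
        fix s assume "s \<in> {min 0 t..max 0 t}"
        then have s: "\<bar>s\<bar> \<le> \<bar>t\<bar>" by (auto simp: min_def max_def split: if_splits)
        have "((\<lambda>s. s *\<^sub>R D t) has_vector_derivative D t) (at s)"
          by (auto intro!: derivative_eq_intros)
        then show "((\<lambda>s. G t s - s *\<^sub>R D t) has_vector_derivative hderiv 1 (G t) s - D t) (at s)"
          by (intro has_vector_derivative_diff smth_hderiv1(1) sec)
        have "norm (hderiv 1 (G t) s - hderiv 1 (G t) 0) \<le> M * \<bar>s - 0\<bar>"
        proof (rule norm_increment_bound)
          fix y assume "y \<in> {min 0 s..max 0 s}"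
          then have "\<bar>y\<bar> \<le> 1" using s t by (auto simp: min_def max_def split: if_splits)
          then show "norm (hderiv 2 (G t) y) \<le> M" using M t by simp
          show "(hderiv 1 (G t) has_vector_derivative hderiv 2 (G t) y) (at y)"
            using has_hderiv[OF sec(2), of 1 t y] by (simp add: numeral_2_eq_2)
        qed
        also have "\<dots> \<le> M * \<bar>t\<bar>" using s M0 by (simp add: mult_left_mono)
        finally show "norm (hderiv 1 (G t) s - D t) \<le> M * \<bar>t\<bar>" by (simp add: D)
      qed
      then have "norm (G t t - G t 0 - t *\<^sub>R D t) / \<bar>t\<bar> \<le> M * \<bar>t\<bar>"
        using t by (simp add: pos_divide_le_eq algebra_simps)
      moreover have "(G t t - G t 0) /\<^sub>R t - D t = (G t t - G t 0 - t *\<^sub>R D t) /\<^sub>R t"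
        using t by (simp add: scaleR_diff_right)
      ultimately show ?thesis by (simp only: norm_scaleR abs_inverse divide_inverse mult.commute)
    qed
    have "((\<lambda>t. M * \<bar>t\<bar>) \<longlongrightarrow> M * \<bar>0\<bar>) (at 0)" by (intro tendsto_intros)
    then have "((\<lambda>t. M * \<bar>t\<bar>) \<longlongrightarrow> 0) (at 0)" by simp
    moreover have "\<forall>\<^sub>F t in at 0. norm ((G t t - G t 0) /\<^sub>R t - D t) \<le> M * \<bar>t\<bar>"
      unfolding eventually_at using bd by (intro exI[of _ 1]) auto
    ultimately show ?thesis by (rule Lim_null_comparison[rotated])
  qed
  ultimately have "((\<lambda>t. ((G t t - G t 0) /\<^sub>R t - D t) + D t) \<longlongrightarrow> 0 + D 0) (at 0)"
    by (intro tendsto_add)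
  then have 1: "((\<lambda>t. (G t t - G t 0) /\<^sub>R t) \<longlongrightarrow> D 0) (at 0)" by simp
  have 2: "((\<lambda>t. (f (x + t *\<^sub>R v) - f x) /\<^sub>R t) \<longlongrightarrow> dir_deriv X f x v) (at 0)"
    using has_vector_derivative_along_line[OF f x v, of 0] unfolding has_vector_derivative_iff_quotient by simp
  have "((\<lambda>t. (G t t - G t 0) /\<^sub>R t + (f (x + t *\<^sub>R v) - f x) /\<^sub>R t) \<longlongrightarrow> D 0 + dir_deriv X f x v) (at 0)"
    by (rule tendsto_add[OF 1 2])
  moreover have "(G t t - G t 0) /\<^sub>R t + (f (x + t *\<^sub>R v) - f x) /\<^sub>R t = (f (x + t *\<^sub>R (v + w)) - f x) /\<^sub>R t" for t
    by (simp add: G_def scaleR_add_right[symmetric] add.assoc)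
  moreover have "((\<lambda>t. (f (x + t *\<^sub>R (v + w)) - f x) /\<^sub>R t) \<longlongrightarrow> dir_deriv X f x (v + w)) (at 0)"
    using has_vector_derivative_along_line[OF f x add_mem[OF v w], of 0]
    unfolding has_vector_derivative_iff_quotient by simp
  ultimately show ?thesis
    using tendsto_unique[of "at (0::real)"] by (simp add: D_def add.commute)
qed

text \<open>Smoothness along curves is not defined through continuity. If continuity failed at
  \<open>x\<close>, some \<open>y n\<close> would tend to \<open>x\<close> rapidly with
  \<open>f (y n)\<close> staying away from \<open>f x\<close>; a special curve through them is
  smooth in every seminorm, and \<open>f\<close> along it is continuous at \<open>0\<close>.\<close>

lemma smooth_map_continuous:
  assumes f: "smooth_map X X f" and x: "x \<in> E" and "0 < e"
  shows "\<exists>n d. 0 < d \<and> (\<forall>y\<in>E. p n (y - x) < d \<longrightarrow> norm (f y - f x) < e)"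
proof (rule ccontr)
  assume "\<not> ?thesis"
  then have "\<forall>n. \<exists>y\<in>E. p n (y - x) < (1/2) ^ (n * n) \<and> norm (f y - f x) \<ge> e"
    by (meson not_le zero_less_divide_1_iff zero_less_numeral zero_less_power)
  then obtain y where y: "\<And>n. y n \<in> E" "\<And>n. p n (y n - x) < (1/2) ^ (n * n)" "\<And>n. norm (f (y n) - f x) \<ge> e"
    by metis
  obtain \<beta> :: "real \<Rightarrow> real" where \<beta>: "smth \<beta>" "\<And>x. \<bar>x\<bar> \<ge> 1 \<Longrightarrow> \<beta> x = 0"
      "\<And>x. \<bar>x\<bar> \<le> 1/2 \<Longrightarrow> \<beta> x = 1"
    using smooth_bump_exists by blast
  define c where "c = (\<lambda>t. x + special_curve \<beta> (\<lambda>n. y n - x) t)"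
  have sm: "special_curve \<beta> (\<lambda>n. y n - x) t \<in> E" for t
    unfolding special_curve_def using y(1) x by (auto intro!: mem_intros)
  have "(A ^^ m) (special_curve \<beta> (\<lambda>n. y n - x) t) = special_curve \<beta> (\<lambda>n. (A ^^ m) (y n - x)) t" for m t
    unfolding special_curve_def using y(1) x by (simp add: pow_zero pow_sum pow_scale mem_intros)
  then have eq: "(A ^^ m) (c t) = (A ^^ m) x + special_curve \<beta> (\<lambda>n. (A ^^ m) (y n - x)) t" for m t
    unfolding c_def using x sm by (simp add: pow_add)
  have "smth (special_curve \<beta> (\<lambda>n. (A ^^ m) (y n - x)))" for m
  proof (intro smth_special_curve \<beta> rapid_decay[of m])
    show "norm ((A ^^ m) (y n - x)) \<le> (1/2) ^ (n * n)" if "m \<le> n" for n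
      using norm_pow_le[OF that, of "y n - x"] y(2)[of n] by linarith
  qed
  then have "smth (\<lambda>t. (A ^^ m) (c t))" for m unfolding eq by (intro smth_add smth_const)
  moreover have "c t \<in> E" for t unfolding c_def using x sm by (intro mem_intros)
  ultimately have "smth (\<lambda>t. f (c t))" using smooth_map_X_D(2)[OF f, of c 0] by simp
  then have "isCont (\<lambda>t. f (c t)) 0"
    using smth_continuous[of "\<lambda>t. f (c t)" UNIV 0] by (simp add: continuous_on_eq_continuous_at)
  moreover have "(\<lambda>n. (1/2::real) ^ n) \<longlonglongrightarrow> 0" by (rule LIMSEQ_power_zero) simp
  ultimately have "(\<lambda>n. f (c ((1/2) ^ n))) \<longlonglongrightarrow> f (c 0)"
    by (rule isCont_tendsto_compose)
  moreover have "c ((1/2) ^ n) = y n" for n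
  proof -
    have "2 ^ (n + 2) * (1/2::real) ^ n = 4" by (simp add: power_add flip: power_mult_distrib)
    then show ?thesis
      using special_curve_eq[of \<beta> n "(1/2) ^ n" "\<lambda>n. y n - x"] \<beta>(2,3) by (simp add: c_def)
  qed
  moreover have "c 0 = x" by (simp add: c_def special_curve_def)
  ultimately have "(\<lambda>n. norm (f (y n) - f x)) \<longlonglongrightarrow> 0"
    using tendsto_norm_zero Lim_null[of "\<lambda>n. f (y n)" "f x" sequentially] by simp
  then have "\<forall>\<^sub>F n in sequentially. norm (f (y n) - f x) < e"
    using \<open>0 < e\<close> by (rule order_tendstoD(2))
  then show False using y(3) by (auto simp: eventually_sequentially not_less[symmetric])
qed

end

section \<open>Finite families in inner product spaces\<close>

text \<open>Gram-Schmidt: a new vector is first made orthogonal to the old span, after which one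
  coefficient can be corrected without disturbing the others.\<close>

lemma orthogonal_projection_exists:
  fixes B :: "'h::real_inner set"
  assumes "finite B"
  shows "\<exists>s\<in>span B. \<forall>b\<in>span B. (x - s) \<bullet> b = 0"
proof -
  have "\<exists>s\<in>span B. \<forall>b\<in>B. (x - s) \<bullet> b = 0"
    using assms
  proof (induction B arbitrary: x)
    case empty
    show ?case by (auto simp: span_zero)
  next
    case (insert b B)
    obtain t where t: "t \<in> span B" "\<forall>c\<in>B. (b - t) \<bullet> c = 0" using insert.IH[of b] by blast
    obtain s where s: "s \<in> span B" "\<forall>c\<in>B. (x - s) \<bullet> c = 0" using insert.IH[of x] by blast
    have sub: "span B \<subseteq> span (insert b B)" by (rule span_mono) auto
    have t0: "(x - s) \<bullet> t = 0" "(b - t) \<bullet> t = 0"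
      using orthogonal_to_span[OF t(1), of "x - s"] orthogonal_to_span[OF t(1), of "b - t"] s t
      by (auto simp: orthogonal_def)
    show ?case
    proof (cases "b - t = 0")
      case True
      then have "(x - s) \<bullet> b = 0" using t0 by simp
      then show ?thesis using s sub by (intro bexI[of _ s]) auto
    next
      case False
      define k where "k = ((x - s) \<bullet> (b - t)) / ((b - t) \<bullet> (b - t))"
      have k: "k * ((b - t) \<bullet> (b - t)) = (x - s) \<bullet> (b - t)" using False by (simp add: k_def)
      show ?thesis
      proof (intro bexI ballI)
        show "s + k *\<^sub>R (b - t) \<in> span (insert b B)"
        proof (intro span_add span_scale span_diff)
          show "b \<in> span (insert b B)" by (intro span_base) simp
        qed (use s t sub in blast)+
        fix c assume "c \<in> insert b B"
        then consider "c = b" | "c \<in> B" by blast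
        then show "(x - (s + k *\<^sub>R (b - t))) \<bullet> c = 0"
        proof cases
          case 1
          have "(x - (s + k *\<^sub>R (b - t))) \<bullet> ((b - t) + t) = 0"
            using t0 k by (simp only: diff_diff_eq[symmetric] inner_diff_left[of "x - s"] inner_scaleR_left inner_add_right)
          then show ?thesis using 1 by simp
        next
          case 2
          then show ?thesis
            using s t by (simp add: diff_diff_eq[symmetric] inner_diff_left[of "x - s"])
        qed
      qed
    qed
  qed
  then obtain s where s: "s \<in> span B" "\<forall>b\<in>B. (x - s) \<bullet> b = 0" by blast
  then have "(x - s) \<bullet> b = 0" if "b \<in> span B" for b
    using orthogonal_to_span[OF that, of "x - s"] by (auto simp: orthogonal_def)
  with s show ?thesis by blast
qed

lemma span_family:
  fixes v :: "'i \<Rightarrow> 'v::real_vector"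
  assumes "finite I"
  shows "span (v ` I) = range (\<lambda>c. \<Sum>i\<in>I. c i *\<^sub>R v i)"
proof
  have "subspace (range (\<lambda>c. \<Sum>i\<in>I. c i *\<^sub>R v i))"
    unfolding subspace_def
  proof (intro conjI allI ballI)
    show "0 \<in> range (\<lambda>c. \<Sum>i\<in>I. c i *\<^sub>R v i)"
      by (rule range_eqI[of _ _ "\<lambda>_. 0"]) simp
    fix x y :: 'v assume "x \<in> range (\<lambda>c. \<Sum>i\<in>I. c i *\<^sub>R v i)"
    then obtain a where a: "x = (\<Sum>i\<in>I. a i *\<^sub>R v i)" by blast
    show "r *\<^sub>R x \<in> range (\<lambda>c. \<Sum>i\<in>I. c i *\<^sub>R v i)" for r
      by (rule range_eqI[of _ _ "\<lambda>i. r * a i"]) (simp add: a scaleR_sum_right)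
    assume "y \<in> range (\<lambda>c. \<Sum>i\<in>I. c i *\<^sub>R v i)"
    then obtain b where b: "y = (\<Sum>i\<in>I. b i *\<^sub>R v i)" by blast
    show "x + y \<in> range (\<lambda>c. \<Sum>i\<in>I. c i *\<^sub>R v i)"
      by (rule range_eqI[of _ _ "\<lambda>i. a i + b i"]) (simp add: a b scaleR_add_left sum.distrib)
  qed
  moreover have "v i \<in> range (\<lambda>c. \<Sum>i\<in>I. c i *\<^sub>R v i)" if "i \<in> I" for i
    by (rule range_eqI[of _ _ "\<lambda>j. if j = i then 1 else 0"])
      (use that assms in \<open>simp add: if_distrib[of "\<lambda>r. r *\<^sub>R _"] cong: if_cong\<close>)
  ultimately show "span (v ` I) \<subseteq> range (\<lambda>c. \<Sum>i\<in>I. c i *\<^sub>R v i)"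
    by (intro span_minimal) auto
  show "range (\<lambda>c. \<Sum>i\<in>I. c i *\<^sub>R v i) \<subseteq> span (v ` I)"
    by (auto intro!: span_sum span_scale intro: span_base)
qed

text \<open>Indexed rather than a property of the set of vectors, because frame vectors move with a
  parameter while the coefficients stay attached to the indices.\<close>

definition family_independent :: "'i set \<Rightarrow> ('i \<Rightarrow> 'v::real_vector) \<Rightarrow> bool" where
  "family_independent I v \<longleftrightarrow> (\<forall>c. (\<Sum>i\<in>I. c i *\<^sub>R v i) = 0 \<longrightarrow> (\<forall>i\<in>I. c i = 0))"

lemma family_independentD: "family_independent I v \<Longrightarrow> (\<Sum>i\<in>I. c i *\<^sub>R v i) = 0 \<Longrightarrow> i \<in> I \<Longrightarrow> c i = 0"
  unfolding family_independent_def by blast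

lemma family_independent_iff:
  assumes "finite I"
  shows "family_independent I v \<longleftrightarrow> inj_on v I \<and> independent (v ` I)"
proof (intro iffI conjI)
  assume v: "family_independent I v"
  show inj: "inj_on v I"
  proof (rule inj_onI, rule ccontr)
    fix i j assume ij: "i \<in> I" "j \<in> I" "v i = v j" "i \<noteq> j"
    define c where "c = (\<lambda>k. if k = i then 1 else if k = j then -1 else (0::real))"
    have "(\<Sum>k\<in>I. c k *\<^sub>R v k) = (\<Sum>k\<in>{i, j}. c k *\<^sub>R v k)"
      using assms ij by (intro sum.mono_neutral_right) (auto simp: c_def)
    also have "\<dots> = 0" using ij by (simp add: c_def)
    finally show False using family_independentD[OF v, of c i] ij by (simp add: c_def)
  qed
  show "independent (v ` I)"
  proof (rule ccontr)
    assume "\<not> independent (v ` I)"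
    then obtain u where u: "\<exists>x\<in>v ` I. u x \<noteq> 0" "(\<Sum>x\<in>v ` I. u x *\<^sub>R x) = 0"
      using dependent_finite[of "v ` I"] assms by auto
    then have "(\<Sum>i\<in>I. u (v i) *\<^sub>R v i) = 0" by (simp add: sum.reindex[OF inj])
    then show False using u(1) family_independentD[OF v, of "\<lambda>i. u (v i)"] by auto
  qed
next
  assume v: "inj_on v I \<and> independent (v ` I)"
  show "family_independent I v"
    unfolding family_independent_def
  proof (intro allI impI ballI)
    fix c i assume c: "(\<Sum>i\<in>I. c i *\<^sub>R v i) = 0" "i \<in> I"
    have "(\<Sum>x\<in>v ` I. c (inv_into I v x) *\<^sub>R x) = (\<Sum>i\<in>I. c i *\<^sub>R v i)"
      using v by (subst sum.reindex) auto
    then have "c (inv_into I v (v i)) = 0"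
      using independentD[of "v ` I" "v ` I" "\<lambda>x. c (inv_into I v x)" "v i"] c v assms by simp
    then show "c i = 0" using v c by simp
  qed
qed

text \<open>The coefficients are controlled by a dual family of the unperturbed vectors.\<close>

lemma family_independent_perturbation:
  fixes v :: "'i \<Rightarrow> 'h::real_inner"
  assumes I: "finite I" and v: "family_independent I v"
  shows "\<exists>\<delta>>0. \<exists>K. \<forall>v'. (\<forall>i\<in>I. norm (v' i - v i) < \<delta>) \<longrightarrow>
    (\<forall>c. (\<Sum>i\<in>I. \<bar>c i\<bar>) \<le> K * norm (\<Sum>i\<in>I. c i *\<^sub>R v' i))"
proof -
  have "\<exists>e. e \<bullet> v i = 1 \<and> (\<forall>j\<in>I - {i}. e \<bullet> v j = 0)" if i: "i \<in> I" for i
  proof -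
    obtain s where s: "s \<in> span (v ` (I - {i}))" "\<forall>b\<in>span (v ` (I - {i})). (v i - s) \<bullet> b = 0"
      using orthogonal_projection_exists[of "v ` (I - {i})" "v i"] I by auto
    obtain c where c: "s = (\<Sum>j\<in>I - {i}. c j *\<^sub>R v j)"
      using s(1) I by (auto simp: span_family)
    have "v i \<noteq> s"
    proof
      assume "v i = s"
      define c' where "c' = (\<lambda>j. if j = i then -1 else c j)"
      have "(\<Sum>j\<in>I. c' j *\<^sub>R v j) = - v i + (\<Sum>j\<in>I - {i}. c' j *\<^sub>R v j)"
        using I i by (simp add: sum.remove[of I i] c'_def)
      also have "(\<Sum>j\<in>I - {i}. c' j *\<^sub>R v j) = s"
        unfolding c by (intro sum.cong) (auto simp: c'_def)
      finally have "(\<Sum>j\<in>I. c' j *\<^sub>R v j) = 0" using \<open>v i = s\<close> by simp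
      from family_independentD[OF v this i] show False by (simp add: c'_def)
    qed
    define x where "x = v i - s"
    have "x \<bullet> x \<noteq> 0" using \<open>v i \<noteq> s\<close> by (simp add: x_def)
    moreover have "x \<bullet> v i = x \<bullet> x"
    proof -
      have "x \<bullet> s = 0" using s unfolding x_def by blast
      then show ?thesis by (simp add: x_def inner_diff_right)
    qed
    moreover have "x \<bullet> v j = 0" if "j \<in> I - {i}" for j
      using s(2) that unfolding x_def by (auto intro: span_base)
    ultimately show ?thesis by (intro exI[of _ "x /\<^sub>R (x \<bullet> x)"]) auto
  qed
  then obtain e where e: "\<And>i. i \<in> I \<Longrightarrow> e i \<bullet> v i = 1" "\<And>i j. i \<in> I \<Longrightarrow> j \<in> I - {i} \<Longrightarrow> e i \<bullet> v j = 0"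
    by metis
  define N where "N = (\<Sum>i\<in>I. norm (e i))"
  have N: "0 \<le> N" unfolding N_def by (intro sum_nonneg) auto
  \<comment> \<open>Chosen so that the perturbation contributes at most half of \<open>S\<close>,
    which is absorbed on the left; this gives the constant \<open>2 * N\<close>.\<close>
  define \<delta> where "\<delta> = 1 / (2 * (N + 1))"
  have \<delta>: "0 < \<delta>" "N * \<delta> \<le> 1/2" using N by (auto simp: \<delta>_def field_simps)
  have "(\<Sum>i\<in>I. \<bar>c i\<bar>) \<le> (2 * N) * norm (\<Sum>i\<in>I. c i *\<^sub>R v' i)"
    if v': "\<forall>i\<in>I. norm (v' i - v i) < \<delta>" for v' and c :: "'i \<Rightarrow> real"
  proof -
    define x where "x = (\<Sum>i\<in>I. c i *\<^sub>R v' i)"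
    define S where "S = (\<Sum>i\<in>I. \<bar>c i\<bar>)"
    have S: "0 \<le> S" unfolding S_def by (intro sum_nonneg) auto
    have "\<bar>c i\<bar> \<le> norm (e i) * (norm x + \<delta> * S)" if i: "i \<in> I" for i
    proof -
      have "x = (\<Sum>j\<in>I. c j *\<^sub>R v j) + (\<Sum>j\<in>I. c j *\<^sub>R (v' j - v j))"
        unfolding x_def by (simp add: sum.distrib[symmetric] scaleR_diff_right)
      then have "e i \<bullet> (\<Sum>j\<in>I. c j *\<^sub>R v j) = e i \<bullet> (x - (\<Sum>j\<in>I. c j *\<^sub>R (v' j - v j)))" by simp
      moreover have "e i \<bullet> (\<Sum>j\<in>I. c j *\<^sub>R v j) = c i"
        using I i e by (simp add: inner_sum_right inner_add_right sum.remove[of I i])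
      ultimately have "\<bar>c i\<bar> \<le> norm (e i) * norm (x - (\<Sum>j\<in>I. c j *\<^sub>R (v' j - v j)))"
        using Cauchy_Schwarz_ineq2 by metis
      also have "\<dots> \<le> norm (e i) * (norm x + \<delta> * S)"
      proof (rule mult_left_mono)
        have "norm (\<Sum>j\<in>I. c j *\<^sub>R (v' j - v j)) \<le> (\<Sum>j\<in>I. \<bar>c j\<bar> * \<delta>)"
          using v' by (intro sum_norm_le) (simp add: less_imp_le mult_left_mono)
        then show "norm (x - (\<Sum>j\<in>I. c j *\<^sub>R (v' j - v j))) \<le> norm x + \<delta> * S"
          unfolding S_def
          by (intro order.trans[OF norm_triangle_ineq4] add_left_mono) (simp add: sum_distrib_left mult.commute)
      qed auto
      finally show ?thesis .
    qed
    then have "(\<Sum>i\<in>I. \<bar>c i\<bar>) \<le> (\<Sum>i\<in>I. norm (e i) * (norm x + \<delta> * S))" by (rule sum_mono)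
    also have "\<dots> = N * norm x + N * \<delta> * S" by (simp add: N_def sum_distrib_right distrib_left mult.assoc sum.distrib)
    also have "\<dots> \<le> N * norm x + 1/2 * S" using mult_right_mono[OF \<delta>(2) S] by simp
    finally have "S \<le> N * norm x + 1/2 * S" by (simp only: S_def)
    then show ?thesis unfolding S_def[symmetric] x_def[symmetric] by simp
  qed
  then show ?thesis using \<delta>(1) by blast
qed

lemma family_independent_of_bound:
  fixes v :: "'i \<Rightarrow> 'h::real_normed_vector"
  assumes "finite I" "\<And>c. (\<Sum>i\<in>I. \<bar>c i\<bar>) \<le> K * norm (\<Sum>i\<in>I. c i *\<^sub>R v i)"
  shows "family_independent I v"
  unfolding family_independent_def
proof (intro allI impI ballI)
  fix c i assume c: "(\<Sum>i\<in>I. c i *\<^sub>R v i) = 0" and i: "i \<in> I"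
  have "\<bar>c i\<bar> \<le> (\<Sum>i\<in>I. \<bar>c i\<bar>)" using assms(1) i by (intro member_le_sum) auto
  also have "\<dots> \<le> 0" using assms(2)[of c] c by simp
  finally show "c i = 0" by simp
qed

text \<open>The bound \<open>K\<close> keeps the coefficients of \<open>x t\<close> from blowing up.
  Hence a vector orthogonal to all limits \<open>v i\<close> has inner products with
  \<open>x t\<close> tending to zero; this is applied to the part of \<open>x0\<close> orthogonal to
  the limit span.\<close>

lemma span_limit:
  fixes V :: "'t \<Rightarrow> 'i \<Rightarrow> 'h::real_inner"
  assumes I: "finite I" and F: "F \<noteq> bot"
    and V: "\<And>i. i \<in> I \<Longrightarrow> ((\<lambda>t. V t i) \<longlongrightarrow> v i) F" and x: "(x \<longlongrightarrow> x0) F"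
    and span: "\<forall>\<^sub>F t in F. x t \<in> span (V t ` I)"
    and K: "\<forall>\<^sub>F t in F. \<forall>c. (\<Sum>i\<in>I. \<bar>c i\<bar>) \<le> K * norm (\<Sum>i\<in>I. c i *\<^sub>R V t i)"
  shows "x0 \<in> span (v ` I)"
proof -
  obtain s where s: "s \<in> span (v ` I)" "\<forall>b\<in>span (v ` I). (x0 - s) \<bullet> b = 0"
    using orthogonal_projection_exists[of "v ` I" x0] I by auto
  define y where "y = x0 - s"
  have yv: "y \<bullet> v i = 0" if "i \<in> I" for i using s(2) that unfolding y_def by (auto intro: span_base)
  have "\<forall>\<^sub>F t in F. norm (y \<bullet> x t) \<le> K * norm (x t) * (\<Sum>i\<in>I. \<bar>y \<bullet> V t i\<bar>)"
    using span K
  proof eventually_elim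
    case (elim t)
    then obtain c where c: "x t = (\<Sum>i\<in>I. c i *\<^sub>R V t i)" by (auto simp: span_family[OF I])
    have "\<bar>y \<bullet> x t\<bar> \<le> (\<Sum>i\<in>I. \<bar>c i\<bar> * \<bar>y \<bullet> V t i\<bar>)"
      unfolding c inner_sum_right inner_scaleR_right abs_mult[symmetric] by (rule sum_abs)
    also have "\<dots> \<le> (\<Sum>i\<in>I. \<bar>c i\<bar> * (\<Sum>i\<in>I. \<bar>y \<bullet> V t i\<bar>))"
      using I by (intro sum_mono mult_left_mono member_le_sum) auto
    also have "\<dots> = (\<Sum>i\<in>I. \<bar>c i\<bar>) * (\<Sum>i\<in>I. \<bar>y \<bullet> V t i\<bar>)" by (simp add: sum_distrib_right)
    also have "\<dots> \<le> K * norm (x t) * (\<Sum>i\<in>I. \<bar>y \<bullet> V t i\<bar>)"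
      using elim(2) unfolding c by (intro mult_right_mono sum_nonneg) auto
    finally show ?case by simp
  qed
  moreover have "((\<lambda>t. K * norm (x t) * (\<Sum>i\<in>I. \<bar>y \<bullet> V t i\<bar>)) \<longlongrightarrow> K * norm x0 * (\<Sum>i\<in>I. \<bar>y \<bullet> v i\<bar>)) F"
    by (intro tendsto_intros x V)
  ultimately have "((\<lambda>t. y \<bullet> x t) \<longlongrightarrow> 0) F"
    using yv by (simp add: Lim_null_comparison)
  moreover have "((\<lambda>t. y \<bullet> x t) \<longlongrightarrow> y \<bullet> x0) F" by (intro tendsto_intros x)
  ultimately have "0 = y \<bullet> x0" by (rule tendsto_unique[OF F])
  moreover have "y \<bullet> s = 0" using s unfolding y_def by blast
  ultimately have "y \<bullet> y = 0" by (simp add: y_def inner_diff_right)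
  then show ?thesis using s(1) by (simp add: y_def)
qed

text \<open>A Gronwall argument for the squared length of the components orthogonal to the initial span.\<close>

lemma span_preserved_by_flow:
  fixes V :: "real \<Rightarrow> 'i \<Rightarrow> 'h::real_inner"
  assumes I: "finite I" and i: "i \<in> I"
    and dV: "\<And>t j. t \<in> {0..1} \<Longrightarrow> j \<in> I \<Longrightarrow> ((\<lambda>t. V t j) has_vector_derivative V' t j) (at t)"
    and V': "\<And>t j. t \<in> {0..1} \<Longrightarrow> j \<in> I \<Longrightarrow> V' t j \<in> span (V t ` I)"
    and M: "\<And>t j. t \<in> {0..1} \<Longrightarrow> j \<in> I \<Longrightarrow> norm (V' t j) \<le> M"
    and K: "\<And>t c. t \<in> {0..1} \<Longrightarrow> (\<Sum>i\<in>I. \<bar>c i\<bar>) \<le> K * norm (\<Sum>i\<in>I. c i *\<^sub>R V t i)" and K0: "0 \<le> K"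
  shows "V 1 i \<in> span (V 0 ` I)"
proof -
  obtain s where s: "s \<in> span (V 0 ` I)" "\<forall>b\<in>span (V 0 ` I). (V 1 i - s) \<bullet> b = 0"
    using orthogonal_projection_exists[of "V 0 ` I" "V 1 i"] I by auto
  define y where "y = V 1 i - s"
  define F where "F = (\<lambda>t. \<Sum>j\<in>I. (y \<bullet> V t j) * (y \<bullet> V t j))"
  define F' where "F' = (\<lambda>t. \<Sum>j\<in>I. 2 * ((y \<bullet> V t j) * (y \<bullet> V' t j)))"
  define L where "L = (\<Sum>j\<in>I. 2 * (K * M))"
  \<comment> \<open>Expanding \<open>V' t j\<close> in the frame turns \<open>F'\<close> into mixed
    products; bounding each by \<open>F\<close> closes the differential inequality.\<close>
  have prod: "\<bar>y \<bullet> V t j\<bar> * \<bar>y \<bullet> V t k\<bar> \<le> F t" if "j \<in> I" "k \<in> I" for t j k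
  proof -
    have "(y \<bullet> V t j) * (y \<bullet> V t j) \<le> F t" "(y \<bullet> V t k) * (y \<bullet> V t k) \<le> F t"
      unfolding F_def using that I
      by (intro member_le_sum[where f = "\<lambda>j. (y \<bullet> V t j) * (y \<bullet> V t j)"]; auto)+
    moreover have "0 \<le> (\<bar>y \<bullet> V t j\<bar> - \<bar>y \<bullet> V t k\<bar>)\<^sup>2" by simp
    then have "2 * (\<bar>y \<bullet> V t j\<bar> * \<bar>y \<bullet> V t k\<bar>) \<le> (y \<bullet> V t j) * (y \<bullet> V t j) + (y \<bullet> V t k) * (y \<bullet> V t k)"
      by (simp add: power2_eq_square algebra_simps)
    ultimately show ?thesis by linarith
  qed
  have F'F: "F' t \<le> L * F t" if t: "t \<in> {0..1}" for t
  proof -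
    have "2 * ((y \<bullet> V t j) * (y \<bullet> V' t j)) \<le> 2 * (K * M) * F t" if j: "j \<in> I" for j
    proof -
      obtain c where c: "V' t j = (\<Sum>k\<in>I. c k *\<^sub>R V t k)"
        using V'[OF t j] by (auto simp: span_family[OF I])
      have F0: "0 \<le> F t" unfolding F_def by (intro sum_nonneg) auto
      have "(y \<bullet> V t j) * (y \<bullet> V' t j) = (\<Sum>k\<in>I. c k * ((y \<bullet> V t j) * (y \<bullet> V t k)))"
        unfolding c inner_sum_right inner_scaleR_right sum_distrib_left by (simp only: mult.left_commute)
      also have "\<dots> \<le> (\<Sum>k\<in>I. \<bar>c k\<bar> * F t)"
      proof (rule sum_mono)
        fix k assume k: "k \<in> I"
        have "c k * ((y \<bullet> V t j) * (y \<bullet> V t k)) \<le> \<bar>c k\<bar> * (\<bar>y \<bullet> V t j\<bar> * \<bar>y \<bullet> V t k\<bar>)"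
          unfolding abs_mult[symmetric] by (rule abs_ge_self)
        also have "\<dots> \<le> \<bar>c k\<bar> * F t" by (intro mult_left_mono prod j k) auto
        finally show "c k * ((y \<bullet> V t j) * (y \<bullet> V t k)) \<le> \<bar>c k\<bar> * F t" .
      qed
      also have "\<dots> = (\<Sum>k\<in>I. \<bar>c k\<bar>) * F t" by (simp add: sum_distrib_right)
      also have "\<dots> \<le> (K * M) * F t"
      proof (rule mult_right_mono[OF _ F0])
        have "(\<Sum>k\<in>I. \<bar>c k\<bar>) \<le> K * norm (V' t j)" unfolding c by (rule K[OF t])
        also have "\<dots> \<le> K * M" by (intro mult_left_mono M t j K0)
        finally show "(\<Sum>k\<in>I. \<bar>c k\<bar>) \<le> K * M" .
      qed
      finally show ?thesis by simp
    qed
    then show ?thesis unfolding F'_def L_def sum_distrib_right by (rule sum_mono)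
  qed
  have dF: "(F has_real_derivative F' t) (at t)" if t: "t \<in> {0..1}" for t
  proof -
    have d: "((\<lambda>t. y \<bullet> V t j) has_real_derivative y \<bullet> V' t j) (at t)" if "j \<in> I" for j
      using bounded_linear.has_vector_derivative[OF bounded_linear_inner_right dV[OF t that]]
      by (simp add: has_real_derivative_iff_has_vector_derivative)
    show ?thesis unfolding F_def F'_def
      by (rule DERIV_sum) (auto intro!: derivative_eq_intros d)
  qed
  have "F 1 * exp (- L * 1) \<le> F 0 * exp (- L * 0)"
  proof (rule DERIV_nonpos_imp_nonincreasing[of 0 1 "\<lambda>t. F t * exp (- L * t)"])
    fix t :: real assume t: "0 \<le> t" "t \<le> 1"
    have "((\<lambda>t. F t * exp (- L * t)) has_real_derivative (F' t - L * F t) * exp (- L * t)) (at t)"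
      using t by (auto intro!: derivative_eq_intros dF simp: algebra_simps)
    moreover have "(F' t - L * F t) * exp (- L * t) \<le> 0"
      using F'F[of t] t by (intro mult_nonpos_nonneg) auto
    ultimately show "\<exists>y. ((\<lambda>t. F t * exp (- L * t)) has_real_derivative y) (at t) \<and> y \<le> 0" by blast
  qed simp
  moreover have "F 0 = 0"
  proof -
    have "y \<bullet> V 0 j = 0" if "j \<in> I" for j using s(2) that unfolding y_def by (auto intro: span_base)
    then show ?thesis by (simp add: F_def)
  qed
  ultimately have "F 1 \<le> 0" by (simp add: mult_le_0_iff)
  then have "\<bar>y \<bullet> V 1 i\<bar> * \<bar>y \<bullet> V 1 i\<bar> \<le> 0" using prod[OF i i, of 1] by linarith
  then have "y \<bullet> V 1 i = 0" by (auto simp: mult_le_0_iff)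
  moreover have "y \<bullet> s = 0" using s unfolding y_def by blast
  ultimately have "y \<bullet> y = 0" by (simp add: y_def inner_diff_right)
  then show ?thesis using s(1) by (simp add: y_def)
qed

lemma span_eq_of_card:
  fixes B T :: "'v::real_vector set"
  assumes "finite T" "independent B" "B \<subseteq> span T" "card T \<le> card B"
  shows "span B = span T"
proof
  show "span B \<subseteq> span T" using assms(3) by (simp add: span_minimal)
  show "span T \<subseteq> span B"
  proof (rule subsetI, rule ccontr)
    fix x assume x: "x \<in> span T" "x \<notin> span B"
    have "independent (insert x B)" using assms(2) x(2) by (rule independent_insertI[rotated])
    then have "finite (insert x B) \<and> card (insert x B) \<le> card T"
      using assms x by (intro independent_span_bound) auto
    moreover have "x \<notin> B" using x(2) span_base by blast
    ultimately show False using assms(4) by auto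
  qed
qed

lemma finite_dim_subset_basis:
  fixes S :: "'v::real_vector set"
  assumes "finite b" "S \<subseteq> span b"
  obtains B where "B \<subseteq> S" "independent B" "finite B" "span B = span S" "card B = dim S"
proof -
  obtain B where B: "B \<subseteq> S" "independent B" "S \<subseteq> span B" using maximal_independent_subset by blast
  have "finite B" using independent_span_bound[OF assms(1) B(2)] B(1) assms(2) by blast
  moreover have "span B = span S" using B by (metis span_eq span_superset subset_trans)
  moreover have "card B = dim S" using B \<open>span B = span S\<close> dim_eq_card by metis
  ultimately show ?thesis using that B by blast
qed

section \<open>The shift semigroup and its generator\<close>

text \<open>The set of operators may vary with \<open>n\<close>: for the semigroup, boundedness of
  an orbit is first known only on a time interval that depends on \<open>h\<close>, so intervals
  shrinking with \<open>n\<close> are used.\<close>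

lemma uniform_boundedness:
  fixes \<T> :: "nat \<Rightarrow> ('h::{real_normed_vector, complete_space} \<Rightarrow> 'b::real_normed_vector) set"
  assumes lin: "\<And>n T. T \<in> \<T> n \<Longrightarrow> bounded_linear T"
    and bd: "\<And>h. \<exists>n. \<forall>T\<in>\<T> n. norm (T h) \<le> real n"
  shows "\<exists>n C. \<forall>T\<in>\<T> n. \<forall>h. norm (T h) \<le> C * norm h"
proof -
  define F where "F = (\<lambda>n. {h. \<forall>T\<in>\<T> n. norm (T h) \<le> real n})"
  have cl: "closed (F n)" for n
  proof -
    have "F n = (\<Inter>T\<in>\<T> n. {h. norm (T h) \<le> real n})" by (auto simp: F_def)
    moreover have "closed {h. norm (T h) \<le> real n}" if "T \<in> \<T> n" for T
      by (rule closed_Collect_le[OF continuous_on_norm[OF linear_continuous_on[OF lin[OF that]]] continuous_on_const])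
    ultimately show ?thesis by auto
  qed
  have "\<exists>n. interior (F n) \<noteq> {}"
  proof (rule ccontr)
    assume "\<nexists>n. interior (F n) \<noteq> {}"
    then have "euclidean interior_of \<Union>(range F) = {}"
      using cl by (intro Baire_category_alt) (auto simp: completely_metrizable_space_euclidean)
    moreover have "\<Union>(range F) = UNIV" using bd by (auto simp: F_def)
    ultimately show False by simp
  qed
  then obtain n x r where r: "0 < r" "ball x r \<subseteq> F n" by (metis equals0I mem_interior)
  have "norm (T h) \<le> (4 * real n / r) * norm h" if T: "T \<in> \<T> n" for T h
  proof (cases "h = 0")
    case True
    then show ?thesis using linear_0[OF bounded_linear.linear[OF lin[OF T]]] by simp
  next
    case False
    define y where "y = x + (r / (2 * norm h)) *\<^sub>R h"
    have "dist x y = r / 2" using False r by (simp add: y_def dist_norm)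
    then have "y \<in> F n" "x \<in> F n" using r by auto
    then have "norm (T y) \<le> n" "norm (T x) \<le> n" using T by (auto simp: F_def)
    moreover have "T y - T x = (r / (2 * norm h)) *\<^sub>R T h"
      using lin[OF T] by (simp add: y_def linear_simps)
    then have "norm (T y - T x) = r / (2 * norm h) * norm (T h)"
      using r by simp
    ultimately have "r / (2 * norm h) * norm (T h) \<le> 2 * n"
      using norm_triangle_ineq4[of "T y" "T x"] by linarith
    then show ?thesis using r False by (simp add: field_simps)
  qed
  then show ?thesis by blast
qed

text \<open>The library proves integrability of continuous functions for the class \<open>banach\<close> only, to which
  the type of a complete inner product space need not belong. The isometric embedding into the dual
  space, which is of class \<open>banach\<close>, supplies the integral; its value lies in the closed image of
  the embedding because Riemann sums do.\<close>

lemma integrable_continuous_hilbert: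
  fixes f :: "real \<Rightarrow> 'h::{real_inner, complete_space}"
  assumes f: "continuous_on {a..b} f"
  shows "f integrable_on {a..b}"
proof -
  let ?J = "blinfun_inner_left :: 'h \<Rightarrow> 'h \<Rightarrow>\<^sub>L real"
  have lin: "bounded_linear ?J" by (rule bounded_linear_blinfun_inner_left)
  have nJ: "norm (?J x) = norm x" for x
  proof (rule antisym)
    show "norm (?J x) \<le> norm x"
      by (rule norm_blinfun_bound) (use Cauchy_Schwarz_ineq2[of _ x] in \<open>auto simp: mult.commute\<close>)
    show "norm x \<le> norm (?J x)"
    proof (cases "x = 0")
      case False
      have "norm (?J x x) \<le> norm (?J x) * norm x" by (rule norm_blinfun)
      then have "norm x * norm x \<le> norm (?J x) * norm x"
        by (simp add: power2_norm_eq_inner[symmetric] power2_eq_square)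
      then show ?thesis using False by simp
    qed simp
  qed
  have "complete (range ?J)"
    by (rule complete_isometric_image[of 1]) (use lin nJ complete_UNIV in auto)
  then have clR: "closed (range ?J)" by (rule complete_imp_closed)
  have "continuous_on {a..b} (\<lambda>t. ?J (f t))"
    by (rule bounded_linear.continuous_on[OF lin f])
  then obtain Y where Y: "((\<lambda>t. ?J (f t)) has_integral Y) {a..b}"
    using integrable_continuous_real integrable_on_def by blast
  have sums: "(\<Sum>(x, k)\<in>\<D>. measure lborel k *\<^sub>R ?J (f x)) = ?J (\<Sum>(x, k)\<in>\<D>. measure lborel k *\<^sub>R f x)" for \<D>
    unfolding linear_sum[OF bounded_linear.linear[OF lin]]
    by (intro sum.cong) (auto simp: linear_scale[OF bounded_linear.linear[OF lin]])
  have "Y \<in> closure (range ?J)"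
    unfolding closure_approachable
  proof (intro allI impI)
    fix e :: real assume "0 < e"
    from Y[unfolded box_real[symmetric] has_integral, rule_format, OF this]
    obtain \<gamma> where *: "gauge \<gamma> \<and> (\<forall>\<D>. \<D> tagged_division_of (cbox a b) \<and> \<gamma> fine \<D> \<longrightarrow>
        norm ((\<Sum>(x, k)\<in>\<D>. measure lborel k *\<^sub>R ?J (f x)) - Y) < e)" ..
    note \<gamma> = conjunct1[OF *] conjunct2[OF *]
    obtain \<D> where "\<D> tagged_division_of (cbox a b)" "\<gamma> fine \<D>" using fine_division_exists[OF \<gamma>(1)] .
    with \<gamma>(2) have "norm ((\<Sum>(x, k)\<in>\<D>. measure lborel k *\<^sub>R ?J (f x)) - Y) < e" by blast
    then show "\<exists>y\<in>range ?J. dist y Y < e" unfolding sums dist_norm by blast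
  qed
  then obtain y where y: "Y = ?J y" using clR by (auto simp: closure_closed)
  have "(f has_integral y) {a..b}"
    unfolding box_real[symmetric] has_integral
  proof (intro allI impI)
    fix e :: real assume "0 < e"
    from Y[unfolded box_real[symmetric] has_integral, rule_format, OF this]
    obtain \<gamma> where *: "gauge \<gamma> \<and> (\<forall>\<D>. \<D> tagged_division_of (cbox a b) \<and> \<gamma> fine \<D> \<longrightarrow>
        norm ((\<Sum>(x, k)\<in>\<D>. measure lborel k *\<^sub>R ?J (f x)) - Y) < e)" ..
    note \<gamma> = conjunct1[OF *] conjunct2[OF *]
    have eq: "norm ((\<Sum>(x, k)\<in>\<D>. measure lborel k *\<^sub>R f x) - y) = norm ((\<Sum>(x, k)\<in>\<D>. measure lborel k *\<^sub>R ?J (f x)) - Y)" for \<D>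
      unfolding sums y linear_diff[OF bounded_linear.linear[OF lin], symmetric] nJ ..
    show "\<exists>\<gamma>. gauge \<gamma> \<and> (\<forall>\<D>. \<D> tagged_division_of cbox a b \<and> \<gamma> fine \<D> \<longrightarrow>
        norm ((\<Sum>(x, k)\<in>\<D>. measure lborel k *\<^sub>R f x) - y) < e)"
      unfolding eq by (rule exI, rule conjI[OF \<gamma>])
  qed
  then show ?thesis by blast
qed

lemma at_within_atLeast_nontrivial: "(x::real) \<ge> 0 \<Longrightarrow> at x within {0..} \<noteq> bot"
proof
  assume "x \<ge> 0" "at x within {0..} = bot"
  have "at_right x \<le> at x within {0..}" using \<open>x \<ge> 0\<close> by (intro at_le) auto
  then have "at_right x \<le> bot" using \<open>at x within {0..} = bot\<close> by simp
  then show False using trivial_limit_at_right_real[of x] by (simp add: bot_unique)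
qed

lemma at_within_Icc_atLeast: "x < b \<Longrightarrow> at x within {0..b} = at (x::real) within {0..}"
  by (rule at_within_nhd[of x "{..<b}"]) auto

context forward_curve_space
begin

section \<open>The generator as pointwise differentiation\<close>

abbreviation "A \<equiv> opA ev"
abbreviation "E \<equiv> dom_infty UNIV (domA ev) A"
abbreviation "E0 \<equiv> dom_infty H0 (domA0 ev H0) A"

text \<open>Evaluations separate points, so the generator is determined by one-sided derivatives of
  curves and no limit in the norm has to be computed.\<close>

lemma opA_iff:
  "h \<in> domA ev \<and> A h = k \<longleftrightarrow> (\<forall>x\<ge>0. (ev h has_real_derivative ev k x) (at x within {0..}))"
proof
  assume r: "\<forall>x\<ge>0. (ev h has_real_derivative ev k x) (at x within {0..})"
  then have h: "h \<in> domA ev" unfolding generator_C1 by blast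
  have "ev (A h) x = ev k x" if "x \<ge> 0" for x
    using generator_deriv[OF h that] r that at_within_atLeast_nontrivial[OF that]
      vector_derivative_unique_within
    by (metis has_real_derivative_iff_has_vector_derivative)
  then have "A h = k" by (intro ev_inject) auto
  with h show "h \<in> domA ev \<and> A h = k" by blast
qed (use generator_deriv in blast)

lemma opA_I:
  assumes "\<And>x. x \<ge> 0 \<Longrightarrow> (ev h has_real_derivative ev k x) (at x within {0..})"
  shows "h \<in> domA ev" "A h = k"
  using opA_iff[of h k] assms by blast+

lemma ev_add: "x \<ge> 0 \<Longrightarrow> ev (g + h) x = ev g x + ev h x"
  using linear_add[OF bounded_linear.linear[OF ev_bounded_linear, of x], of g h] by simp

lemma ev_scale: "x \<ge> 0 \<Longrightarrow> ev (r *\<^sub>R h) x = r * ev h x"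
  using linear_scale[OF bounded_linear.linear[OF ev_bounded_linear, of x], of r h] by simp

lemma ev_zero: "x \<ge> 0 \<Longrightarrow> ev 0 x = 0"
  using ev_scale[of x 0 0] by simp

lemma ev_minus: "x \<ge> 0 \<Longrightarrow> ev (- h) x = - ev h x"
  using ev_scale[of x "-1" h] by simp

lemma has_derivative_cong_atLeast:
  assumes "(f has_real_derivative D) (at x within {0..})" "x \<ge> 0" "\<And>x. x \<ge> 0 \<Longrightarrow> g x = f x"
  shows "(g has_real_derivative D) (at x within {0..})"
  using assms unfolding has_field_derivative_def by (intro has_derivative_transform[of x _ g f]) auto

lemma opA_add:
  assumes "g \<in> domA ev" "h \<in> domA ev"
  shows "g + h \<in> domA ev" "A (g + h) = A g + A h"
proof -
  have "(ev (g + h) has_real_derivative ev (A g + A h) x) (at x within {0..})" if "x \<ge> 0" for x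
    using DERIV_add[OF generator_deriv[OF assms(1) that] generator_deriv[OF assms(2) that]] that
    by (simp add: ev_add has_derivative_cong_atLeast[where f = "\<lambda>x. ev g x + ev h x"])
  then show "g + h \<in> domA ev" "A (g + h) = A g + A h" using opA_I by blast+
qed

lemma opA_scale:
  assumes "h \<in> domA ev"
  shows "r *\<^sub>R h \<in> domA ev" "A (r *\<^sub>R h) = r *\<^sub>R A h"
proof -
  have "(ev (r *\<^sub>R h) has_real_derivative ev (r *\<^sub>R A h) x) (at x within {0..})" if "x \<ge> 0" for x
    using DERIV_cmult[OF generator_deriv[OF assms that], of r] that
    by (simp add: ev_scale has_derivative_cong_atLeast[where f = "\<lambda>x. r * ev h x"])
  then show "r *\<^sub>R h \<in> domA ev" "A (r *\<^sub>R h) = r *\<^sub>R A h" using opA_I by blast+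
qed

lemma opA_zero: "0 \<in> domA ev" "A 0 = 0"
proof -
  have "(ev 0 has_real_derivative ev 0 x) (at x within {0..})" if "x \<ge> 0" for x
    using that by (simp add: ev_zero has_derivative_cong_atLeast[where f = "\<lambda>_. 0"])
  then show "0 \<in> domA ev" "A 0 = 0" using opA_I by blast+
qed

lemma pow_dom_iff: "h \<in> pow_dom UNIV D B n \<longleftrightarrow> (\<forall>i<n. (B ^^ i) h \<in> D)"
proof (induction n arbitrary: h)
  case (Suc n)
  have "(\<forall>i<Suc n. (B ^^ i) h \<in> D) \<longleftrightarrow> h \<in> D \<and> (\<forall>i<n. (B ^^ i) (B h) \<in> D)"
    by (simp add: All_less_Suc2 funpow_Suc_right del: funpow.simps)
  then show ?case using Suc by simp
qed simp

lemma E_iff: "h \<in> E \<longleftrightarrow> (\<forall>n. (A ^^ n) h \<in> domA ev)"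
  unfolding dom_infty_def by (auto simp: pow_dom_iff)

lemma subspace_pow_dom: "subspace (pow_dom UNIV (domA ev) A n)"
  by (induction n) (auto simp: subspace_def opA_zero opA_add opA_scale)

lemma ev_uniformly_bounded:
  assumes "0 \<le> X"
  shows "\<exists>C. \<forall>x\<in>{0..X}. \<forall>h. \<bar>ev h x\<bar> \<le> C * norm h"
proof -
  define \<T> where "\<T> = (\<lambda>n::nat. (\<lambda>x h. ev h x) ` {0..X})"
  have "\<exists>n C. \<forall>T\<in>\<T> n. \<forall>h. norm (T h) \<le> C * norm h"
  proof (rule uniform_boundedness)
    show "bounded_linear T" if "T \<in> \<T> n" for T n
      using that ev_bounded_linear by (auto simp: \<T>_def)
    fix h
    have "compact (ev h ` {0..X})"
      by (intro compact_continuous_image continuous_on_subset[OF ev_continuous] compact_Icc) auto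
    then obtain B where "\<forall>x\<in>{0..X}. norm (ev h x) \<le> B"
      using compact_imp_bounded bounded_iff by (metis imageI)
    moreover obtain n :: nat where "B \<le> n" using real_arch_simple by blast
    ultimately show "\<exists>n. \<forall>T\<in>\<T> n. norm (T h) \<le> real n"
      by (intro exI[of _ n]) (force simp: \<T>_def)
  qed
  then show ?thesis by (auto simp: \<T>_def)
qed

text \<open>Norm convergence implies uniform convergence of the curves on compact intervals, because
  the evaluations there are uniformly bounded; the claim is then the classical theorem on
  derivatives of uniform limits.\<close>

lemma opA_closed:
  assumes x: "\<And>n::nat. x n \<in> domA ev" and h: "x \<longlonglongrightarrow> h" and k: "(\<lambda>n. A (x n)) \<longlonglongrightarrow> k"
  shows "h \<in> domA ev" "A h = k"
proof -
  have lim: "(\<lambda>n. ev (x n) t) \<longlonglongrightarrow> ev h t" if "t \<ge> 0" for t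
    using bounded_linear.tendsto[OF ev_bounded_linear[OF that] h] .
  have "(ev h has_real_derivative ev k t) (at t within {0..})" if t: "t \<ge> 0" for t
  proof -
    let ?S = "{0..t + 1}"
    obtain C where C: "\<And>s g. s \<in> ?S \<Longrightarrow> \<bar>ev g s\<bar> \<le> C * norm g"
      using ev_uniformly_bounded[of "t + 1"] t by force
    have "\<exists>g. \<forall>s\<in>?S. (\<lambda>n. ev (x n) s) \<longlonglongrightarrow> g s \<and> (g has_derivative (*) (ev k s)) (at s within ?S)"
    proof (rule has_derivative_sequence[where f = "\<lambda>n. ev (x n)" and f' = "\<lambda>n s. (*) (ev (A (x n)) s)"
          and g' = "\<lambda>s. (*) (ev k s)" and ?x0.0 = 0 and l = "ev h 0"])
      show "(ev (x n) has_derivative (*) (ev (A (x n)) s)) (at s within ?S)" if "s \<in> ?S" for n s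
        using generator_deriv[OF x[of n], of s] that unfolding has_field_derivative_def
        by (intro has_derivative_subset[of _ _ s "{0..}" ?S]) auto
      fix e :: real assume "0 < e"
      have "(\<lambda>n. C * norm (A (x n) - k)) \<longlonglongrightarrow> C * norm (k - k)"
        by (intro tendsto_intros k)
      then have "\<forall>\<^sub>F n in sequentially. C * norm (A (x n) - k) < e"
        using \<open>0 < e\<close> by (intro order_tendstoD(2)) auto
      then show "\<forall>\<^sub>F n in sequentially. \<forall>s\<in>?S. \<forall>y. norm (ev (A (x n)) s * y - ev k s * y) \<le> e * norm y"
      proof eventually_elim
        case (elim n)
        show ?case
        proof (intro ballI allI)
          fix s y :: real assume s: "s \<in> ?S"
          have "ev (A (x n)) s - ev k s = ev (A (x n) - k) s"
            using s ev_add[of s "A (x n)" "- k"] ev_minus[of s k] by simp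
          then have "\<bar>ev (A (x n)) s - ev k s\<bar> \<le> e" using C[OF s, of "A (x n) - k"] elim by simp
          then have "\<bar>ev (A (x n)) s - ev k s\<bar> * \<bar>y\<bar> \<le> e * \<bar>y\<bar>" by (intro mult_right_mono) auto
          then show "norm (ev (A (x n)) s * y - ev k s * y) \<le> e * norm y"
            by (simp add: abs_mult[symmetric] left_diff_distrib)
        qed
      qed
    next
      show "(\<lambda>n. ev (x n) 0) \<longlonglongrightarrow> ev h 0" by (rule lim) simp
      show "0 \<in> ?S" using t by simp
    qed simp
    then obtain g where g: "\<And>s. s \<in> ?S \<Longrightarrow> (\<lambda>n. ev (x n) s) \<longlonglongrightarrow> g s"
        "\<And>s. s \<in> ?S \<Longrightarrow> (g has_derivative (*) (ev k s)) (at s within ?S)" by blast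
    have "ev h s = g s" if "s \<in> ?S" for s
      using LIMSEQ_unique[OF lim g(1)[OF that]] that by simp
    then have "(ev h has_derivative (*) (ev k t)) (at t within ?S)"
      using t by (intro has_derivative_transform[OF _ _ g(2)]) auto
    then show ?thesis
      unfolding has_field_derivative_def using at_within_Icc_atLeast[of t "t + 1"] by simp
  qed
  then show "h \<in> domA ev" "A h = k" using opA_I by blast+
qed

sublocale graph_frechet_space E A
proof
  show "subspace E" unfolding dom_infty_def by (intro subspace_Inter) (auto intro: subspace_pow_dom)
  show "A h \<in> E" if "h \<in> E" for h
    using that unfolding E_iff by (metis funpow_swap1 comp_apply funpow_Suc_right)
  show "A (g + h) = A g + A h" if "g \<in> E" "h \<in> E" for g h
    using that opA_add(2) E_iff[of g] E_iff[of h] by (metis funpow_0)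
  show "A (r *\<^sub>R h) = r *\<^sub>R A h" if "h \<in> E" for r h
    using that opA_scale(2) E_iff[of h] by (metis funpow_0)
  show "l 0 \<in> E \<and> (\<forall>m. (A ^^ m) (l 0) = l m)"
    if x: "\<And>n::nat. x n \<in> E" and l: "\<And>m. (\<lambda>n. (A ^^ m) (x n)) \<longlonglongrightarrow> l m" for x l
  proof -
    have step: "l m \<in> domA ev" "A (l m) = l (Suc m)" for m
      using opA_closed[of "\<lambda>n. (A ^^ m) (x n)" "l m" "l (Suc m)"] x l[of m] l[of "Suc m"]
      unfolding E_iff by auto
    have "(A ^^ m) (l 0) = l m" for m by (induction m) (auto simp: step)
    then show ?thesis using step(1) by (auto simp: E_iff)
  qed
qed

lemma DAinf_eq: "DAinf ev = X" unfolding DAinf_def ..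

lemma E0_iff: "h \<in> E0 \<longleftrightarrow> (\<forall>n. (A ^^ n) h \<in> domA0 ev H0)"
proof -
  have "h \<in> pow_dom H0 (domA0 ev H0) A n \<longleftrightarrow> (\<forall>i<n. (A ^^ i) h \<in> domA0 ev H0) \<and> (A ^^ n) h \<in> H0" for n h
  proof (induction n arbitrary: h)
    case (Suc n)
    have "(\<forall>i<Suc n. (A ^^ i) h \<in> domA0 ev H0) \<longleftrightarrow> h \<in> domA0 ev H0 \<and> (\<forall>i<n. (A ^^ i) (A h) \<in> domA0 ev H0)"
      by (simp add: All_less_Suc2 funpow_Suc_right del: funpow.simps)
    then show ?case using Suc by (simp add: funpow_swap1)
  qed simp
  then show ?thesis unfolding dom_infty_def by (auto simp: domA0_def)
qed

lemma E0_subset: "h \<in> E0 \<Longrightarrow> h \<in> E \<and> h \<in> H0 \<and> A h \<in> E0"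
proof -
  assume h: "h \<in> E0"
  then have "(A ^^ n) (A h) \<in> domA0 ev H0" for n
    using E0_iff[of h] by (metis comp_apply funpow_Suc_right)
  moreover have "h \<in> domA0 ev H0" using h E0_iff[of h] by (metis funpow_0)
  ultimately show ?thesis using h unfolding E_iff E0_iff by (auto simp: domA0_def)
qed

lemma graph_frechet_space_E0: "graph_frechet_space E0 A"
proof
  have [simp]: "(A ^^ n) 0 = 0" for n by (rule pow_zero)
  show "subspace E0"
    unfolding subspace_def
  proof (intro conjI ballI allI)
    show "0 \<in> E0"
      using H0_subspace unfolding E0_iff by (simp add: domA0_def opA_zero subspace_0)
    fix x y assume x: "x \<in> E0"
    show "r *\<^sub>R x \<in> E0" for r
      using x E0_subset[OF x] H0_subspace unfolding E0_iff
      by (auto simp: pow_scale domA0_def opA_scale subspace_scale)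
    assume y: "y \<in> E0"
    show "x + y \<in> E0"
      using x E0_subset[OF x] y E0_subset[OF y] H0_subspace unfolding E0_iff
      by (auto simp: pow_add domA0_def opA_add subspace_add)
  qed
  show "A h \<in> E0" if "h \<in> E0" for h using E0_subset[OF that] by blast
  show "A (g + h) = A g + A h" if "g \<in> E0" "h \<in> E0" for g h
    using E0_subset[OF that(1)] E0_subset[OF that(2)] A_add by blast
  show "A (r *\<^sub>R h) = r *\<^sub>R A h" if "h \<in> E0" for r h
    using E0_subset[OF that] A_scale by blast
  show "l 0 \<in> E0 \<and> (\<forall>m. (A ^^ m) (l 0) = l m)"
    if x: "\<And>n::nat. x n \<in> E0" and l: "\<And>m. (\<lambda>n. (A ^^ m) (x n)) \<longlonglongrightarrow> l m" for x l
  proof -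
    have E: "l 0 \<in> E" "\<And>m. (A ^^ m) (l 0) = l m"
      using graph_closed[of x l] x l E0_subset by blast+
    have "(A ^^ m) (x n) \<in> H0" for m n
      using x[of n] unfolding E0_iff by (auto simp: domA0_def)
    then have "l m \<in> H0" for m using closed_sequentially[OF H0_closed _ l] by blast
    then have "(A ^^ m) (l 0) \<in> domA0 ev H0" for m
      using E(1) E(2)[of "Suc m"] unfolding E_iff by (auto simp: domA0_def E(2))
    then show ?thesis using E(2) E0_iff by blast
  qed
qed

lemma smooth_curve_DA0inf_iff:
  "smooth_curve (DA0inf ev H0) c \<longleftrightarrow> (\<forall>t. c t \<in> E0) \<and> (\<forall>m. smth (\<lambda>t. (A ^^ m) (c t)))"
  unfolding DA0inf_def by (rule graph_frechet_space.smooth_curve_X_iff[OF graph_frechet_space_E0])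

lemma topspace_DA0inf: "topspace (DA0inf ev H0) = E0"
  unfolding DA0inf_def by (rule graph_frechet_space.topspace_X[OF graph_frechet_space_E0])

section \<open>The bilinear map S and its smoothness\<close>

lemma ev_hjm_S:
  assumes "f \<in> H0" "g \<in> H0" "x \<ge> 0"
  shows "ev (hjm_S ev f g) x = ev f x * integral {0..x} (ev g)"
proof -
  obtain k where k: "represents ev k (\<lambda>x. ev f x * integral {0..x} (ev g))"
    using S_closed assms by blast
  have "curve_of ev (\<lambda>x. ev f x * integral {0..x} (ev g)) = k"
    unfolding curve_of_def
    by (rule the_equality[where P = "\<lambda>h. represents ev h (\<lambda>x. ev f x * integral {0..x} (ev g))", OF k])
      (use k ev_inject in \<open>simp add: represents_def\<close>)
  then show ?thesis using k assms by (simp add: hjm_S_def represents_def)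
qed

lemma ev_integrable: "x \<ge> 0 \<Longrightarrow> ev g integrable_on {0..x}"
  by (intro integrable_continuous_real continuous_on_subset[OF ev_continuous]) auto

lemma integral_ev_add: "x \<ge> 0 \<Longrightarrow> integral {0..x} (ev (g + h)) = integral {0..x} (ev g) + integral {0..x} (ev h)"
proof -
  assume "x \<ge> 0"
  have "integral {0..x} (ev (g + h)) = integral {0..x} (\<lambda>t. ev g t + ev h t)"
    by (intro integral_cong) (simp add: ev_add)
  then show ?thesis using integral_add[OF ev_integrable ev_integrable] \<open>x \<ge> 0\<close> by simp
qed

lemma integral_ev_scale: "x \<ge> 0 \<Longrightarrow> integral {0..x} (ev (r *\<^sub>R h)) = r * integral {0..x} (ev h)"
proof -
  assume "x \<ge> 0"
  have "integral {0..x} (ev (r *\<^sub>R h)) = integral {0..x} (\<lambda>t. r * ev h t)"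
    by (intro integral_cong) (simp add: ev_scale)
  then show ?thesis by simp
qed

lemma hjm_S_bounded: "\<exists>K. bounded_bilinear_on (hjm_S ev) H0 H0 K"
proof -
  note H0 = H0_subspace H0_closed
  have addl: "hjm_S ev (x + x') z = hjm_S ev x z + hjm_S ev x' z" if "x \<in> H0" "x' \<in> H0" "z \<in> H0" for x x' z
    by (rule ev_inject) (use that in \<open>simp add: ev_hjm_S ev_add subspace_add[OF H0_subspace] distrib_right\<close>)
  have addr: "hjm_S ev x (z + z') = hjm_S ev x z + hjm_S ev x z'" if "x \<in> H0" "z \<in> H0" "z' \<in> H0" for x z z'
    by (rule ev_inject) (use that in \<open>simp add: ev_hjm_S ev_add integral_ev_add subspace_add[OF H0_subspace] distrib_left\<close>)
  have scl: "hjm_S ev (r *\<^sub>R x) z = r *\<^sub>R hjm_S ev x z" if "x \<in> H0" "z \<in> H0" for x z r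
    by (rule ev_inject) (use that in \<open>simp add: ev_hjm_S ev_scale subspace_scale[OF H0_subspace]\<close>)
  have scr: "hjm_S ev x (r *\<^sub>R z) = r *\<^sub>R hjm_S ev x z" if "x \<in> H0" "z \<in> H0" for x z r
    by (rule ev_inject) (use that in \<open>simp add: ev_hjm_S ev_scale integral_ev_scale subspace_scale[OF H0_subspace]\<close>)
  have z: "0 \<in> H0" by (rule subspace_0[OF H0_subspace])
  have zl: "hjm_S ev 0 z = 0" if "z \<in> H0" for z using scl[OF z that, of 0] by simp
  have zr: "hjm_S ev z 0 = 0" if "z \<in> H0" for z using scr[OF that z, of 0] by simp
  obtain d where d: "0 < d" "\<And>x y. x \<in> H0 \<Longrightarrow> y \<in> H0 \<Longrightarrow> dist (x, y) (0, 0) < d \<Longrightarrow> norm (hjm_S ev x y) < 1"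
    using S_continuous[unfolded continuous_on_iff, rule_format, of "(0, 0)" 1] z zl[OF z] by (auto simp: dist_norm)
  have bound: "norm (hjm_S ev x y) \<le> (9 / d\<^sup>2) * norm x * norm y" if xy: "x \<in> H0" "y \<in> H0" for x y
  proof (cases "x = 0 \<or> y = 0")
    case True
    then show ?thesis using zl zr xy by auto
  next
    case False
    \<comment> \<open>Thirds of \<open>d\<close>, because the norm of the pair is estimated by the
      sum of the two norms.\<close>
    define a where "a = d / (3 * norm x)"
    define b where "b = d / (3 * norm y)"
    have ab: "0 < a" "0 < b" using False d by (auto simp: a_def b_def)
    have "norm (a *\<^sub>R x, b *\<^sub>R y) \<le> norm (a *\<^sub>R x) + norm (b *\<^sub>R y)" by (rule norm_Pair_le)
    also have "\<dots> = d / 3 + d / 3" using False ab d by (simp add: a_def b_def)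
    also have "\<dots> < d" using d by simp
    finally have "dist (a *\<^sub>R x, b *\<^sub>R y) (0, 0) < d" by (simp add: zero_prod_def[symmetric])
    then have "norm (hjm_S ev (a *\<^sub>R x) (b *\<^sub>R y)) < 1"
      using xy by (intro d(2)) (auto intro: subspace_scale[OF H0_subspace])
    moreover have "hjm_S ev (a *\<^sub>R x) (b *\<^sub>R y) = (a * b) *\<^sub>R hjm_S ev x y"
      using xy by (simp add: scl scr subspace_scale[OF H0_subspace])
    ultimately have "(a * b) * norm (hjm_S ev x y) < 1" using ab by simp
    then have "norm (hjm_S ev x y) \<le> 1 / (a * b)" using ab by (simp add: field_simps)
    also have "1 / (a * b) = (9 / d\<^sup>2) * norm x * norm y"
      using False d by (simp add: a_def b_def power2_eq_square)
    finally show ?thesis .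
  qed
  show ?thesis
    by (rule exI[of _ "9 / d\<^sup>2"], unfold_locales) (use H0 addl addr scl scr bound in auto)
qed

text \<open>The product rule produces the pointwise product \<open>f g\<close>. Writing
  \<open>g\<close> as \<open>g(0)\<close> plus the integral of \<open>g'\<close> turns it into
  \<open>S(f, g') + g(0) f\<close>, which lies in the space and can be differentiated again in the
  same way.\<close>

lemma opA_hjm_S:
  assumes f: "f \<in> domA0 ev H0" and g: "g \<in> domA0 ev H0"
  shows "hjm_S ev f g \<in> domA ev"
    "A (hjm_S ev f g) = hjm_S ev (A f) g + hjm_S ev f (A g) + ev g 0 *\<^sub>R f"
proof -
  have H: "f \<in> H0" "g \<in> H0" "A f \<in> H0" "A g \<in> H0" "f \<in> domA ev" "g \<in> domA ev"
    using f g by (auto simp: domA0_def)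
  let ?k = "hjm_S ev (A f) g + hjm_S ev f (A g) + ev g 0 *\<^sub>R f"
  have "(ev (hjm_S ev f g) has_real_derivative ev ?k x) (at x within {0..})" if x: "x \<ge> 0" for x
  proof (rule has_derivative_cong_atLeast[OF _ x])
    have "((\<lambda>x. integral {0..x} (ev g)) has_real_derivative ev g x) (at x within {0..x + 1})"
      using x by (intro integral_has_real_derivative continuous_on_subset[OF ev_continuous]) auto
    then have I: "((\<lambda>x. integral {0..x} (ev g)) has_real_derivative ev g x) (at x within {0..})"
      using at_within_Icc_atLeast[of x "x + 1"] by simp
    have "(ev (A g) has_integral ev g x - ev g 0) {0..x}"
    proof (rule fundamental_theorem_of_calculus[OF x])
      fix y assume "y \<in> {0..x}"
      then show "(ev g has_vector_derivative ev (A g) y) (at y within {0..x})"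
        using generator_deriv[OF H(6), of y] DERIV_subset[of "ev g" _ y "{0..}" "{0..x}"]
        by (auto simp: has_real_derivative_iff_has_vector_derivative)
    qed
    then have I2: "integral {0..x} (ev (A g)) = ev g x - ev g 0" by (rule integral_unique)
    have "ev ?k x = ev (A f) x * integral {0..x} (ev g) + ev f x * ev g x"
      using x H by (simp add: ev_add ev_scale ev_hjm_S I2) (simp add: algebra_simps)
    then show "((\<lambda>x. ev f x * integral {0..x} (ev g)) has_real_derivative ev ?k x) (at x within {0..})"
      using DERIV_mult[OF generator_deriv[OF H(5) x] I] by (simp add: algebra_simps)
  qed (use H in \<open>simp add: ev_hjm_S\<close>)
  then show "hjm_S ev f g \<in> domA ev" "A (hjm_S ev f g) = ?k" using opA_I by blast+
qed

lemma E0_domA0: "h \<in> E0 \<Longrightarrow> h \<in> domA0 ev H0"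
  unfolding E0_iff by (metis funpow_0)

lemma hjm_S_mem:
  assumes "f \<in> E0" "g \<in> E0"
  shows "hjm_S ev f g \<in> E"
proof -
  have "hjm_S ev f g \<in> pow_dom UNIV (domA ev) A n" if "f \<in> E0" "g \<in> E0" for n f g
    using that
  proof (induction n arbitrary: f g)
    case (Suc n)
    have "f \<in> pow_dom UNIV (domA ev) A n" using E0_subset[OF Suc.prems(1)] unfolding dom_infty_def by auto
    then have "A (hjm_S ev f g) \<in> pow_dom UNIV (domA ev) A n"
      unfolding opA_hjm_S(2)[OF E0_domA0[OF Suc.prems(1)] E0_domA0[OF Suc.prems(2)]]
      using Suc E0_subset by (intro subspace_add subspace_scale subspace_pow_dom) auto
    then show ?case using opA_hjm_S(1) E0_domA0 Suc.prems by auto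
  qed simp
  then show ?thesis using assms unfolding dom_infty_def by blast
qed

lemma smth_hjm_S:
  assumes "smooth_curve (DA0inf ev H0) f" "smooth_curve (DA0inf ev H0) g"
  shows "smth (\<lambda>t. (A ^^ m) (hjm_S ev (f t) (g t)))"
  using assms
proof (induction m arbitrary: f g)
  case 0
  obtain K where K: "bounded_bilinear_on (hjm_S ev) H0 H0 K" using hjm_S_bounded by blast
  have "smth (\<lambda>t. (A ^^ 0) (f t))" "smth (\<lambda>t. (A ^^ 0) (g t))" "\<And>t. f t \<in> H0" "\<And>t. g t \<in> H0"
    using 0 unfolding smooth_curve_DA0inf_iff using E0_subset by blast+
  then show ?case using bounded_bilinear_on.smth[OF K, of f g] by simp
next
  case (Suc m)
  note fg = Suc.prems[unfolded smooth_curve_DA0inf_iff]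
  have A': "smooth_curve (DA0inf ev H0) (\<lambda>t. A (c t))" if "smooth_curve (DA0inf ev H0) c" for c
    unfolding smooth_curve_DA0inf_iff
  proof (intro conjI allI)
    note c = that[unfolded smooth_curve_DA0inf_iff]
    show "A (c t) \<in> E0" for t using c E0_subset by blast
    show "smth (\<lambda>t. (A ^^ m) (A (c t)))" for m
      using conjunct2[OF c, rule_format, of "Suc m"] by (simp only: funpow_Suc_right o_def)
  qed
  have mem: "f t \<in> E0" "g t \<in> E0" "A (f t) \<in> E0" "A (g t) \<in> E0" "f t \<in> E" for t
    using fg E0_subset by blast+
  have "(A ^^ Suc m) (hjm_S ev (f t) (g t)) = (A ^^ m) (hjm_S ev (A (f t)) (g t))
      + (A ^^ m) (hjm_S ev (f t) (A (g t))) + ev (g t) 0 *\<^sub>R (A ^^ m) (f t)" for t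
    unfolding funpow_Suc_right o_def opA_hjm_S(2)[OF E0_domA0[OF mem(1)] E0_domA0[OF mem(2)]]
    by (simp add: pow_add pow_scale mem_intros hjm_S_mem mem)
  moreover have "smth (\<lambda>t. (A ^^ m) (hjm_S ev (A (f t)) (g t))
      + (A ^^ m) (hjm_S ev (f t) (A (g t))) + ev (g t) 0 *\<^sub>R (A ^^ m) (f t))"
  proof (intro smth_add smth_scaleR Suc.IH A' Suc.prems)
    have "smth (\<lambda>t. (A ^^ 0) (g t))" using fg by blast
    then show "smth (\<lambda>t. ev (g t) 0)"
      using smth_bounded_linear[OF ev_bounded_linear[of 0], of g] by simp
    show "smth (\<lambda>t. (A ^^ m) (f t))" using fg by blast
  qed
  ultimately show ?case by simp
qed

section \<open>Strong continuity of the shifts and smoothing averages\<close>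

lemma ev_shift: "t \<ge> 0 \<Longrightarrow> x \<ge> 0 \<Longrightarrow> ev (shift ev t h) x = ev h (t + x)"
proof -
  assume tx: "t \<ge> 0" "x \<ge> 0"
  obtain k where k: "represents ev k (\<lambda>x. ev h (t + x))" using shift_closed tx(1) by blast
  have "curve_of ev (\<lambda>x. ev h (t + x)) = k"
    unfolding curve_of_def
    by (rule the_equality[where P = "\<lambda>g. represents ev g (\<lambda>x. ev h (t + x))", OF k])
      (use k ev_inject in \<open>simp add: represents_def\<close>)
  then show ?thesis using k tx by (simp add: shift_def represents_def)
qed

lemma shift_tendsto: "((\<lambda>t. shift ev t h) \<longlongrightarrow> h) (at_right 0)"
  using shift_semigroup unfolding c0_semigroup_def by blast

lemma shift_bounded_linear: "t \<ge> 0 \<Longrightarrow> bounded_linear (shift ev t)"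
  using shift_semigroup unfolding c0_semigroup_def by blast

lemma shift_0: "shift ev 0 h = h"
  using shift_semigroup unfolding c0_semigroup_def by blast

lemma shift_add: "s \<ge> 0 \<Longrightarrow> t \<ge> 0 \<Longrightarrow> shift ev (s + t) h = shift ev s (shift ev t h)"
  using shift_semigroup unfolding c0_semigroup_def by blast

lemma shift_near_0:
  assumes "0 < e"
  shows "\<exists>d>0. \<forall>t. 0 \<le> t \<longrightarrow> t \<le> d \<longrightarrow> norm (shift ev t h - h) \<le> e"
proof -
  have "\<forall>\<^sub>F t in at_right 0. dist (shift ev t h) h < e"
    using shift_tendsto assms by (rule tendstoD)
  then obtain b where b: "0 < b" "\<And>t. 0 < t \<Longrightarrow> t < b \<Longrightarrow> dist (shift ev t h) h < e"
    unfolding eventually_at_right_field by auto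
  have "norm (shift ev t h - h) \<le> e" if "0 \<le> t" "t \<le> b / 2" for t
  proof (cases "t = 0")
    case True
    then show ?thesis using assms by (simp add: shift_0)
  next
    case False
    then have "dist (shift ev t h) h < e" using that b(1) by (intro b(2)) auto
    then show ?thesis by (simp add: dist_norm)
  qed
  then show ?thesis using b(1) by (intro exI[of _ "b / 2"]) auto
qed

lemma shift_locally_bounded: "\<exists>\<delta> C. 0 < \<delta> \<and> (\<forall>t h. 0 \<le> t \<longrightarrow> t \<le> \<delta> \<longrightarrow> norm (shift ev t h) \<le> C * norm h)"
proof -
  define \<T> where "\<T> = (\<lambda>n::nat. shift ev ` {0..1 / (real n + 1)})"
  have "\<exists>n C. \<forall>T\<in>\<T> n. \<forall>h. norm (T h) \<le> C * norm h"
  proof (rule uniform_boundedness)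
    show "bounded_linear T" if "T \<in> \<T> n" for T n
      using that shift_bounded_linear by (auto simp: \<T>_def)
    fix h
    obtain d where d: "0 < d" "\<And>t. 0 \<le> t \<Longrightarrow> t \<le> d \<Longrightarrow> norm (shift ev t h - h) \<le> 1"
      using shift_near_0[of 1 h] by auto
    obtain n :: nat where n: "max (1 / d) (norm h + 1) \<le> n" using real_arch_simple by blast
    have "1 / (real n + 1) \<le> d"
    proof -
      have "1 / d \<le> real n + 1" using n by linarith
      then show ?thesis using d(1) by (simp add: field_simps)
    qed
    moreover have "norm (shift ev t h) \<le> real n" if "0 \<le> t" "t \<le> d" for t
      using d(2)[OF that] n norm_triangle_ineq2[of "shift ev t h" h] by linarith
    ultimately have "\<forall>T\<in>\<T> n. norm (T h) \<le> real n" by (auto simp: \<T>_def)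
    then show "\<exists>n. \<forall>T\<in>\<T> n. norm (T h) \<le> real n" by blast
  qed
  then obtain n C where nC: "\<forall>T\<in>\<T> n. \<forall>h. norm (T h) \<le> C * norm h" by blast
  have "norm (shift ev t h) \<le> C * norm h" if "0 \<le> t" "t \<le> 1 / (real n + 1)" for t h
    using nC that by (auto simp: \<T>_def)
  moreover have "0 < 1 / (real n + 1)" by simp
  ultimately show ?thesis by blast
qed

text \<open>Strong continuity is given at time \<open>0\<close> only. Factoring out the smaller of
  two times reduces any increment to one starting at \<open>0\<close>, on either side.\<close>

lemma shift_continuous:
  assumes C: "\<And>t h. 0 \<le> t \<Longrightarrow> t \<le> \<delta> \<Longrightarrow> norm (shift ev t h) \<le> C * norm h"
  shows "continuous_on {0..\<delta>} (\<lambda>t. shift ev t h)"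
proof (cases "\<delta> \<ge> 0")
  case True
  have C0: "0 \<le> \<bar>C\<bar>" by simp
  have inc: "norm (shift ev t h - shift ev s h) \<le> \<bar>C\<bar> * norm (shift ev (t - s) h - h)"
    if "0 \<le> s" "s \<le> t" "t \<le> \<delta>" for s t
  proof -
    have "shift ev t h - shift ev s h = shift ev s (shift ev (t - s) h - h)"
      using shift_add[of s "t - s" h] that
        linear_diff[OF bounded_linear.linear[OF shift_bounded_linear, of s], of "shift ev (t - s) h" h] by simp
    also have "norm \<dots> \<le> C * norm (shift ev (t - s) h - h)" using that by (intro C) auto
    also have "\<dots> \<le> \<bar>C\<bar> * norm (shift ev (t - s) h - h)" by (intro mult_right_mono) auto
    finally show ?thesis .
  qed
  show ?thesis
    unfolding continuous_on_iff
  proof (intro ballI allI impI)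
    fix s e :: real assume s: "s \<in> {0..\<delta>}" and e: "0 < e"
    obtain d where d: "0 < d" "\<And>t. 0 \<le> t \<Longrightarrow> t \<le> d \<Longrightarrow> norm (shift ev t h - h) \<le> e / (\<bar>C\<bar> + 1)"
      using shift_near_0[of "e / (\<bar>C\<bar> + 1)" h] e by (auto simp: add_nonneg_pos)
    have lt: "\<bar>C\<bar> * (e / (\<bar>C\<bar> + 1)) < e" using e by (simp add: field_simps add_nonneg_pos)
    have "dist (shift ev t h) (shift ev s h) < e" if t: "t \<in> {0..\<delta>}" "dist t s < d" for t
    proof -
      have "norm (shift ev (max s t) h - shift ev (min s t) h)
          \<le> \<bar>C\<bar> * norm (shift ev (max s t - min s t) h - h)"
        using s t by (intro inc) auto
      also have "\<dots> \<le> \<bar>C\<bar> * (e / (\<bar>C\<bar> + 1))"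
        using s t by (intro mult_left_mono d(2)) (auto simp: dist_real_def max_def min_def)
      finally show ?thesis using lt
        by (simp add: dist_norm max_def min_def norm_minus_commute split: if_splits)
    qed
    then show "\<exists>d>0. \<forall>t\<in>{0..\<delta>}. dist t s < d \<longrightarrow> dist (shift ev t h) (shift ev s h) < e"
      using d(1) by blast
  qed
qed simp

text \<open>\<open>A\<close> acts on weighted averages of the shifts of a curve by differentiating the weight, so the
  averages with smooth weights lie in \<open>D(A\<^sup>\<infinity>)\<close>.\<close>

definition weight :: "real \<Rightarrow> (real \<Rightarrow> real) \<Rightarrow> bool" where
  "weight e \<rho> \<longleftrightarrow> smth \<rho> \<and> (\<forall>t. t \<le> 0 \<or> e \<le> t \<longrightarrow> \<rho> t = 0)"

lemma weight_derivative:
  assumes "weight e \<rho>"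
  shows "weight e (\<lambda>t. - hderiv 1 \<rho> t)"
proof -
  have \<rho>: "smth \<rho>" "\<And>t. t \<le> 0 \<or> e \<le> t \<Longrightarrow> \<rho> t = 0" using assms by (auto simp: weight_def)
  have "hderiv 1 \<rho> t = 0" if t: "t \<le> 0 \<or> e \<le> t" for t
  proof -
    \<comment> \<open>A half-line ending at \<open>t\<close> on which \<open>\<rho>\<close>
      vanishes; the derivative at the boundary of the support is already determined by this
      side.\<close>
    define S where "S = (if t \<le> 0 then {..t} else {t..})"
    have z: "\<rho> s = 0" if "s \<in> S" for s using that t \<rho>(2) by (auto simp: S_def split: if_splits)
    have "t \<in> S" by (simp add: S_def)
    have "(\<rho> has_vector_derivative hderiv 1 \<rho> t) (at t within S)"
      by (rule has_vector_derivative_at_within[OF smth_hderiv1(1)[OF \<rho>(1)]])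
    then have "((\<lambda>_. 0) has_vector_derivative hderiv 1 \<rho> t) (at t within S)"
      by (rule has_vector_derivative_transform[OF \<open>t \<in> S\<close>, rotated]) (simp add: z)
    moreover have "((\<lambda>_. 0) has_vector_derivative 0) (at t within S)" by simp
    moreover have "at t within S \<noteq> bot"
    proof (cases "t \<le> 0")
      case True
      have "at_left t \<le> at t within S" using True by (intro at_le) (auto simp: S_def)
      then show ?thesis using trivial_limit_at_left_real[of t] by (metis bot_unique)
    next
      case False
      have "at_right t \<le> at t within S" using False by (intro at_le) (auto simp: S_def)
      then show ?thesis using trivial_limit_at_right_real[of t] by (metis bot_unique)
    qed
    ultimately show ?thesis using vector_derivative_unique_within by blast
  qed
  moreover have "smth (\<lambda>t. - hderiv 1 \<rho> t)" by (intro smth_uminus smth_hderiv1(2) \<rho>(1))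
  ultimately show ?thesis by (simp add: weight_def)
qed

text \<open>The substitution \<open>u = t + x\<close> moves the dependence on \<open>x\<close> from
  the curve, which need not be differentiable, to the weight. The enlarged interval of integration
  is independent of \<open>x\<close>, ready for differentiation under the integral.\<close>

lemma ev_average:
  assumes e: "0 < e" and \<rho>: "weight e \<rho>" and y: "((\<lambda>t. \<rho> t *\<^sub>R shift ev t h) has_integral y) {0..e}"
    and x: "0 \<le> x" "x \<le> b"
  shows "((\<lambda>u. \<rho> (u - x) * ev h u) has_integral ev y x) {0..b + e}"
proof -
  have "((\<lambda>g. ev g x) \<circ> (\<lambda>t. \<rho> t *\<^sub>R shift ev t h) has_integral ev y x) {0..e}"
    by (rule has_integral_linear[OF y ev_bounded_linear[OF x(1)]])
  then have "((\<lambda>t. \<rho> t * ev h (t + x)) has_integral ev y x) {0..e}"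
    by (rule has_integral_eq[rotated]) (use x in \<open>auto simp: ev_scale ev_shift\<close>)
  then have "((\<lambda>u. \<rho> (1 * u + - x) * ev h (1 * u + - x + x)) has_integral ev y x /\<^sub>R 1 ^ DIM(real))
      (cbox ((0 - - x) /\<^sub>R 1) ((e - - x) /\<^sub>R 1))"
    using has_integral_affinity'[of "\<lambda>t. \<rho> t * ev h (t + x)" "ev y x" 0 e 1 "- x"] by simp
  then have "((\<lambda>u. \<rho> (u - x) * ev h u) has_integral ev y x) {x..e + x}" by simp
  then show ?thesis
    by (rule has_integral_on_superset) (use x \<rho> in \<open>auto simp: weight_def\<close>)
qed

lemma opA_average:
  assumes e: "0 < e" and \<rho>: "weight e \<rho>"
    and y: "((\<lambda>t. \<rho> t *\<^sub>R shift ev t h) has_integral y) {0..e}"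
    and z: "((\<lambda>t. (- hderiv 1 \<rho> t) *\<^sub>R shift ev t h) has_integral z) {0..e}"
  shows "y \<in> domA ev" "A y = z"
proof -
  let ?\<rho>' = "\<lambda>t. - hderiv 1 \<rho> t"
  have sm: "smth \<rho>" using \<rho> by (simp add: weight_def)
  have c: "continuous_on S \<rho>" "continuous_on S (hderiv 1 \<rho>)" for S
    using smth_continuous[OF sm, of S 0] smth_continuous[OF sm, of S 1] by simp_all
  have "(ev y has_real_derivative ev z x) (at x within {0..})" if x: "x \<ge> 0" for x
  proof -
    define b where "b = x + 1"
    let ?U = "{0..b}" and ?I = "cbox 0 (b + e)"
    have L: "((\<lambda>x. integral ?I (\<lambda>u. \<rho> (u - x) * ev h u)) has_real_derivative
        integral ?I (\<lambda>u. ?\<rho>' (u - x) * ev h u)) (at x within ?U)"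
    proof (rule leibniz_rule_field_derivative[where f = "\<lambda>x u. \<rho> (u - x) * ev h u"])
      fix x u
      have "(\<rho> has_real_derivative hderiv 1 \<rho> (u - x)) (at (u - x))"
        using smth_hderiv1(1)[OF sm] by (simp add: has_real_derivative_iff_has_vector_derivative)
      then have "((\<lambda>x. \<rho> (u - x)) has_real_derivative hderiv 1 \<rho> (u - x) * (0 - 1)) (at x)"
        by (intro DERIV_chain2[of \<rho> _ "\<lambda>x. u - x"] DERIV_diff DERIV_const DERIV_ident)
      then have "((\<lambda>x. \<rho> (u - x) * ev h u) has_real_derivative hderiv 1 \<rho> (u - x) * (0 - 1) * ev h u) (at x within ?U)"
        using DERIV_cmult_right DERIV_subset[of _ _ x UNIV ?U] by blast
      then show "((\<lambda>x. \<rho> (u - x) * ev h u) has_real_derivative ?\<rho>' (u - x) * ev h u) (at x within ?U)"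
        by simp
    next
      fix x assume "x \<in> ?U"
      have "continuous_on {0..b + e} (\<lambda>u. \<rho> (u - x) * ev h u)"
        by (intro continuous_on_mult continuous_on_compose2[OF c(1)[of UNIV]] continuous_on_diff
            continuous_on_id continuous_on_const continuous_on_subset[OF ev_continuous]) auto
      then show "(\<lambda>u. \<rho> (u - x) * ev h u) integrable_on ?I"
        unfolding cbox_interval by (rule integrable_continuous_real)
    next
      show "continuous_on (?U \<times> ?I) (\<lambda>(x, u). ?\<rho>' (u - x) * ev h u)"
        unfolding split_beta
        by (intro continuous_on_mult continuous_on_minus continuous_on_compose2[OF c(2)[of UNIV]]
            continuous_on_compose2[OF ev_continuous[of h]] continuous_on_diff continuous_on_fst
            continuous_on_snd continuous_on_id) auto
    qed (use x in \<open>auto simp: b_def\<close>)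
    have Z: "integral ?I (\<lambda>u. ?\<rho>' (u - x) * ev h u) = ev z x"
      unfolding cbox_interval
      by (rule integral_unique[OF ev_average[OF e weight_derivative[OF \<rho>] z x]]) (simp add: b_def)
    have Y: "ev y s = integral ?I (\<lambda>u. \<rho> (u - s) * ev h u)" if "s \<in> ?U" for s
      unfolding cbox_interval
      by (rule integral_unique[OF ev_average[OF e \<rho> y], symmetric]) (use that in auto)
    have "x \<in> ?U" using x by (simp add: b_def)
    from has_derivative_transform[OF this Y L[unfolded Z has_field_derivative_def]]
    have "(ev y has_real_derivative ev z x) (at x within ?U)"
      unfolding has_field_derivative_def .
    then show ?thesis using at_within_Icc_atLeast[of x b] by (simp add: b_def)
  qed
  then show "y \<in> domA ev" "A y = z" using opA_I by blast+
qed

lemma average_exists: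
  assumes C: "\<And>t h. 0 \<le> t \<Longrightarrow> t \<le> e \<Longrightarrow> norm (shift ev t h) \<le> C * norm h" and \<rho>: "weight e \<rho>"
  shows "\<exists>y. ((\<lambda>t. \<rho> t *\<^sub>R shift ev t h) has_integral y) {0..e}"
proof -
  have "continuous_on {0..e} \<rho>" using \<rho> smth_continuous[of \<rho> "{0..e}" 0] by (simp add: weight_def)
  then have "continuous_on {0..e} (\<lambda>t. \<rho> t *\<^sub>R shift ev t h)"
    by (intro continuous_on_scaleR shift_continuous[OF C])
  from integrable_continuous_hilbert[OF this] show ?thesis unfolding integrable_on_def .
qed

lemma average_mem:
  assumes e: "0 < e" and C: "\<And>t h. 0 \<le> t \<Longrightarrow> t \<le> e \<Longrightarrow> norm (shift ev t h) \<le> C * norm h"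
    and \<rho>: "weight e \<rho>" and y: "((\<lambda>t. \<rho> t *\<^sub>R shift ev t h) has_integral y) {0..e}"
  shows "y \<in> E"
proof -
  have "(A ^^ n) y \<in> domA ev" for n
    using \<rho> y
  proof (induction n arbitrary: \<rho> y)
    case 0
    obtain z where "((\<lambda>t. (- hderiv 1 \<rho> t) *\<^sub>R shift ev t h) has_integral z) {0..e}"
      using average_exists[OF C weight_derivative[OF 0(1)]] by blast
    then show ?case using opA_average(1)[OF e 0] by simp
  next
    case (Suc n)
    obtain z where z: "((\<lambda>t. (- hderiv 1 \<rho> t) *\<^sub>R shift ev t h) has_integral z) {0..e}"
      using average_exists[OF C weight_derivative[OF Suc.prems(1)]] by blast
    have "(A ^^ n) z \<in> domA ev" by (rule Suc.IH[OF weight_derivative[OF Suc.prems(1)] z])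
    then show ?case
      using opA_average(2)[OF e Suc.prems z] by (simp add: funpow_Suc_right del: funpow.simps)
  qed
  then show ?thesis by (simp add: E_iff)
qed

text \<open>Averages with nonnegative weights supported near \<open>0\<close> form an approximate
  identity. Density excludes a finite-dimensional \<open>D(A^inf)\<close> when \<open>A\<close> is
  unbounded.\<close>

lemma E_dense: "closure E = UNIV"
proof -
  have "h \<in> closure E" for h
    unfolding closure_approachable
  proof (intro allI impI)
    fix \<epsilon> :: real assume \<epsilon>: "0 < \<epsilon>"
    obtain \<delta> C where C: "0 < \<delta>" "\<And>t h. 0 \<le> t \<Longrightarrow> t \<le> \<delta> \<Longrightarrow> norm (shift ev t h) \<le> C * norm h"
      using shift_locally_bounded by blast
    obtain d where d: "0 < d" "\<And>t. 0 \<le> t \<Longrightarrow> t \<le> d \<Longrightarrow> norm (shift ev t h - h) \<le> \<epsilon> / 2"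
      using shift_near_0[of "\<epsilon> / 2" h] \<epsilon> by auto
    define e where "e = min \<delta> d"
    have e: "0 < e" using C d by (simp add: e_def)
    have Ce: "norm (shift ev t g) \<le> C * norm g" if "0 \<le> t" "t \<le> e" for t g
      using C(2) that by (simp add: e_def)
    obtain \<rho>1 :: "real \<Rightarrow> real" where \<rho>1: "smth \<rho>1" "\<And>x. 0 \<le> \<rho>1 x" "\<And>x. \<rho>1 x > 0 \<longleftrightarrow> 0 < x \<and> x < 1"
      using smooth_mollifier_exists by blast
    define \<rho> where "\<rho> = (\<lambda>t. \<rho>1 (1 / e * t + 0))"
    have \<rho>0: "0 \<le> \<rho> t" for t by (simp add: \<rho>_def \<rho>1)
    have pos: "\<rho> t > 0 \<longleftrightarrow> 0 < t \<and> t < e" for t using e by (simp add: \<rho>_def \<rho>1 field_simps)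
    have "smth \<rho>" unfolding \<rho>_def by (rule smth_compose[OF \<rho>1(1) smth_affine])
    moreover have "\<rho> t = 0" if "t \<le> 0 \<or> e \<le> t" for t using pos[of t] \<rho>0[of t] that by linarith
    ultimately have w: "weight e \<rho>" by (simp add: weight_def)
    have cont: "continuous_on {0..e} \<rho>" using smth_continuous[OF \<open>smth \<rho>\<close>, of _ 0] by simp
    then obtain c where c: "(\<rho> has_integral c) {0..e}"
      using integrable_continuous_real integrable_on_def by blast
    have "0 \<le> c" by (rule has_integral_nonneg[OF c]) (rule \<rho>0)
    moreover have "c \<noteq> 0"
    proof
      assume "c = 0"
      then have "\<rho> (e / 2) = 0"
        using has_integral_0_cbox_imp_0[of 0 e \<rho> "e / 2"] cont c \<rho>0 e by auto
      then show False using pos[of "e / 2"] e by simp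
    qed
    ultimately have c0: "0 < c" by simp
    obtain y where y: "((\<lambda>t. \<rho> t *\<^sub>R shift ev t h) has_integral y) {0..e}"
      using average_exists[OF Ce w] by blast
    have "y \<in> E" by (rule average_mem[OF e Ce w y])
    then have mem: "(1 / c) *\<^sub>R y \<in> E" by (rule scale_mem)
    define u where "u = y - c *\<^sub>R h"
    have "((\<lambda>t. \<rho> t *\<^sub>R shift ev t h - \<rho> t *\<^sub>R h) has_integral u) {0..e}"
      unfolding u_def by (intro has_integral_diff y has_integral_scaleR_left c)
    \<comment> \<open>Testing against \<open>u\<close> itself reduces the norm estimate to an
      inequality between real integrals.\<close>
    from has_integral_linear[OF this bounded_linear_inner_left[of u]]
    have "((\<lambda>t. \<rho> t * ((shift ev t h - h) \<bullet> u)) has_integral u \<bullet> u) {0..e}"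
      by (simp add: o_def scaleR_diff_right[symmetric])
    moreover have "((\<lambda>t. \<rho> t * (\<epsilon> / 2 * norm u)) has_integral c * (\<epsilon> / 2 * norm u)) {0..e}"
      by (rule has_integral_mult_left[OF c])
    ultimately have "u \<bullet> u \<le> c * (\<epsilon> / 2 * norm u)"
    proof (rule has_integral_le)
      fix t assume t: "t \<in> {0..e}"
      have "(shift ev t h - h) \<bullet> u \<le> norm (shift ev t h - h) * norm u"
        by (rule norm_cauchy_schwarz)
      also have "\<dots> \<le> \<epsilon> / 2 * norm u" using t by (intro mult_right_mono d(2)) (auto simp: e_def)
      finally show "\<rho> t * ((shift ev t h - h) \<bullet> u) \<le> \<rho> t * (\<epsilon> / 2 * norm u)"
        by (intro mult_left_mono \<rho>0)
    qed
    then have "norm u * norm u \<le> (c * \<epsilon> / 2) * norm u"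
      by (simp add: power2_norm_eq_inner[symmetric] power2_eq_square mult.assoc)
    then have nu: "norm u \<le> c * \<epsilon> / 2" using \<epsilon> c0 by (cases "u = 0") auto
    have "(1 / c) *\<^sub>R y - h = (1 / c) *\<^sub>R u" using c0 by (simp add: u_def scaleR_diff_right)
    then have "norm ((1 / c) *\<^sub>R y - h) = norm u / c" using c0 by simp
    also have "\<dots> \<le> \<epsilon> / 2" using nu c0 by (simp add: field_simps)
    finally have "dist ((1 / c) *\<^sub>R y) h < \<epsilon>" using \<epsilon> by (simp add: dist_norm)
    with mem show "\<exists>y\<in>E. dist y h < \<epsilon>" by blast
  qed
  then show ?thesis by blast
qed

end

section \<open>The distribution generated by drift and volatilities\<close>

lemma closed_span_finite:
  fixes B :: "'h::real_inner set"
  assumes "finite B"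
  shows "closed (span B)"
proof -
  have "x \<in> span B" if x: "x \<in> closure (span B)" for x
  proof -
    obtain z where z: "\<And>n. z n \<in> span B" "z \<longlonglongrightarrow> x" using x closure_sequential by blast
    obtain s where s: "s \<in> span B" "\<forall>b\<in>span B. (x - s) \<bullet> b = 0"
      using orthogonal_projection_exists[OF assms] by blast
    have "(\<lambda>n. (x - s) \<bullet> z n) \<longlonglongrightarrow> (x - s) \<bullet> x" by (intro tendsto_intros z)
    then have "(\<lambda>n. 0) \<longlonglongrightarrow> (x - s) \<bullet> x" using s(2) z(1) by simp
    then have "(x - s) \<bullet> x = 0" using LIMSEQ_unique tendsto_const by blast
    moreover have "(x - s) \<bullet> s = 0" using s by blast
    ultimately have "(x - s) \<bullet> (x - s) = 0" by (simp add: inner_diff_right)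
    then show ?thesis using s(1) by simp
  qed
  then have "closure (span B) \<subseteq> span B" by (rule subsetI)
  then show ?thesis by (simp only: closure_subset_eq)
qed

lemma smooth_curve_euclidean:
  assumes "smth c"
  shows "smooth_curve euclidean c"
  unfolding smooth_curve_def
  by (intro conjI exI[of _ "\<lambda>n. hderiv n c"] allI)
    (use has_hderiv[OF assms] in \<open>auto simp: has_vector_derivative_iff_quotient\<close>)

locale hjm_distribution = forward_curve_space ev H0
  for ev :: "'h::{real_inner,complete_space} \<Rightarrow> real \<Rightarrow> real" and H0 :: "'h set" +
  fixes d :: nat and l :: "'h \<Rightarrow> 'b::banach" and \<phi> :: "nat \<Rightarrow> 'b \<Rightarrow> 'h"
  assumes l: "bounded_linear l"
    and \<phi>: "\<And>j. j \<in> {1..d} \<Longrightarrow> smooth_map euclidean (DA0inf ev H0) (\<phi> j)"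
    and unbounded: "domA ev \<noteq> UNIV"
    and jets_open: "\<And>r::nat. open_map (DAinf ev) (product_topology (\<lambda>_. euclidean) {0..r})
           (\<lambda>h. \<lambda>i\<in>{0..r}. l ((opA ev ^^ i) h))"
begin

abbreviation "\<sigma> \<equiv> vol l \<phi>"
abbreviation "\<mu> \<equiv> drift ev d l \<phi>"

lemma l_add: "l (x + y) = l x + l y" using linear_add[OF bounded_linear.linear[OF l]] .
lemma l_diff: "l (x - y) = l x - l y" using linear_diff[OF bounded_linear.linear[OF l]] .
lemma l_scale: "l (r *\<^sub>R x) = r *\<^sub>R l x" using linear_scale[OF bounded_linear.linear[OF l]] .
lemma l_sum: "l (\<Sum>i\<in>I. f i) = (\<Sum>i\<in>I. l (f i))" using linear_sum[OF bounded_linear.linear[OF l]] .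
lemma l_zero: "l 0 = 0" using linear_0[OF bounded_linear.linear[OF l]] .

lemma vol_mem: "j \<in> {1..d} \<Longrightarrow> \<sigma> j h \<in> E0"
  using \<phi>[of j] unfolding smooth_map_def topspace_DA0inf vol_def by auto

lemma vol_curve:
  assumes "j \<in> {1..d}" "\<And>m. smth (\<lambda>t. (A ^^ m) (c t))"
  shows "smooth_curve (DA0inf ev H0) (\<lambda>t. \<sigma> j (c t))"
proof -
  have "smth (\<lambda>t. l (c t))" using smth_bounded_linear[OF l assms(2)[of 0]] by simp
  then have "smooth_curve euclidean (\<lambda>t. l (c t))" by (rule smooth_curve_euclidean)
  then show ?thesis using \<phi>[OF assms(1)] unfolding smooth_map_def vol_def by (auto simp: o_def)
qed

lemma smooth_map_vol:
  assumes j: "j \<in> {1..d}"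
  shows "smooth_map X X (\<sigma> j)"
proof (rule smooth_map_X_I)
  show "\<sigma> j h \<in> E" for h using vol_mem[OF j] E0_subset by blast
  show "smth (\<lambda>t. (A ^^ m) (\<sigma> j (c t)))" if "\<And>m. smth (\<lambda>t. (A ^^ m) (c t))" for c m
    using vol_curve[OF j that] unfolding smooth_curve_DA0inf_iff by blast
qed

lemma smooth_map_drift: "smooth_map X X \<mu>"
proof -
  have "smooth_map X X (\<lambda>h. hjm_S ev (\<sigma> j h) (\<sigma> j h))" if j: "j \<in> {1..d}" for j
    by (rule smooth_map_X_I) (use hjm_S_mem vol_mem[OF j] smth_hjm_S vol_curve[OF j] in blast)+
  then show ?thesis
    unfolding drift_def[abs_def] DAinf_eq
    by (intro smooth_map_add smooth_map_diff smooth_map_scale smooth_map_sum smooth_map_A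
        smooth_map_dir_deriv smooth_map_vol) auto
qed

abbreviation "brackets \<equiv> iterated_brackets X (insert \<mu> (\<sigma> ` {1..d}))"

lemma smooth_map_brackets: "V \<in> brackets \<Longrightarrow> smooth_map X X V"
  by (induction rule: iterated_brackets.induct)
    (auto intro: smooth_map_drift smooth_map_vol smooth_map_lie_bracket)

section \<open>Jets, translations and brackets\<close>

definition K :: "nat \<Rightarrow> 'h set" where
  "K n = {u \<in> E. \<forall>i<n. l ((A ^^ i) u) = 0}"

lemma K_mem: "u \<in> K n \<Longrightarrow> u \<in> E" by (simp add: K_def)
lemma K_0: "K 0 = E" by (simp add: K_def)
lemma K_antimono: "m \<le> n \<Longrightarrow> K n \<subseteq> K m" by (auto simp: K_def)
lemma K_scale: "u \<in> K n \<Longrightarrow> r *\<^sub>R u \<in> K n" by (auto simp: K_def pow_scale l_scale mem_intros)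
lemma K_A:
  assumes "u \<in> K (Suc n)"
  shows "A u \<in> K n"
  unfolding K_def
proof (intro CollectI conjI allI impI)
  show "A u \<in> E" by (rule A_mem[OF K_mem[OF assms]])
  fix i assume "i < n"
  then have "l ((A ^^ Suc i) u) = 0" using assms unfolding K_def by blast
  then show "l ((A ^^ i) (A u)) = 0" by (simp only: funpow_Suc_right o_def)
qed

definition jet :: "nat \<Rightarrow> ('h \<Rightarrow> 'h) \<Rightarrow> bool" where
  "jet n V \<longleftrightarrow> (\<forall>h\<in>E. \<forall>u\<in>K n. V (h + u) = V h)"

lemma jetD: "jet n V \<Longrightarrow> h \<in> E \<Longrightarrow> u \<in> K n \<Longrightarrow> V (h + u) = V h"
  by (simp add: jet_def)

lemma jet_mono: "jet m V \<Longrightarrow> m \<le> n \<Longrightarrow> jet n V"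
  using K_antimono unfolding jet_def by blast

lemma jet_vol: "jet 1 (\<sigma> j)"
  by (simp add: jet_def K_def vol_def l_add)

lemma dir_deriv_translate:
  assumes "\<And>s. f (h + u + s *\<^sub>R v) - f (h + u) = f (h + s *\<^sub>R v) - f h"
  shows "dir_deriv X f (h + u) v = dir_deriv X f h v"
  unfolding dir_deriv_def assms ..

lemma dir_deriv_jet:
  assumes V: "jet n V" and h: "h \<in> E" and u: "u \<in> K n" and v: "v \<in> E"
  shows "dir_deriv X V (h + u) v = dir_deriv X V h v"
proof (rule dir_deriv_translate)
  fix s
  have "V (h + u + s *\<^sub>R v) = V (h + s *\<^sub>R v + u)" by (simp add: algebra_simps)
  also have "\<dots> = V (h + s *\<^sub>R v)" using h v by (intro jetD[OF V _ u] mem_intros)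
  finally show "V (h + u + s *\<^sub>R v) - V (h + u) = V (h + s *\<^sub>R v) - V h"
    using jetD[OF V h u] by simp
qed

text \<open>All summands except \<open>A h\<close> depend on \<open>h\<close> through
  \<open>l h\<close>. This includes the correction term, since its difference quotients at
  \<open>h + u\<close> and at \<open>h\<close> coincide.\<close>

lemma drift_translate:
  assumes h: "h \<in> E" and u: "u \<in> K 1"
  shows "\<mu> (h + u) = \<mu> h + A u"
proof -
  have "dir_deriv X (\<sigma> j) (h + u) (\<sigma> j (h + u)) = dir_deriv X (\<sigma> j) h (\<sigma> j h)" if "j \<in> {1..d}" for j
    using dir_deriv_jet[OF jet_vol h u, of "\<sigma> j h" j] vol_mem[OF that] E0_subset jetD[OF jet_vol h u] by auto
  then show ?thesis
    using A_add[OF h K_mem[OF u]] by (simp add: drift_def DAinf_eq jetD[OF jet_vol h u])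
qed

lemma dir_deriv_drift_translate:
  assumes h: "h \<in> E" and u: "u \<in> K 1" and v: "v \<in> E"
  shows "dir_deriv X \<mu> (h + u) v = dir_deriv X \<mu> h v"
proof (rule dir_deriv_translate)
  fix s
  have "\<mu> (h + u + s *\<^sub>R v) = \<mu> (h + s *\<^sub>R v + u)" by (simp add: algebra_simps)
  also have "\<dots> = \<mu> (h + s *\<^sub>R v) + A u" using h v by (intro drift_translate u mem_intros)
  finally show "\<mu> (h + u + s *\<^sub>R v) - \<mu> (h + u) = \<mu> (h + s *\<^sub>R v) - \<mu> h"
    by (simp add: drift_translate[OF h u])
qed

lemma drift_mem: "h \<in> E \<Longrightarrow> \<mu> h \<in> E"
  by (rule smooth_map_X_D(1)[OF smooth_map_drift])

lemma brackets_mem: "V \<in> brackets \<Longrightarrow> h \<in> E \<Longrightarrow> V h \<in> E"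
  by (rule smooth_map_X_D(1)[OF smooth_map_brackets[of V]])

text \<open>Translation by \<open>u\<close> adds the term \<open>DV(h)(A u)\<close>. It vanishes if
  \<open>A u\<close> is in \<open>K n\<close>, where \<open>V\<close> is constant; since
  \<open>A\<close> shifts jets by one, this costs one more jet of \<open>u\<close>.\<close>

lemma jet_bracket_drift:
  assumes V: "V \<in> brackets" "jet n V"
  shows "jet (Suc n) (lie_bracket X \<mu> V)"
  unfolding jet_def
proof (intro ballI)
  fix h u assume h: "h \<in> E" and u: "u \<in> K (Suc n)"
  have u1: "u \<in> K 1" and un: "u \<in> K n" using u K_antimono[of 1 "Suc n"] K_antimono[of n "Suc n"] by auto
  have Vh: "V (h + u) = V h" "V h \<in> E" using jetD[OF V(2) h un] brackets_mem[OF V(1) h] by auto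
  have "dir_deriv X V (h + u) (\<mu> (h + u)) = dir_deriv X V h (\<mu> h + A u)"
    unfolding drift_translate[OF h u1]
    by (rule dir_deriv_jet[OF V(2) h un]) (intro mem_intros drift_mem h K_mem[OF u])
  also have "\<dots> = dir_deriv X V h (\<mu> h) + dir_deriv X V h (A u)"
    by (rule dir_deriv_add[OF smooth_map_brackets[OF V(1)] h]) (intro mem_intros drift_mem h K_mem[OF u])+
  also have "dir_deriv X V h (A u) = dir_deriv X V h 0"
  proof -
    have "V (h + s *\<^sub>R A u) = V (h + s *\<^sub>R 0)" for s
      using jetD[OF V(2) h K_scale[OF K_A[OF u]]] by simp
    then show ?thesis unfolding dir_deriv_def by simp
  qed
  also have "\<dots> = 0"
    using dir_deriv_scale[OF smooth_map_brackets[OF V(1)] h zero_mem, of 0] by simp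
  finally show "lie_bracket X \<mu> V (h + u) = lie_bracket X \<mu> V h"
    using Vh dir_deriv_drift_translate[OF h u1 Vh(2)] by (simp add: lie_bracket_def)
qed

lemma lie_bracket_swap: "lie_bracket X V W = (\<lambda>h. - lie_bracket X W V h)"
  by (simp add: lie_bracket_def)

text \<open>A bracket with the drift uses one more jet, a bracket of two jet fields uses the larger
  number, and the drift bracketed with itself vanishes, so the drift cannot reappear.\<close>

lemma brackets_cases:
  assumes "V \<in> brackets"
  shows "V = \<mu> \<or> (\<exists>n. jet n V)"
  using assms
proof (induction rule: iterated_brackets.induct)
  case (generator V)
  then show ?case using jet_vol by auto
next
  case (bracket V W)
  consider "V = \<mu>" "W = \<mu>" | n where "V = \<mu>" "jet n W" | n where "jet n V" "W = \<mu>"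
    | m n where "jet m V" "jet n W" using bracket.IH by blast
  then show ?case
  proof cases
    case 1
    then have "jet 0 (lie_bracket X V W)" by (simp add: jet_def lie_bracket_def)
    then show ?thesis by blast
  next
    case 2
    then show ?thesis using jet_bracket_drift bracket.hyps by blast
  next
    case 3
    then have "jet (Suc n) (lie_bracket X W V)" using jet_bracket_drift bracket.hyps by blast
    then have "jet (Suc n) (lie_bracket X V W)" unfolding lie_bracket_swap[of V W] by (simp add: jet_def)
    then show ?thesis by blast
  next
    case 4
    define k where "k = max m n"
    have k: "jet k V" "jet k W" using 4 jet_mono by (auto simp: k_def)
    have "jet k (lie_bracket X V W)"
      unfolding jet_def
    proof (intro ballI)
      fix h u assume h: "h \<in> E" and u: "u \<in> K k"
      show "lie_bracket X V W (h + u) = lie_bracket X V W h"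
        unfolding lie_bracket_def jetD[OF k(1) h u] jetD[OF k(2) h u]
          dir_deriv_jet[OF k(1) h u brackets_mem[OF bracket.hyps(2) h]]
          dir_deriv_jet[OF k(2) h u brackets_mem[OF bracket.hyps(1) h]] ..
    qed
    then show ?thesis by blast
  qed
qed

section \<open>Splitting the drift off the distribution\<close>

definition jet_brackets :: "('h \<Rightarrow> 'h) set" where
  "jet_brackets = {V \<in> brackets. \<exists>n. jet n V}"

definition W :: "'h \<Rightarrow> 'h set" where
  "W h = span ((\<lambda>V. V h) ` jet_brackets)"

lemma brackets_eq: "brackets = insert \<mu> jet_brackets"
  using brackets_cases iterated_brackets.generator[of \<mu> "insert \<mu> (\<sigma> ` {1..d})" X]
  unfolding jet_brackets_def by auto

lemma D_LA_eq: "D_LA ev d l \<phi> h = span (insert (\<mu> h) ((\<lambda>V. V h) ` jet_brackets))"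
  unfolding D_LA_def DAinf_eq brackets_eq by simp

lemma W_subset_D_LA: "W h \<subseteq> D_LA ev d l \<phi> h"
  unfolding W_def D_LA_eq by (rule span_mono) auto

lemma vol_in_W:
  assumes "j \<in> {1..d}"
  shows "\<sigma> j h \<in> W h"
proof -
  have "\<sigma> j \<in> brackets" using assms by (intro iterated_brackets.generator) blast
  then have "\<sigma> j \<in> jet_brackets" using jet_vol unfolding jet_brackets_def by blast
  then show ?thesis unfolding W_def by (intro span_base) (rule imageI)
qed

lemma bracket_drift_in_W:
  assumes "V \<in> jet_brackets"
  shows "dir_deriv X \<mu> h (V h) - dir_deriv X V h (\<mu> h) \<in> W h"
proof -
  have "\<mu> \<in> brackets" by (rule iterated_brackets.generator) simp
  then have "lie_bracket X \<mu> V \<in> jet_brackets"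
    using assms jet_bracket_drift unfolding jet_brackets_def by (auto intro: iterated_brackets.bracket)
  then have "lie_bracket X \<mu> V h \<in> W h" unfolding W_def by (intro span_base) auto
  then show ?thesis by (simp add: lie_bracket_def)
qed

text \<open>The image of the open map is open and contains zero, hence contains a small positive
  multiple of any prescribed jet; linearity rescales it.\<close>

lemma jets_surjective: "\<exists>h\<in>E. \<forall>i\<le>r. l ((A ^^ i) h) = w i"
proof -
  let ?f = "\<lambda>h. \<lambda>i\<in>{0..r}. l ((A ^^ i) h)"
  let ?P = "product_topology (\<lambda>_. euclidean) {0..r} :: (nat \<Rightarrow> 'b) topology"
  let ?g = "\<lambda>t::real. \<lambda>i\<in>{0..r}. t *\<^sub>R w i"
  have "openin ?P (?f ` topspace X)"
    using jets_open[of r] unfolding open_map_def DAinf_eq by blast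
  then have o: "openin ?P (?f ` E)" unfolding topspace_X .
  have "continuous_map euclidean ?P ?g"
    unfolding continuous_map_componentwise
    by (auto simp: continuous_map_iff_continuous2 intro!: continuous_intros)
  then have "open {t. ?g t \<in> ?f ` E}"
    using openin_continuous_map_preimage[OF _ o, of euclidean ?g] by simp
  moreover have "?g 0 = ?f 0" by (auto simp: pow_zero l_zero)
  then have "0 \<in> {t. ?g t \<in> ?f ` E}" using zero_mem by auto
  ultimately obtain e where e: "0 < e" "ball 0 e \<subseteq> {t. ?g t \<in> ?f ` E}"
    using open_contains_ball by blast
  have "e / 2 \<in> ball 0 e" using e(1) by simp
  with e(2) have "e / 2 \<in> {t. ?g t \<in> ?f ` E}" by (rule subsetD)
  then obtain h where h: "h \<in> E" "?g (e / 2) = ?f h" by blast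
  have "l ((A ^^ i) h) = (e / 2) *\<^sub>R w i" if "i \<le> r" for i
    using fun_cong[OF h(2), of i] that by simp
  then have "l ((A ^^ i) ((2 / e) *\<^sub>R h)) = w i" if "i \<le> r" for i
    using that e(1) h(1) by (simp add: pow_scale l_scale)
  then show ?thesis using scale_mem[OF h(1)] by blast
qed

text \<open>If \<open>B\<close> is nonzero, prescribing jets produces arbitrarily many independent vectors in \<open>A (K n)\<close>.
  If \<open>B = 0\<close>, then \<open>K n = D(A\<^sup>\<infinity>)\<close> would be finite-dimensional, as \<open>A\<close> kills only constants; being
  dense, it would be the whole space, and \<open>A\<close> would be everywhere defined.\<close>

lemma A_K_infinite_dimensional:
  assumes F: "finite F" and AK: "A ` K n \<subseteq> span F"
  shows False
proof (cases "\<exists>b::'b. b \<noteq> 0")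
  case True
  then obtain b :: 'b where b: "b \<noteq> 0" by blast
  define N where "N = Suc (card F)"
  \<comment> \<open>The only nonzero jet up to order \<open>n + N\<close> sits at position
    \<open>n + s\<close>. So \<open>u s\<close> belongs to \<open>K n\<close>, and the jet of order
    \<open>n + t - 1\<close> of \<open>A (u s)\<close> detects whether \<open>s = t\<close>.\<close>
  have "\<exists>h\<in>E. \<forall>i\<le>n + N. l ((A ^^ i) h) = (if i = n + s then b else 0)" for s
    by (rule jets_surjective)
  then obtain u where u: "\<And>s. u s \<in> E" "\<And>s i. i \<le> n + N \<Longrightarrow> l ((A ^^ i) (u s)) = (if i = n + s then b else 0)"
    by metis
  have uK: "u s \<in> K n" for s using u by (auto simp: K_def)
  have "family_independent {1..N} (\<lambda>s. A (u s))"
    unfolding family_independent_def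
  proof (intro allI impI ballI)
    fix c t assume c: "(\<Sum>s\<in>{1..N}. c s *\<^sub>R A (u s)) = 0" and t: "t \<in> {1..N}"
    obtain q where q: "n + t = Suc q" using t by (metis add_Suc_right atLeastAtMost_iff not0_implies_Suc not_one_le_zero)
    have "(A ^^ q) (A (u s)) = (A ^^ (n + t)) (u s)" for s
      unfolding q by (simp add: funpow_swap1)
    then have "l ((A ^^ q) (\<Sum>s\<in>{1..N}. c s *\<^sub>R A (u s))) = (\<Sum>s\<in>{1..N}. c s *\<^sub>R l ((A ^^ (n + t)) (u s)))"
      using u(1) by (simp add: pow_sum pow_scale mem_intros l_sum l_scale)
    also have "\<dots> = (\<Sum>s\<in>{1..N}. if s = t then c s *\<^sub>R b else 0)"
      using t by (intro sum.cong) (auto simp: u(2))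
    also have "\<dots> = c t *\<^sub>R b" using t by simp
    finally have "c t *\<^sub>R b = 0" unfolding c by (simp add: pow_zero l_zero)
    then show "c t = 0" using b by simp
  qed
  then have i: "inj_on (\<lambda>s. A (u s)) {1..N}" "independent ((\<lambda>s. A (u s)) ` {1..N})"
    by (simp_all add: family_independent_iff)
  have "(\<lambda>s. A (u s)) ` {1..N} \<subseteq> span F" using AK uK by auto
  from independent_span_bound[OF F i(2) this] have "N \<le> card F" unfolding card_image[OF i(1)] by simp
  then show False by (simp add: N_def)
next
  case False
  then have "K n = E" by (auto simp: K_def)
  then have AE: "A ` E \<subseteq> span F" using AK by simp
  obtain C where C: "C \<subseteq> A ` E" "independent C" "finite C" "span C = span (A ` E)"
    using finite_dim_subset_basis[OF F AE] by metis
  have "\<forall>x\<in>C. \<exists>y. y \<in> E \<and> A y = x" using C(1) by blast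
  then obtain g where g: "\<And>x. x \<in> C \<Longrightarrow> g x \<in> E \<and> A (g x) = x" by metis
  have const: "ev k x = ev k 0" if "k \<in> E" "A k = 0" "x \<ge> 0" for k x
  proof (rule has_field_derivative_zero_constant[of "{0..}" "ev k", THEN exE])
    show "(ev k has_field_derivative 0) (at y within {0..})" if "y \<in> {0..}" for y
      using generator_deriv[of k y] \<open>k \<in> E\<close> E_iff[of k] \<open>A k = 0\<close> ev_zero[of y] that by (metis atLeast_iff funpow_0)
    show "ev k x = ev k 0" if "\<forall>x\<in>{0..}. ev k x = c" for c using that \<open>x \<ge> 0\<close> by simp
  qed simp
  have "\<exists>k0\<in>E. \<forall>k\<in>E. A k = 0 \<longrightarrow> k \<in> span {k0}"
  proof (cases "\<exists>k0\<in>E. A k0 = 0 \<and> k0 \<noteq> 0")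
    case True
    then obtain k0 where k0: "k0 \<in> E" "A k0 = 0" "k0 \<noteq> 0" by blast
    have nz: "ev k0 0 \<noteq> 0"
    proof
      assume "ev k0 0 = 0"
      have z: "ev k0 x = ev 0 x" if "x \<ge> 0" for x
        using const[OF k0(1,2) that] \<open>ev k0 0 = 0\<close> ev_zero[OF that] by linarith
      have "k0 = 0" by (rule ev_inject) (use z in blast)
      with k0 show False by simp
    qed
    have "k \<in> span {k0}" if "k \<in> E" "A k = 0" for k
    proof -
      have "k = (ev k 0 / ev k0 0) *\<^sub>R k0"
      proof (intro ev_inject allI impI)
        fix x :: real assume x: "x \<ge> 0"
        show "ev k x = ev ((ev k 0 / ev k0 0) *\<^sub>R k0) x"
          unfolding ev_scale[OF x] const[OF that x] const[OF k0(1,2) x] using nz by simp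
      qed
      then show ?thesis by (metis span_base span_scale singletonI)
    qed
    with k0 show ?thesis by blast
  next
    case False
    then show ?thesis using zero_mem by (intro bexI[of _ 0]) (auto simp: span_zero)
  qed
  then obtain k0 where k0: "k0 \<in> E" "\<And>k. k \<in> E \<Longrightarrow> A k = 0 \<Longrightarrow> k \<in> span {k0}" by blast
  have "h \<in> span (insert k0 (g ` C))" if h: "h \<in> E" for h
  proof -
    have "A h \<in> span C" unfolding C(4) using h by (intro span_base) auto
    then obtain a where a: "A h = (\<Sum>x\<in>C. a x *\<^sub>R x)" using span_family[OF C(3), of "\<lambda>x. x"] by auto
    define s where "s = (\<Sum>x\<in>C. a x *\<^sub>R g x)"
    have "s \<in> E" unfolding s_def using g by (auto intro!: mem_intros)
    have "A s = (\<Sum>x\<in>C. a x *\<^sub>R x)"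
      using pow_sum[of C "\<lambda>x. a x *\<^sub>R g x" 1] g by (simp add: s_def A_scale mem_intros)
    then have "A (h - s) = 0" using pow_diff[OF h \<open>s \<in> E\<close>, of 1] a by simp
    then have "h - s \<in> span {k0}" using h \<open>s \<in> E\<close> by (intro k0(2) mem_intros)
    then have "h - s \<in> span (insert k0 (g ` C))" by (rule subsetD[OF span_mono, rotated]) auto
    moreover have "s \<in> span (insert k0 (g ` C))"
      unfolding s_def by (intro span_sum span_scale span_base) auto
    ultimately show ?thesis using span_add by fastforce
  qed
  then have Esub: "E \<subseteq> span (insert k0 (g ` C))" by blast
  obtain B where B: "B \<subseteq> E" "finite B" "span B = span E"
    using finite_dim_subset_basis[OF _ Esub] C(3) by (metis finite_imageI finite_insert)
  have "span E = E" using subspace_E by (simp add: span_eq_iff)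
  then have "closed E" using closed_span_finite[OF B(2)] B(3) by metis
  then have "E = UNIV" using E_dense by (simp add: closure_closed)
  then have "domA ev = UNIV" using E_iff by (metis UNIV_I UNIV_eq_I funpow_0)
  then show False using unbounded by simp
qed

lemma openin_line:
  assumes "openin X U" "h \<in> U" "v \<in> E"
  shows "\<exists>e>0. \<forall>t. \<bar>t\<bar> \<le> e \<longrightarrow> h + t *\<^sub>R v \<in> U"
proof -
  have h: "h \<in> E" using openin_subset[OF assms(1)] assms(2) topspace_X by blast
  obtain n e where e: "0 < e" "{y \<in> E. p n (y - h) < e} \<subseteq> U"
    using openin_X_contains_ball[OF assms(1,2)] by blast
  define r where "r = e / (p n v + 1)"
  have r: "0 < r" "r * p n v < e"
    using e(1) p_nonneg[of n v] by (auto simp: r_def field_simps add_nonneg_pos)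
  have "h + t *\<^sub>R v \<in> U" if "\<bar>t\<bar> \<le> r" for t
  proof -
    have "p n (t *\<^sub>R v) = \<bar>t\<bar> * p n v" by (rule p_scale[OF assms(3)])
    also have "\<dots> \<le> r * p n v" by (intro mult_right_mono that p_nonneg)
    finally have "p n (h + t *\<^sub>R v - h) < e" using r(2) by simp
    then show ?thesis using e(2) h assms(3) by (auto intro!: mem_intros)
  qed
  with r(1) show ?thesis by blast
qed

lemma drift_transversal:
  assumes N: "openin X N" "h \<in> N"
    and dim: "\<And>h. h \<in> N \<Longrightarrow> (\<exists>b. finite b \<and> D_LA ev d l \<phi> h = span b) \<and> dim (D_LA ev d l \<phi> h) = k"
  shows "\<mu> h \<notin> W h"
proof
  assume \<mu>W: "\<mu> h \<in> W h"
  let ?D = "D_LA ev d l \<phi>" and ?S = "(\<lambda>V. V h) ` jet_brackets"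
  have hE: "h \<in> E" using openin_subset[OF N(1)] N(2) topspace_X by blast
  have DW: "?D h = W h"
    using \<mu>W unfolding D_LA_eq W_def by (simp add: span_redundant)
  obtain b where b: "finite b" "?D h = span b" using dim[OF N(2)] by blast
  have "?S \<subseteq> span b" unfolding b(2)[symmetric] DW W_def by (rule span_superset)
  from finite_dim_subset_basis[OF b(1) this] obtain B where B: "B \<subseteq> ?S" "independent B" "finite B"
      "span B = W h" "card B = dim ?S" unfolding W_def by metis
  have cardB: "card B = k" using dim[OF N(2)] DW B(5) by (simp add: W_def)
  have "\<forall>x\<in>B. \<exists>V n. V \<in> jet_brackets \<and> V h = x \<and> jet n V"
    using B(1) unfolding jet_brackets_def by blast
  then obtain V n where V: "\<And>x. x \<in> B \<Longrightarrow> V x \<in> jet_brackets" "\<And>x. x \<in> B \<Longrightarrow> V x h = x" "\<And>x. x \<in> B \<Longrightarrow> jet (n x) (V x)"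
    by metis
  define r where "r = Suc (\<Sum>x\<in>B. n x)"
  have r: "jet r (V x)" if "x \<in> B" for x
  proof -
    have "n x \<le> (\<Sum>x\<in>B. n x)" using B(3) that by (intro member_le_sum) auto
    then show ?thesis using jet_mono[OF V(3)[OF that], of r] by (simp add: r_def)
  qed
  have "A u \<in> span B" if u: "u \<in> K r" for u
  proof -
    have uE: "u \<in> E" and u1: "u \<in> K 1" using u K_antimono[of 1 r] K_mem by (auto simp: r_def)
    obtain e where e: "0 < e" "\<And>t. \<bar>t\<bar> \<le> e \<Longrightarrow> h + t *\<^sub>R u \<in> N"
      using openin_line[OF N uE] by blast
    let ?h = "h + e *\<^sub>R u"
    have "?h \<in> N" using e by simp
    then obtain b' where b': "finite b'" "?D ?h = span b'" and k: "dim (?D ?h) = k" using dim by blast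
    obtain T where T: "T \<subseteq> ?D ?h" "finite T" "span T = span (?D ?h)" "card T = dim (?D ?h)"
      using finite_dim_subset_basis[OF b'(1), of "?D ?h"] b'(2) by (metis order_refl)
    have spT: "span T = ?D ?h" unfolding T(3) b'(2) by simp
    \<comment> \<open>The basis vectors of \<open>W h\<close> are values of jet fields, unchanged by
      the translation, so they also lie in the distribution at \<open>?h\<close>. Its dimension is
      again \<open>k\<close>, which forces the two spaces to coincide.\<close>
    have "x \<in> span T" if "x \<in> B" for x
    proof -
      have "V x ?h = x" using jetD[OF r[OF that] hE K_scale[OF u]] V(2)[OF that] by simp
      moreover have "V x ?h \<in> W ?h" unfolding W_def using V(1)[OF that] by (intro span_base) auto
      ultimately show ?thesis unfolding spT using W_subset_D_LA by fastforce
    qed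
    then have "span B = span T"
      using T(2,4) B(2) k cardB by (intro span_eq_of_card) auto
    moreover have "\<mu> ?h \<in> ?D ?h" unfolding D_LA_eq by (intro span_base) simp
    ultimately have "\<mu> h + A (e *\<^sub>R u) \<in> span B"
      using drift_translate[OF hE K_scale[OF u1]] spT by simp
    moreover have "\<mu> h \<in> span B" using \<mu>W B(4) by simp
    ultimately have "A (e *\<^sub>R u) \<in> span B" using span_diff by fastforce
    then have "(1 / e) *\<^sub>R A (e *\<^sub>R u) \<in> span B" by (rule span_scale)
    then show ?thesis using A_scale[OF uE] e(1) by simp
  qed
  then show False using A_K_infinite_dimensional[OF B(3), of r] by blast
qed

section \<open>Frames of \<open>W\<close> and their propagation\<close>

lemma dir_deriv_sum:
  assumes f: "smooth_map X X f" and x: "x \<in> E" and v: "\<And>i. i \<in> I \<Longrightarrow> v i \<in> E"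
  shows "dir_deriv X f x (\<Sum>i\<in>I. c i *\<^sub>R v i) = (\<Sum>i\<in>I. c i *\<^sub>R dir_deriv X f x (v i))"
proof -
  have z: "dir_deriv X f x 0 = 0" using dir_deriv_scale[OF f x zero_mem, of 0] by simp
  show ?thesis using v
    by (induction I rule: infinite_finite_induct)
      (simp_all add: z dir_deriv_add[OF f x] dir_deriv_scale[OF f x] mem_intros)
qed

lemma W_basis:
  assumes N: "openin X N" "h \<in> N"
    and dim: "\<And>h. h \<in> N \<Longrightarrow> (\<exists>b. finite b \<and> D_LA ev d l \<phi> h = span b) \<and> dim (D_LA ev d l \<phi> h) = k"
  obtains B where "B \<subseteq> (\<lambda>V. V h) ` jet_brackets" "independent B" "finite B" "span B = W h" "card B = k - 1"
proof -
  let ?D = "D_LA ev d l \<phi>" and ?S = "(\<lambda>V. V h) ` jet_brackets"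
  obtain b where b: "finite b" "?D h = span b" using dim[OF N(2)] by blast
  have "?S \<subseteq> span b" unfolding b(2)[symmetric] by (rule order.trans[OF span_superset W_subset_D_LA[unfolded W_def]])
  from finite_dim_subset_basis[OF b(1) this] obtain B where B: "B \<subseteq> ?S" "independent B" "finite B"
      "span B = W h" unfolding W_def by metis
  have nin: "\<mu> h \<notin> span B" unfolding B(4) by (rule drift_transversal[OF N dim])
  have "?D h = span (insert (\<mu> h) B)"
    unfolding D_LA_eq span_insert B(4) W_def[symmetric] ..
  then have "dim (?D h) = card (insert (\<mu> h) B)"
    using independent_insertI[OF nin B(2)] by (metis dim_span dim_eq_card_independent)
  moreover have "\<mu> h \<notin> B" using nin span_base by blast
  ultimately have "k = Suc (card B)" using dim[OF N(2)] B(3) by simp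
  then show ?thesis using that B by simp
qed

text \<open>The vector \<open>u\<close> carries the \<open>n\<close>-th jet of \<open>v\<close> at
  position \<open>n + 1\<close> and no jets below. Then \<open>A u\<close> carries it at position
  \<open>n\<close>, and subtracting \<open>A u\<close> removes the only jet that keeps
  \<open>v\<close> out of \<open>K (Suc n)\<close>.\<close>

lemma jet_decomposition:
  assumes "v \<in> K n"
  obtains u u' where "u \<in> K (Suc n)" "u' \<in> K (Suc n)" "v = A u + u'"
proof -
  obtain u where u: "u \<in> E" "\<And>i. i \<le> Suc n \<Longrightarrow> l ((A ^^ i) u) = (if i = Suc n then l ((A ^^ n) v) else 0)"
    using jets_surjective[of "Suc n" "\<lambda>i. if i = Suc n then l ((A ^^ n) v) else 0"] by blast
  have vE: "v \<in> E" by (rule K_mem[OF assms])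
  have "u \<in> K (Suc n)" using u by (auto simp: K_def)
  moreover have "v - A u \<in> K (Suc n)"
    unfolding K_def
  proof (intro CollectI conjI allI impI)
    show "v - A u \<in> E" by (intro mem_intros vE u)
    fix i assume i: "i < Suc n"
    have "(A ^^ i) (v - A u) = (A ^^ i) v - (A ^^ Suc i) u"
      using pow_diff[OF vE A_mem[OF u(1)], of i] by (simp add: funpow_swap1)
    then have "l ((A ^^ i) (v - A u)) = l ((A ^^ i) v) - (if i = n then l ((A ^^ n) v) else 0)"
      using u(2)[of "Suc i"] i by (simp add: l_diff del: funpow.simps)
    then show "l ((A ^^ i) (v - A u)) = 0" using assms i by (auto simp: K_def less_Suc_eq)
  qed
  ultimately show ?thesis using that[of u "v - A u"] by simp
qed

text \<open>Near \<open>h0\<close>, the space \<open>W\<close> is spanned by a frame that depends on finitely many jets only.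
  Descending on the number of jets, let \<open>W\<close> be invariant under translations by \<open>K (n + 1)\<close>. Comparing \<open>[\<mu>, V] \<in> W\<close> at \<open>h\<close> and \<open>h + u\<close> for \<open>u\<close> in \<open>K (n + 1)\<close>,
  where \<open>\<mu> (h + u) = \<mu> h + A u\<close>, shows that the derivatives of the frame along \<open>A u\<close> lie in \<open>W\<close>.
  As \<open>K n = K (n + 1) + A (K (n + 1))\<close>, integration gives invariance under \<open>K n\<close>, and finally
  under \<open>K 0 = D(A\<^sup>\<infinity>)\<close>.\<close>

lemma W_locally_constant:
  assumes N0: "openin X N0" "h0 \<in> N0"
    and dim: "\<And>h. h \<in> N0 \<Longrightarrow> (\<exists>b. finite b \<and> D_LA ev d l \<phi> h = span b) \<and> dim (D_LA ev d l \<phi> h) = k"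
  shows "\<exists>N \<Lambda>. openin X N \<and> h0 \<in> N \<and> N \<subseteq> N0 \<and> (\<forall>i\<in>{1..k - 1}. \<Lambda> i \<in> E) \<and>
    family_independent {1..k - 1} \<Lambda> \<and> (\<forall>h\<in>N. W h = span (\<Lambda> ` {1..k - 1}))"
proof -
  define I where "I = {1..k - 1}"
  have finI: "finite I" and cardI: "card I = k - 1" by (auto simp: I_def)
  have h0E: "h0 \<in> E" using openin_subset[OF N0(1)] N0(2) topspace_X by blast
  obtain B where B: "B \<subseteq> (\<lambda>V. V h0) ` jet_brackets" "independent B" "finite B" "span B = W h0" "card B = k - 1"
    using W_basis[OF N0 dim] by metis
  obtain \<Lambda> where \<Lambda>: "bij_betw \<Lambda> I B"
    using ex_bij_betw_nat_finite_1[OF B(3)] unfolding B(5) I_def by blast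
  have img: "\<Lambda> ` I = B" using \<Lambda> by (simp add: bij_betw_def)
  have indep: "family_independent I \<Lambda>"
    unfolding family_independent_iff[OF finI] img using \<Lambda> B(2) by (simp add: bij_betw_def)
  have "\<forall>i\<in>I. \<exists>V n. V \<in> jet_brackets \<and> V h0 = \<Lambda> i \<and> jet n V"
  proof
    fix i assume "i \<in> I"
    then have "\<Lambda> i \<in> (\<lambda>V. V h0) ` jet_brackets" using B(1) img by blast
    then obtain V where "V \<in> jet_brackets" "\<Lambda> i = V h0" by auto
    moreover from this(1) obtain n where "jet n V" unfolding jet_brackets_def by blast
    ultimately show "\<exists>V n. V \<in> jet_brackets \<and> V h0 = \<Lambda> i \<and> jet n V" by metis
  qed
  then obtain V n where V: "\<And>i. i \<in> I \<Longrightarrow> V i \<in> jet_brackets" "\<And>i. i \<in> I \<Longrightarrow> V i h0 = \<Lambda> i" "\<And>i. i \<in> I \<Longrightarrow> jet (n i) (V i)"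
    by metis
  have Vb: "V i \<in> brackets" if "i \<in> I" for i using V(1)[OF that] by (simp add: jet_brackets_def)
  have Vsm: "smooth_map X X (V i)" if "i \<in> I" for i by (rule smooth_map_brackets[OF Vb[OF that]])
  have VE: "V i h \<in> E" if "i \<in> I" "h \<in> E" for i h by (rule brackets_mem[OF Vb[OF that(1)] that(2)])
  have VW: "V i h \<in> W h" if "i \<in> I" for i h
    unfolding W_def by (rule span_base, rule imageI, rule V(1)[OF that])
  define r where "r = (\<Sum>i\<in>I. n i)"
  have r: "jet r (V i)" if "i \<in> I" for i
  proof -
    have "n i \<le> r" unfolding r_def using finI that by (intro member_le_sum) auto
    then show ?thesis using jet_mono[OF V(3)[OF that]] by blast
  qed
  obtain \<delta> Q where \<delta>: "0 < \<delta>" and Q: "\<And>v' c. (\<And>i. i \<in> I \<Longrightarrow> norm (v' i - \<Lambda> i) < \<delta>) \<Longrightarrow>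
      (\<Sum>i\<in>I. \<bar>c i\<bar>) \<le> Q * norm (\<Sum>i\<in>I. c i *\<^sub>R v' i)"
    using family_independent_perturbation[OF finI indep] by metis
  have "\<exists>n e. 0 < e \<and> (\<forall>y\<in>E. p n (y - h0) < e \<longrightarrow> (\<forall>i\<in>J. norm (V i y - V i h0) < \<delta>))"
    if "finite J" "J \<subseteq> I" for J
    using that
  proof (induction J rule: finite_induct)
    case empty
    show ?case by (intro exI[of _ "0::nat"] exI[of _ "1::real"]) auto
  next
    case (insert j J)
    then obtain n e where 1: "0 < e" "\<And>y i. y \<in> E \<Longrightarrow> p n (y - h0) < e \<Longrightarrow> i \<in> J \<Longrightarrow> norm (V i y - V i h0) < \<delta>"
      by blast
    obtain n' e' where 2: "0 < e'" "\<And>y. y \<in> E \<Longrightarrow> p n' (y - h0) < e' \<Longrightarrow> norm (V j y - V j h0) < \<delta>"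
      using smooth_map_continuous[OF Vsm h0E \<delta>, of j] insert.prems by blast
    have "norm (V i y - V i h0) < \<delta>" if "y \<in> E" "p (max n n') (y - h0) < min e e'" "i \<in> insert j J" for y i
    proof -
      have "p n (y - h0) < e" "p n' (y - h0) < e'"
        using that(2) p_mono[of n "max n n'" "y - h0"] p_mono[of n' "max n n'" "y - h0"] by auto
      then show ?thesis using 1(2) 2(2) that(1,3) by blast
    qed
    then show ?case using 1(1) 2(1) by (intro exI[of _ "max n n'"] exI[of _ "min e e'"]) auto
  qed
  from this[OF finI order_refl] obtain n1 e1 where 1: "0 < e1"
      "\<And>y i. y \<in> E \<Longrightarrow> p n1 (y - h0) < e1 \<Longrightarrow> i \<in> I \<Longrightarrow> norm (V i y - V i h0) < \<delta>" by blast
  obtain n2 e2 where 2: "0 < e2" "{y \<in> E. p n2 (y - h0) < e2} \<subseteq> N0"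
    using openin_X_contains_ball[OF N0] by blast
  \<comment> \<open>A ball of a single seminorm, because it is convex: the segment between two of
    its points must stay inside for the integration below.\<close>
  define m e where "m = max n1 n2" and "e = min e1 e2"
  define N where "N = {y \<in> E. p m (y - h0) < e}"
  have e: "0 < e" using 1 2 by (simp add: e_def)
  have small: "p n1 (y - h0) < e1" "p n2 (y - h0) < e2" if "y \<in> N" for y
    using that p_mono[of n1 m "y - h0"] p_mono[of n2 m "y - h0"] by (auto simp: N_def m_def e_def)
  have oN: "openin X N" unfolding N_def by (rule openin_ball[OF h0E e])
  have h0N: "h0 \<in> N" using h0E e p_zero by (simp add: N_def)
  have NE: "y \<in> E" if "y \<in> N" for y using that by (simp add: N_def)
  have NN0: "N \<subseteq> N0" using 2(2) small(2) NE by blast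
  have Qb: "(\<Sum>i\<in>I. \<bar>c i\<bar>) \<le> Q * norm (\<Sum>i\<in>I. c i *\<^sub>R V i y)" if "y \<in> N" for y c
    by (rule Q) (use 1(2)[OF NE[OF that] small(1)[OF that]] V(2) in simp)
  have convex: "x + t *\<^sub>R v \<in> N" if "x \<in> N" "x + v \<in> N" "v \<in> E" "t \<in> {0..1}" for x v t
  proof -
    have "x + t *\<^sub>R v - h0 = (1 - t) *\<^sub>R (x - h0) + t *\<^sub>R (x + v - h0)" by (simp add: algebra_simps)
    moreover have "p m ((1 - t) *\<^sub>R (x - h0) + t *\<^sub>R (x + v - h0)) \<le> (1 - t) * p m (x - h0) + t * p m (x + v - h0)"
      using that h0E NE[OF that(1)] p_triangle[of "(1 - t) *\<^sub>R (x - h0)" "t *\<^sub>R (x + v - h0)" m]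
      by (simp add: p_scale mem_intros)
    moreover have "(1 - t) * p m (x - h0) + t * p m (x + v - h0) < e"
      using that by (intro convex_bound_lt) (auto simp: N_def)
    ultimately show ?thesis using that NE[OF that(1)] unfolding N_def by (auto intro!: mem_intros)
  qed
  have indepN: "family_independent I (\<lambda>i. V i y)" if "y \<in> N" for y
    by (rule family_independent_of_bound[OF finI Qb[OF that]])
  then have indepN': "independent ((\<lambda>i. V i y) ` I)" "card ((\<lambda>i. V i y) ` I) = k - 1" if "y \<in> N" for y
    using that cardI unfolding family_independent_iff[OF finI] by (auto simp: card_image)
  have Wspan: "W y = span ((\<lambda>i. V i y) ` I)" if y: "y \<in> N" for y
  proof -
    obtain T where T: "finite T" "span T = W y" "card T = k - 1"
      using W_basis[OF N0(1) subsetD[OF NN0 y] dim] by metis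
    have "span ((\<lambda>i. V i y) ` I) = span T"
      using T indepN'[OF y] VW by (intro span_eq_of_card) auto
    then show ?thesis using T by simp
  qed
  have closedW: "closed (W y)" if "y \<in> N" for y
    unfolding Wspan[OF that] by (rule closed_span_finite) (use finI in auto)
  have subW: "subspace (W y)" for y unfolding W_def by (rule subspace_span)
  have invariant: "\<forall>h\<in>N. \<forall>u\<in>K 0. h + u \<in> N \<longrightarrow> W (h + u) = W h"
  proof (rule inc_induct[of 0 r])
    show "\<forall>h\<in>N. \<forall>u\<in>K r. h + u \<in> N \<longrightarrow> W (h + u) = W h"
    proof (intro ballI impI)
      fix h u assume h: "h \<in> N" "u \<in> K r" "h + u \<in> N"
      have "V i (h + u) = V i h" if "i \<in> I" for i by (rule jetD[OF r[OF that] NE[OF h(1)] h(2)])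
      then show "W (h + u) = W h" unfolding Wspan[OF h(1)] Wspan[OF h(3)] by simp
    qed
  next
    fix n assume IH: "\<forall>h\<in>N. \<forall>u\<in>K (Suc n). h + u \<in> N \<longrightarrow> W (h + u) = W h"
    \<comment> \<open>Along such directions \<open>W\<close> is constant by the induction
      hypothesis, so the difference quotients stay in one closed space.\<close>
    have along: "dir_deriv X (V i) h u \<in> W h" if i: "i \<in> I" and h: "h \<in> N" and u: "u \<in> K (Suc n)" for i h u
    proof -
      have uE: "u \<in> E" by (rule K_mem[OF u])
      obtain \<epsilon> where \<epsilon>: "0 < \<epsilon>" "\<And>t. \<bar>t\<bar> \<le> \<epsilon> \<Longrightarrow> h + t *\<^sub>R u \<in> N"
        using openin_line[OF oN h uE] by blast
      have lim: "((\<lambda>t. (V i (h + t *\<^sub>R u) - V i h) /\<^sub>R t) \<longlongrightarrow> dir_deriv X (V i) h u) (at 0)"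
        using has_vector_derivative_along_line[OF Vsm[OF i] NE[OF h] uE, of 0]
        unfolding has_vector_derivative_iff_quotient by simp
      have "(V i (h + t *\<^sub>R u) - V i h) /\<^sub>R t \<in> W h" if "\<bar>t\<bar> \<le> \<epsilon>" for t
      proof -
        have "W (h + t *\<^sub>R u) = W h" using IH h K_scale[OF u] \<epsilon>(2)[OF that] by blast
        then show ?thesis using VW[OF i, of "h + t *\<^sub>R u"] VW[OF i, of h] subW[of h]
          by (intro subspace_scale subspace_diff) auto
      qed
      then have "\<forall>\<^sub>F t in at 0. (V i (h + t *\<^sub>R u) - V i h) /\<^sub>R t \<in> W h"
        unfolding eventually_at using \<epsilon>(1) by (intro exI[of _ \<epsilon>]) auto
      then show ?thesis
        by (rule Lim_in_closed_set[OF closedW[OF h] _ _ lim]) simp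
    qed
    have along_A: "dir_deriv X (V i) h' (A u) \<in> W h'" if i: "i \<in> I" and h': "h' \<in> N" and u: "u \<in> K (Suc n)" for i h' u
    proof -
      have uE: "u \<in> E" by (rule K_mem[OF u])
      have h'E: "h' \<in> E" by (rule NE[OF h'])
      obtain \<epsilon> where \<epsilon>: "0 < \<epsilon>" "\<And>t. \<bar>t\<bar> \<le> \<epsilon> \<Longrightarrow> h' + t *\<^sub>R u \<in> N"
        using openin_line[OF oN h' uE] by blast
      \<comment> \<open>The bracket relation is compared at \<open>h\<close> and at
        \<open>h' = h + v\<close>, where \<open>W\<close> is the same space; the factor
        \<open>\<epsilon>\<close> keeps both points in \<open>N\<close>.\<close>
      define v where "v = \<epsilon> *\<^sub>R u"
      define h where "h = h' - v"
      have vK: "v \<in> K (Suc n)" unfolding v_def by (rule K_scale[OF u])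
      have v1: "v \<in> K 1" and vE: "v \<in> E" using vK K_antimono[of 1 "Suc n"] K_mem by auto
      have hN: "h \<in> N" using \<epsilon>(2)[of "- \<epsilon>"] \<epsilon>(1) by (simp add: h_def v_def)
      have hE: "h \<in> E" by (rule NE[OF hN])
      have hh': "h' = h + v" by (simp add: h_def)
      have WW: "W h' = W h" using IH hN vK h' unfolding hh' by blast
      define z where "z = V i h'"
      have zE: "z \<in> E" unfolding z_def by (rule VE[OF i h'E])
      have "z \<in> span ((\<lambda>j. V j h) ` I)" using VW[OF i, of h'] unfolding z_def WW Wspan[OF hN] .
      then obtain c where c: "z = (\<Sum>j\<in>I. c j *\<^sub>R V j h)" unfolding span_family[OF finI] by blast
      define w where "w = \<mu> h"
      have wE: "w \<in> E" unfolding w_def by (rule drift_mem[OF hE])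
      \<comment> \<open>The derivative along \<open>w\<close> of the combination of the frame with
        constant coefficients that takes the value \<open>z\<close> at \<open>h\<close>.\<close>
      define DZ where "DZ = (\<Sum>j\<in>I. c j *\<^sub>R dir_deriv X (V j) h w)"
      have b1: "dir_deriv X \<mu> h z - dir_deriv X (V i) h' (w + A v) \<in> W h'"
        using bracket_drift_in_W[OF V(1)[OF i], of h'] dir_deriv_drift_translate[OF hE v1 zE]
        unfolding w_def drift_translate[OF hE v1, symmetric] hh'[symmetric] by (simp add: z_def)
      have "dir_deriv X \<mu> h z - DZ = (\<Sum>j\<in>I. c j *\<^sub>R (dir_deriv X \<mu> h (V j h) - dir_deriv X (V j) h w))"
        unfolding c DZ_def
        by (subst dir_deriv_sum[OF smooth_map_drift hE]) (auto simp: VE hE scaleR_diff_right sum_subtractf)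
      also have "\<dots> \<in> W h"
        unfolding w_def using bracket_drift_in_W[OF V(1)] by (intro subspace_sum subspace_scale subW) auto
      finally have b2: "dir_deriv X \<mu> h z - DZ \<in> W h'" unfolding WW .
      \<comment> \<open>Along the parallel lines through \<open>h'\<close> and \<open>h\<close> the
        space \<open>W\<close> agrees at corresponding points, so the quotient of the difference of
        the two fields lies in a moving span; \<open>span_limit\<close> passes to the limit.\<close>
      have b3: "dir_deriv X (V i) h' w - DZ \<in> W h'"
        unfolding Wspan[OF h']
      proof (rule span_limit[OF finI, where F = "at (0::real)" and V = "\<lambda>t j. V j (h' + t *\<^sub>R w)" and K = Q
            and x = "\<lambda>t. (V i (h' + t *\<^sub>R w) - (\<Sum>j\<in>I. c j *\<^sub>R V j (h + t *\<^sub>R w))) /\<^sub>R t"])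
        show "((\<lambda>t. V j (h' + t *\<^sub>R w)) \<longlongrightarrow> V j h') (at 0)" if "j \<in> I" for j
          using has_vector_derivative_continuous[OF has_vector_derivative_along_line[OF Vsm[OF that] h'E wE, of 0]]
          by (simp add: isCont_def)
        have q1: "((\<lambda>t. (V i (h' + t *\<^sub>R w) - z) /\<^sub>R t) \<longlongrightarrow> dir_deriv X (V i) h' w) (at 0)"
          using has_vector_derivative_along_line[OF Vsm[OF i] h'E wE, of 0]
          unfolding has_vector_derivative_iff_quotient z_def by simp
        have q2: "((\<lambda>t. \<Sum>j\<in>I. c j *\<^sub>R ((V j (h + t *\<^sub>R w) - V j h) /\<^sub>R t)) \<longlongrightarrow> DZ) (at 0)"
          unfolding DZ_def
        proof (intro tendsto_sum tendsto_scaleR tendsto_const)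
          show "((\<lambda>t. (V j (h + t *\<^sub>R w) - V j h) /\<^sub>R t) \<longlongrightarrow> dir_deriv X (V j) h w) (at 0)" if "j \<in> I" for j
            using has_vector_derivative_along_line[OF Vsm[OF that] hE wE, of 0]
            unfolding has_vector_derivative_iff_quotient by simp
        qed
        have "(V i (h' + t *\<^sub>R w) - z) /\<^sub>R t - (\<Sum>j\<in>I. c j *\<^sub>R ((V j (h + t *\<^sub>R w) - V j h) /\<^sub>R t))
            = (V i (h' + t *\<^sub>R w) - (\<Sum>j\<in>I. c j *\<^sub>R V j (h + t *\<^sub>R w))) /\<^sub>R t" for t
        proof -
          have "(\<Sum>j\<in>I. c j *\<^sub>R ((V j (h + t *\<^sub>R w) - V j h) /\<^sub>R t))
              = ((\<Sum>j\<in>I. c j *\<^sub>R V j (h + t *\<^sub>R w)) - z) /\<^sub>R t"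
            unfolding c sum_subtractf[symmetric] scaleR_sum_right scaleR_diff_right[symmetric]
            by (simp only: scaleR_left_commute)
          then show ?thesis by (simp add: scaleR_diff_right)
        qed
        then show "((\<lambda>t. (V i (h' + t *\<^sub>R w) - (\<Sum>j\<in>I. c j *\<^sub>R V j (h + t *\<^sub>R w))) /\<^sub>R t)
            \<longlongrightarrow> dir_deriv X (V i) h' w - DZ) (at 0)"
          using tendsto_diff[OF q1 q2] by simp
        obtain \<eta>1 where \<eta>1: "0 < \<eta>1" "\<And>t. \<bar>t\<bar> \<le> \<eta>1 \<Longrightarrow> h' + t *\<^sub>R w \<in> N"
          using openin_line[OF oN h' wE] by blast
        obtain \<eta>2 where \<eta>2: "0 < \<eta>2" "\<And>t. \<bar>t\<bar> \<le> \<eta>2 \<Longrightarrow> h + t *\<^sub>R w \<in> N"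
          using openin_line[OF oN hN wE] by blast
        have ev_N: "\<forall>\<^sub>F t in at 0. h' + t *\<^sub>R w \<in> N \<and> h + t *\<^sub>R w \<in> N"
          unfolding eventually_at using \<eta>1 \<eta>2 by (intro exI[of _ "min \<eta>1 \<eta>2"]) auto
        show "\<forall>\<^sub>F t in at 0. \<forall>c. (\<Sum>j\<in>I. \<bar>c j\<bar>) \<le> Q * norm (\<Sum>j\<in>I. c j *\<^sub>R V j (h' + t *\<^sub>R w))"
          by (rule eventually_mono[OF ev_N]) (use Qb in blast)
        show "\<forall>\<^sub>F t in at 0. (V i (h' + t *\<^sub>R w) - (\<Sum>j\<in>I. c j *\<^sub>R V j (h + t *\<^sub>R w))) /\<^sub>R t
            \<in> span ((\<lambda>j. V j (h' + t *\<^sub>R w)) ` I)"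
          using ev_N
        proof eventually_elim
          case (elim t)
          have "h' + t *\<^sub>R w = (h + t *\<^sub>R w) + v" by (simp add: hh')
          then have WW': "W (h' + t *\<^sub>R w) = W (h + t *\<^sub>R w)" using IH elim vK by metis
          have "V i (h' + t *\<^sub>R w) \<in> W (h + t *\<^sub>R w)" using VW[OF i] WW' by metis
          then have "(V i (h' + t *\<^sub>R w) - (\<Sum>j\<in>I. c j *\<^sub>R V j (h + t *\<^sub>R w))) /\<^sub>R t \<in> W (h + t *\<^sub>R w)"
            by (intro subspace_scale subspace_diff subspace_sum subW VW)
          then show ?case using Wspan[of "h' + t *\<^sub>R w"] WW' elim by simp
        qed
      qed simp
      \<comment> \<open>Additivity in the direction isolates \<open>A v\<close>: the terms with the
        derivative of the drift and those with \<open>DZ\<close> cancel.\<close>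
      have "dir_deriv X (V i) h' (A v) = (dir_deriv X \<mu> h z - DZ)
          - (dir_deriv X \<mu> h z - dir_deriv X (V i) h' (w + A v)) - (dir_deriv X (V i) h' w - DZ)"
        using dir_deriv_add[OF Vsm[OF i] h'E wE A_mem[OF vE]] by simp
      also have "\<dots> \<in> W h'" by (rule subspace_diff[OF subW subspace_diff[OF subW b2 b1] b3])
      finally have "(1 / \<epsilon>) *\<^sub>R dir_deriv X (V i) h' (A v) \<in> W h'" by (intro subspace_scale subW)
      moreover have "dir_deriv X (V i) h' (A v) = \<epsilon> *\<^sub>R dir_deriv X (V i) h' (A u)"
        unfolding v_def A_scale[OF uE] by (rule dir_deriv_scale[OF Vsm[OF i] h'E A_mem[OF uE]])
      ultimately show ?thesis using \<epsilon>(1) by simp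
    qed
    have tangent: "dir_deriv X (V i) h v \<in> W h" if i: "i \<in> I" and h: "h \<in> N" and v: "v \<in> K n" for i h v
    proof -
      obtain u u' where u: "u \<in> K (Suc n)" "u' \<in> K (Suc n)" "v = A u + u'" using jet_decomposition[OF v] .
      have "dir_deriv X (V i) h v = dir_deriv X (V i) h (A u) + dir_deriv X (V i) h u'"
        unfolding u(3) by (rule dir_deriv_add[OF Vsm[OF i] NE[OF h] A_mem[OF K_mem[OF u(1)]] K_mem[OF u(2)]])
      then show ?thesis
        using along_A[OF i h u(1)] along[OF i h u(2)] by (simp add: subspace_add[OF subW])
    qed
    show "\<forall>h\<in>N. \<forall>u\<in>K n. h + u \<in> N \<longrightarrow> W (h + u) = W h"
    proof (intro ballI impI)
      fix h v assume h: "h \<in> N" and v: "v \<in> K n" and hv: "h + v \<in> N"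
      have hE: "h \<in> E" and vE: "v \<in> E" using NE[OF h] K_mem[OF v] by auto
      have seg: "h + t *\<^sub>R v \<in> N" if "t \<in> {0..1}" for t by (rule convex[OF h hv vE that])
      let ?D = "\<lambda>t i. dir_deriv X (V i) (h + t *\<^sub>R v) v"
      have "\<exists>M. \<forall>t\<in>{0..1}. norm (?D t i) \<le> M" if i: "i \<in> I" for i
      proof -
        have "smth (\<lambda>t. (A ^^ 0) (?D t i))"
          by (rule smth_dir_deriv[OF Vsm[OF i] line_smooth[OF hE vE]]) (use vE in auto)
        then have "continuous_on {0..1} (\<lambda>t. ?D t i)"
          using smth_continuous[of "\<lambda>t. ?D t i" _ 0] by simp
        then have "compact ((\<lambda>t. ?D t i) ` {0..1})" by (rule compact_continuous_image) simp
        then have "bounded ((\<lambda>t. ?D t i) ` {0..1})" by (rule compact_imp_bounded)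
        then show ?thesis unfolding bounded_iff by blast
      qed
      then obtain M where M: "\<And>i t. i \<in> I \<Longrightarrow> t \<in> {0..1} \<Longrightarrow> norm (?D t i) \<le> M i" by metis
      have Mle: "M i \<le> (\<Sum>i\<in>I. \<bar>M i\<bar>)" if "i \<in> I" for i
      proof -
        have "M i \<le> \<bar>M i\<bar>" by simp
        also have "\<dots> \<le> (\<Sum>i\<in>I. \<bar>M i\<bar>)" using finI that by (intro member_le_sum) auto
        finally show ?thesis .
      qed
      have "V i (h + v) \<in> W h" if i: "i \<in> I" for i
      proof -
        have "V i (h + 1 *\<^sub>R v) \<in> span ((\<lambda>i. V i (h + 0 *\<^sub>R v)) ` I)"
        proof (rule span_preserved_by_flow[OF finI i, where V = "\<lambda>t i. V i (h + t *\<^sub>R v)" and V' = ?D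
              and M = "\<Sum>i\<in>I. \<bar>M i\<bar>" and K = "\<bar>Q\<bar>"])
          fix t :: real and j assume t: "t \<in> {0..1}" and j: "j \<in> I"
          show "((\<lambda>t. V j (h + t *\<^sub>R v)) has_vector_derivative ?D t j) (at t)"
            by (rule has_vector_derivative_along_line[OF Vsm[OF j] hE vE])
          show "?D t j \<in> span ((\<lambda>i. V i (h + t *\<^sub>R v)) ` I)"
            using tangent[OF j seg[OF t] v] unfolding Wspan[OF seg[OF t]] .
          show "norm (?D t j) \<le> (\<Sum>i\<in>I. \<bar>M i\<bar>)" using M[OF j t] Mle[OF j] by linarith
        next
          fix t :: real and c :: "nat \<Rightarrow> real" assume t: "t \<in> {0..1}"
          have "(\<Sum>i\<in>I. \<bar>c i\<bar>) \<le> Q * norm (\<Sum>i\<in>I. c i *\<^sub>R V i (h + t *\<^sub>R v))" by (rule Qb[OF seg[OF t]])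
          also have "\<dots> \<le> \<bar>Q\<bar> * norm (\<Sum>i\<in>I. c i *\<^sub>R V i (h + t *\<^sub>R v))" by (intro mult_right_mono) auto
          finally show "(\<Sum>i\<in>I. \<bar>c i\<bar>) \<le> \<bar>Q\<bar> * norm (\<Sum>i\<in>I. c i *\<^sub>R V i (h + t *\<^sub>R v))" .
        qed simp
        then show ?thesis unfolding Wspan[OF h] by simp
      qed
      then have "span ((\<lambda>i. V i (h + v)) ` I) = span ((\<lambda>i. V i h) ` I)"
        using finI indepN'[OF hv] indepN'[OF h] unfolding Wspan[OF h] by (intro span_eq_of_card) auto
      then show "W (h + v) = W h" unfolding Wspan[OF h] Wspan[OF hv] .
    qed
  qed simp
  have "W h = span (\<Lambda> ` I)" if h: "h \<in> N" for h
  proof -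
    have hK: "h - h0 \<in> K 0" unfolding K_0 by (rule diff_mem[OF NE[OF h] h0E])
    have "h0 + (h - h0) \<in> N \<longrightarrow> W (h0 + (h - h0)) = W h0" using invariant h0N hK by blast
    then have "W h = W h0" using h by simp
    then show ?thesis using B(4) img by simp
  qed
  moreover have "\<Lambda> i \<in> E" if "i \<in> I" for i using V(2)[OF that] VE[OF that h0E] by simp
  ultimately show ?thesis using oN h0N NN0 indep unfolding I_def by blast
qed

end

theorem proposition3:
  fixes ev :: "'h::{real_inner,complete_space} \<Rightarrow> real \<Rightarrow> real"
    and H0 :: "'h set"
    and d :: nat
    and l :: "'h \<Rightarrow> 'b::banach"
    and \<phi> :: "nat \<Rightarrow> 'b \<Rightarrow> 'h"
    and U :: "'h set"
    and k\<^sub>D :: "'h \<Rightarrow> nat"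
  assumes "forward_curve_space ev H0"
    and "d \<ge> 1"
    and "bounded_linear l"
    and "\<And>j. j \<in> {1..d} \<Longrightarrow> smooth_map euclidean (DA0inf ev H0) (\<phi> j)"
    and "open_map (DAinf ev) euclidean (\<lambda>h. (l h, l (opA ev h)))"
    and "\<And>y. lin_indep_family {1..d} (\<lambda>j. \<phi> j y)"
    and "domA ev \<noteq> UNIV"
    and "openin (DAinf ev) U"
    and "\<And>h\<^sub>0. h\<^sub>0 \<in> U \<Longrightarrow> \<exists>V. openin (DAinf ev) V \<and> h\<^sub>0 \<in> V \<and> V \<subseteq> U \<and>
           (\<forall>h\<in>V. (\<exists>b. finite b \<and> D_LA ev d l \<phi> h = span b) \<and>
                   dim (D_LA ev d l \<phi> h) = k\<^sub>D h\<^sub>0)"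
    and "\<And>r::nat. open_map (DAinf ev) (product_topology (\<lambda>_. euclidean) {0..r})
           (\<lambda>h. \<lambda>i\<in>{0..r}. l ((opA ev ^^ i) h))"
  shows "\<forall>h\<^sub>0\<in>U. \<exists>V \<Lambda>. openin (DAinf ev) V \<and> h\<^sub>0 \<in> V \<and> V \<subseteq> U \<and>
           (\<forall>i\<in>{1..k\<^sub>D h\<^sub>0 - 1}. \<Lambda> i \<in> topspace (DAinf ev)) \<and>
           lin_indep_family {1..k\<^sub>D h\<^sub>0 - 1} \<Lambda> \<and>
           (\<forall>h\<in>V.
              D_LA ev d l \<phi> h = span (insert (drift ev d l \<phi> h) (\<Lambda> ` {1..k\<^sub>D h\<^sub>0 - 1})) \<and>
              (\<forall>j\<in>{1..d}. vol l \<phi> j h \<in> span (\<Lambda> ` {1..k\<^sub>D h\<^sub>0 - 1})))"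
proof
  interpret hjm_distribution ev H0 d l \<phi>
    by (intro hjm_distribution.intro hjm_distribution_axioms.intro assms)
  fix h\<^sub>0 assume "h\<^sub>0 \<in> U"
  then obtain N0 where N0: "openin X N0" "h\<^sub>0 \<in> N0" "N0 \<subseteq> U"
      and dim: "\<And>h. h \<in> N0 \<Longrightarrow> (\<exists>b. finite b \<and> D_LA ev d l \<phi> h = span b) \<and> dim (D_LA ev d l \<phi> h) = k\<^sub>D h\<^sub>0"
    using assms(9)[of h\<^sub>0] unfolding DAinf_eq by blast
  let ?I = "{1..k\<^sub>D h\<^sub>0 - 1}"
  obtain N \<Lambda> where N: "openin X N" "h\<^sub>0 \<in> N" "N \<subseteq> N0" "\<forall>i\<in>?I. \<Lambda> i \<in> E" "family_independent ?I \<Lambda>"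
      and W: "\<And>h. h \<in> N \<Longrightarrow> W h = span (\<Lambda> ` ?I)"
    using W_locally_constant[OF N0(1,2) dim] by metis
  have "lin_indep_family ?I \<Lambda>"
    using N(5) unfolding lin_indep_family_def family_independent_iff[OF finite_atLeastAtMost] .
  moreover have "D_LA ev d l \<phi> h = span (insert (\<mu> h) (\<Lambda> ` ?I))" if "h \<in> N" for h
    unfolding D_LA_eq span_insert W_def[symmetric] W[OF that] ..
  moreover have "\<sigma> j h \<in> span (\<Lambda> ` ?I)" if "h \<in> N" "j \<in> {1..d}" for h j
    using vol_in_W[OF that(2), of h] W[OF that(1)] by simp
  ultimately show "\<exists>V \<Lambda>. openin (DAinf ev) V \<and> h\<^sub>0 \<in> V \<and> V \<subseteq> U \<and>
      (\<forall>i\<in>?I. \<Lambda> i \<in> topspace (DAinf ev)) \<and> lin_indep_family ?I \<Lambda> \<and>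
      (\<forall>h\<in>V. D_LA ev d l \<phi> h = span (insert (\<mu> h) (\<Lambda> ` ?I)) \<and> (\<forall>j\<in>{1..d}. \<sigma> j h \<in> span (\<Lambda> ` ?I)))"
    using N N0(3) unfolding DAinf_eq topspace_X by (intro exI[of _ N] exI[of _ \<Lambda>]) auto
qed

end
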